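(* The logic $\mathbf{IUL}^{fp}$ enjoys finite strong standard completeness: for every finite set $T$ of $\mathbf{IUL}^{fp}$-formulas and every $\mathbf{IUL}^{fp}$-formula $\varphi$, $T\vDash_{\mathbf{IUL}^{fp}}\varphi$ holds if and only if for every standard $\mathbf{IUL}^{fp}$-algebra $\mathbf A$ and every $\mathbf A$-model $e$ of $T$, $e$ is also an $\mathbf A$-model of $\varphi$.
   Context: An FL$_e$-algebra is a structure $(X,\wedge,\vee,*,\to,t,f)$ such that $(X,\wedge,\vee)$ is a lattice, $(X,\le,*,t)$ is a commutative monoid residuated with residual $\to$ (i.e. $x*y\le z$ iff $y\le x\to z$), and $f$ is an arbitrary constant; put $x'=x\to f$. It is involutive if $x''=x$ for all $x$, and odd if it is involutive and $t=f$. $\mathbf{IUL}$ is the Involutive Uninorm Logic of Metcalfe and Montagna (language $\wedge,\vee,\&,\to,\mathbf t,\mathbf f,\top,\bot$), whose algebraic semantics is given by bounded involutive FL$_e$-algebras (with $\top,\bot$ interpreted as the top and bottom elements); $\mathbf{IUL}^{fp}$ is $\mathbf{IUL}$ extended by the axiom $\mathbf t\leftrightarrow\mathbf f$, so that its algebras ($\mathbf{IUL}^{fp}$-algebras) are the bounded odd FL$_e$-algebras, and its linearly ordered algebras are the nontrivial bounded odd FL$_e$-chains. $T\vDash_{\mathbf{IUL}^{fp}}\varphi$ denotes the consequence relation of the logic (equivalently, semantic consequence over all $\mathbf{IUL}^{fp}$-algebras). A standard $\mathbf{IUL}^{fp}$-algebra is one whose lattice reduct is the real unit interval $[0,1]$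 with its usual order. An $\mathbf A$-model of a set of formulas is an evaluation into $\mathbf A$ under which every formula of the set takes a value $\ge t$. *)

theory Defs
  imports Complex_Main "HOL-Algebra.Group"
begin

section \<open>Bounded odd FL\<open>\<^sub>e\<close>-algebras\<close>

text \<open>The monoid reduct is that of HOL-Algebra: \<open>mult\<close> is the product \<open>*\<close> and \<open>one\<close> is
  the constant \<open>t\<close>.  All axioms are relativised to the carrier.\<close>

record 'a fle = "'a monoid" +
  meet :: "'a \<Rightarrow> 'a \<Rightarrow> 'a"
  join :: "'a \<Rightarrow> 'a \<Rightarrow> 'a"
  res :: "'a \<Rightarrow> 'a \<Rightarrow> 'a"
  falsum :: 'a

record 'a bounded_fle = "'a fle" +
  top_el :: 'a
  bot_el :: 'a

definition fle_le :: "('a, 'b) fle_scheme \<Rightarrow> 'a \<Rightarrow> 'a \<Rightarrow> bool" where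
  "fle_le A x y \<longleftrightarrow> meet A x y = x"

definition fle_neg :: "('a, 'b) fle_scheme \<Rightarrow> 'a \<Rightarrow> 'a" where
  "fle_neg A x = res A x (falsum A)"

locale FLe_algebra = comm_monoid A for A :: "('a, 'b) fle_scheme" (structure) +
  assumes meet_closed: "\<lbrakk>x \<in> carrier A; y \<in> carrier A\<rbrakk> \<Longrightarrow> meet A x y \<in> carrier A"
    and join_closed: "\<lbrakk>x \<in> carrier A; y \<in> carrier A\<rbrakk> \<Longrightarrow> join A x y \<in> carrier A"
    and res_closed: "\<lbrakk>x \<in> carrier A; y \<in> carrier A\<rbrakk> \<Longrightarrow> res A x y \<in> carrier A"
    and falsum_closed: "falsum A \<in> carrier A"
    and meet_commute: "\<lbrakk>x \<in> carrier A; y \<in> carrier A\<rbrakk> \<Longrightarrow> meet A x y = meet A y x"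
    and join_commute: "\<lbrakk>x \<in> carrier A; y \<in> carrier A\<rbrakk> \<Longrightarrow> join A x y = join A y x"
    and meet_assoc: "\<lbrakk>x \<in> carrier A; y \<in> carrier A; z \<in> carrier A\<rbrakk>
      \<Longrightarrow> meet A (meet A x y) z = meet A x (meet A y z)"
    and join_assoc: "\<lbrakk>x \<in> carrier A; y \<in> carrier A; z \<in> carrier A\<rbrakk>
      \<Longrightarrow> join A (join A x y) z = join A x (join A y z)"
    and meet_absorb: "\<lbrakk>x \<in> carrier A; y \<in> carrier A\<rbrakk> \<Longrightarrow> meet A x (join A x y) = x"
    and join_absorb: "\<lbrakk>x \<in> carrier A; y \<in> carrier A\<rbrakk> \<Longrightarrow> join A x (meet A x y) = x"
    and residuation: "\<lbrakk>x \<in> carrier A; y \<in> carrier A; z \<in> carrier A\<rbrakk>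
      \<Longrightarrow> fle_le A (x \<otimes> y) z \<longleftrightarrow> fle_le A y (res A x z)"

locale odd_FLe_algebra = FLe_algebra +
  assumes involutive: "x \<in> carrier A \<Longrightarrow> fle_neg A (fle_neg A x) = x"
    and odd: "\<one> = falsum A"

locale bounded_odd_FLe_algebra = odd_FLe_algebra A
    for A :: "('a, 'b) bounded_fle_scheme" (structure) +
  assumes top_closed: "top_el A \<in> carrier A"
    and bot_closed: "bot_el A \<in> carrier A"
    and top_greatest: "x \<in> carrier A \<Longrightarrow> fle_le A x (top_el A)"
    and bot_least: "x \<in> carrier A \<Longrightarrow> fle_le A (bot_el A) x"

definition standard_IULfp_algebra :: "real bounded_fle \<Rightarrow> bool" where
  "standard_IULfp_algebra A \<longleftrightarrow>
     bounded_odd_FLe_algebra A \<and>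
     carrier A = {0..1} \<and>
     (\<forall>x\<in>{0..1}. \<forall>y\<in>{0..1}. meet A x y = min x y \<and> join A x y = max x y)"


section \<open>Formulas, evaluations and models\<close>

datatype fm =
    Var nat
  | And fm fm (infixr "\<sqdot>\<and>" 75)
  | Or fm fm (infixr "\<sqdot>\<or>" 70)
  | Fuse fm fm (infixr "\<sqdot>&" 80)
  | Imp fm fm (infixr "\<sqdot>\<rightarrow>" 65)
  | Truth ("\<^bold>t")
  | Falsity ("\<^bold>f")
  | Top ("\<^bold>\<top>")
  | Bot ("\<^bold>\<bottom>")

definition Neg :: "fm \<Rightarrow> fm" where
  "Neg \<alpha> = \<alpha> \<sqdot>\<rightarrow> \<^bold>f"

definition Iff :: "fm \<Rightarrow> fm \<Rightarrow> fm" (infix "\<sqdot>\<leftrightarrow>" 60) where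
  "\<alpha> \<sqdot>\<leftrightarrow> \<beta> = (\<alpha> \<sqdot>\<rightarrow> \<beta>) \<sqdot>\<and> (\<beta> \<sqdot>\<rightarrow> \<alpha>)"

primrec eval_fm :: "('a, 'b) bounded_fle_scheme \<Rightarrow> (nat \<Rightarrow> 'a) \<Rightarrow> fm \<Rightarrow> 'a" where
  "eval_fm A e (Var n) = e n"
| "eval_fm A e (\<alpha> \<sqdot>\<and> \<beta>) = meet A (eval_fm A e \<alpha>) (eval_fm A e \<beta>)"
| "eval_fm A e (\<alpha> \<sqdot>\<or> \<beta>) = join A (eval_fm A e \<alpha>) (eval_fm A e \<beta>)"
| "eval_fm A e (\<alpha> \<sqdot>& \<beta>) = mult A (eval_fm A e \<alpha>) (eval_fm A e \<beta>)"
| "eval_fm A e (\<alpha> \<sqdot>\<rightarrow> \<beta>) = res A (eval_fm A e \<alpha>) (eval_fm A e \<beta>)"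
| "eval_fm A e \<^bold>t = one A"
| "eval_fm A e \<^bold>f = falsum A"
| "eval_fm A e \<^bold>\<top> = top_el A"
| "eval_fm A e \<^bold>\<bottom> = bot_el A"

definition is_model :: "('a, 'b) bounded_fle_scheme \<Rightarrow> (nat \<Rightarrow> 'a) \<Rightarrow> fm set \<Rightarrow> bool" where
  "is_model A e T \<longleftrightarrow>
     (\<forall>n. e n \<in> carrier A) \<and> (\<forall>\<alpha>\<in>T. fle_le A (one A) (eval_fm A e \<alpha>))"


section \<open>The logic\<close>

text \<open>The Hilbert system of Metcalfe and Montagna (Substructural fuzzy logics, J. Symb. Logic
  72, 2007) for \<open>IUL\<close>: the uninorm logic \<open>UL\<close>, which includes the prelinearity axiom
  \<open>PRL\<close>, extended by double negation elimination \<open>INV\<close>.  \<open>FP\<close> is the additional axiom of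
  \<open>IUL\<^sup>f\<^sup>p\<close>.  The algebras of this logic are thus the prelinear (semilinear)
  bounded odd FL\<open>\<^sub>e\<close>-algebras; its chains are the nontrivial bounded odd
  FL\<open>\<^sub>e\<close>-chains, where prelinearity is automatic.  Prelinearity cannot be
  dropped: it fails in the bounded odd FL\<open>\<^sub>e\<close>-algebra obtained from the two-element group
  by adding a bottom and a top below and above its two incomparable elements.\<close>

inductive_set IULfp_axioms :: "fm set" where
  L1: "\<alpha> \<sqdot>\<rightarrow> \<alpha> \<in> IULfp_axioms"
| L2: "(\<alpha> \<sqdot>\<rightarrow> \<beta>) \<sqdot>\<rightarrow> ((\<beta> \<sqdot>\<rightarrow> \<gamma>) \<sqdot>\<rightarrow> (\<alpha> \<sqdot>\<rightarrow> \<gamma>)) \<in> IULfp_axioms"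
| L3: "(\<alpha> \<sqdot>\<rightarrow> (\<beta> \<sqdot>\<rightarrow> \<gamma>)) \<sqdot>\<rightarrow> (\<beta> \<sqdot>\<rightarrow> (\<alpha> \<sqdot>\<rightarrow> \<gamma>)) \<in> IULfp_axioms"
| L4: "((\<alpha> \<sqdot>& \<beta>) \<sqdot>\<rightarrow> \<gamma>) \<sqdot>\<leftrightarrow> (\<alpha> \<sqdot>\<rightarrow> (\<beta> \<sqdot>\<rightarrow> \<gamma>)) \<in> IULfp_axioms"
| L5: "(\<alpha> \<sqdot>\<and> \<beta>) \<sqdot>\<rightarrow> \<alpha> \<in> IULfp_axioms"
| L6: "(\<alpha> \<sqdot>\<and> \<beta>) \<sqdot>\<rightarrow> \<beta> \<in> IULfp_axioms"
| L7: "((\<alpha> \<sqdot>\<rightarrow> \<beta>) \<sqdot>\<and> (\<alpha> \<sqdot>\<rightarrow> \<gamma>)) \<sqdot>\<rightarrow> (\<alpha> \<sqdot>\<rightarrow> (\<beta> \<sqdot>\<and> \<gamma>)) \<in> IULfp_axioms"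
| L8: "\<alpha> \<sqdot>\<rightarrow> (\<alpha> \<sqdot>\<or> \<beta>) \<in> IULfp_axioms"
| L9: "\<beta> \<sqdot>\<rightarrow> (\<alpha> \<sqdot>\<or> \<beta>) \<in> IULfp_axioms"
| L10: "((\<alpha> \<sqdot>\<rightarrow> \<gamma>) \<sqdot>\<and> (\<beta> \<sqdot>\<rightarrow> \<gamma>)) \<sqdot>\<rightarrow> ((\<alpha> \<sqdot>\<or> \<beta>) \<sqdot>\<rightarrow> \<gamma>) \<in> IULfp_axioms"
| L11: "\<alpha> \<sqdot>\<leftrightarrow> (\<^bold>t \<sqdot>\<rightarrow> \<alpha>) \<in> IULfp_axioms"
| L12: "\<^bold>\<bottom> \<sqdot>\<rightarrow> \<alpha> \<in> IULfp_axioms"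
| L13: "\<alpha> \<sqdot>\<rightarrow> \<^bold>\<top> \<in> IULfp_axioms"
| PRL: "((\<alpha> \<sqdot>\<rightarrow> \<beta>) \<sqdot>\<and> \<^bold>t) \<sqdot>\<or> ((\<beta> \<sqdot>\<rightarrow> \<alpha>) \<sqdot>\<and> \<^bold>t) \<in> IULfp_axioms"
| INV: "Neg (Neg \<alpha>) \<sqdot>\<rightarrow> \<alpha> \<in> IULfp_axioms"
| FP: "\<^bold>t \<sqdot>\<leftrightarrow> \<^bold>f \<in> IULfp_axioms"

inductive IULfp_consequence :: "fm set \<Rightarrow> fm \<Rightarrow> bool" (infix "\<Turnstile>\<^sub>I\<^sub>U\<^sub>L\<^sub>f\<^sub>p" 50)
  for T :: "fm set" where
  Hyp: "\<alpha> \<in> T \<Longrightarrow> T \<Turnstile>\<^sub>I\<^sub>U\<^sub>L\<^sub>f\<^sub>p \<alpha>"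
| Ax: "\<alpha> \<in> IULfp_axioms \<Longrightarrow> T \<Turnstile>\<^sub>I\<^sub>U\<^sub>L\<^sub>f\<^sub>p \<alpha>"
| MP: "\<lbrakk>T \<Turnstile>\<^sub>I\<^sub>U\<^sub>L\<^sub>f\<^sub>p \<alpha>; T \<Turnstile>\<^sub>I\<^sub>U\<^sub>L\<^sub>f\<^sub>p \<alpha> \<sqdot>\<rightarrow> \<beta>\<rbrakk> \<Longrightarrow> T \<Turnstile>\<^sub>I\<^sub>U\<^sub>L\<^sub>f\<^sub>p \<beta>"
| Adj: "\<lbrakk>T \<Turnstile>\<^sub>I\<^sub>U\<^sub>L\<^sub>f\<^sub>p \<alpha>; T \<Turnstile>\<^sub>I\<^sub>U\<^sub>L\<^sub>f\<^sub>p \<beta>\<rbrakk> \<Longrightarrow> T \<Turnstile>\<^sub>I\<^sub>U\<^sub>L\<^sub>f\<^sub>p \<alpha> \<sqdot>\<and> \<beta>"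

end

theory Submission
  imports Defs "HOL-Algebra.FiniteProduct" "HOL-Analysis.Analysis"
begin

text \<open>Completeness.  A formula that is not derivable from \<open>T\<close> is refuted in the chain of formulas modulo a
  theory that is maximal among those not deriving it.  In an odd chain \<open>\<tau> x = n (x \<cdot> n x)\<close> is the largest
  idempotent fixing \<open>x\<close>, and \<open>\<tau> (x \<cdot> y)\<close> is the larger of \<open>\<tau> x\<close> and \<open>\<tau> y\<close>.  So the finite set \<open>E\<close>
  of values that matter lives in finitely many layers, and \<open>E\<close> is embedded into an odd chain on the reals by
  induction on their number.  If \<open>u\<close> is the largest layer and \<open>d = n u\<close>, then either \<open>d \<cdot> d = d\<close>, and
  \<open>x \<mapsto> d \<cdot> x\<close> maps everything into an ordered abelian group with unit \<open>d\<close>; or \<open>d\<close> is invertible, and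
  \<open>x \<mapsto> u \<cdot> x\<close> maps everything into an ordered abelian group with unit \<open>u\<close> in which \<open>d\<close> is the largest
  element below the unit.  In both cases the fibre of this map is ordered like the chain of the lower layers with a
  top or a bottom added.  A finite part of the group embeds into the reals, respectively into the integers with
  \<open>d\<close> going to \<open>-1\<close>; hence \<open>E\<close> embeds into a lexicographic product which is again order isomorphic to the
  reals.  The embeddings of ordered groups come from the fact that finitely many positive elements lie in the
  nonnegative integer span of an independent set of positive elements.\<close>

section \<open>Integer cones are simplicial\<close>

text \<open>A finitely generated ordered abelian group need not be archimedean, so it may have no
  order embedding into the reals. Hence only the order on a finite set is kept, while additivity is
  kept on the whole subgroup generated by it: once the finitely many positive differences have
  nonnegative coordinates in an independent system, arbitrary positive weights on these coordinates
  preserve every strict inequality that matters. Rationally independent weights make the map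
  injective; weights 1 send a least positive element to 1. The induction on layers works with the
  real line and not with \<open>[0, 1]\<close>, because the lower layers are reinserted as many
  copies, each with a new end or two, and gluing these copies has to give the same order type again;
  for this they sit over a countable group of reals only. The bounds are put on at the very end,
  where the layer of the top element has a single fibre.\<close>

text \<open>\<open>N c\<close> stands for the nonnegativity of the combination \<open>\<Sum>i\<in>I. c i * g i\<close> of positive elements \<open>g i\<close>
  of an ordered abelian group.  All notions below are phrased in terms of \<open>N\<close>, so that the \<open>g i\<close> can be
  changed by changing \<open>N\<close>.\<close>

locale int_cone =
  fixes I :: "'i set" and N :: "('i \<Rightarrow> int) \<Rightarrow> bool"
  assumes fin: "finite I"
    and cong: "(\<forall>i\<in>I. c i = d i) \<Longrightarrow> N c = N d"
    and add: "N c \<Longrightarrow> N d \<Longrightarrow> N (\<lambda>k. c k + d k)"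
    and total: "N c \<or> N (\<lambda>k. - c k)"
    and pos: "i \<in> I \<Longrightarrow> \<not> N (\<lambda>k. - of_bool (k = i))"
begin

definition null :: "('i \<Rightarrow> int) \<Rightarrow> bool" where
  "null c \<longleftrightarrow> N c \<and> N (\<lambda>k. - c k)"

text \<open>\<open>g i\<close> is the least positive element. This is followed through all changes
  of generators for the sake of the embedding into the integers, where the coordinates of such an
  element have to add up to 1.\<close>

definition least :: "'i \<Rightarrow> bool" where
  "least i \<longleftrightarrow> (\<forall>c. \<not> N (\<lambda>k. - c k) \<longrightarrow> N (\<lambda>k. c k - of_bool (k = i)))"

lemma zero: "N (\<lambda>k. 0)"
  using total[of "\<lambda>k. 0"] by simp

lemma unit: "i \<in> I \<Longrightarrow> N (\<lambda>k. of_bool (k = i))"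
  using total[of "\<lambda>k. of_bool (k = i)"] pos by blast

lemma nonneg:
  assumes "\<And>k. k \<in> I \<Longrightarrow> c k \<ge> 0"
  shows "N c"
  using assms
proof (induction "\<Sum>k\<in>I. nat (c k)" arbitrary: c)
  case 0
  then have "\<forall>k\<in>I. c k \<le> 0" using fin by simp
  then have "\<forall>k\<in>I. c k = 0" using 0(2) by (simp add: order_antisym)
  then show ?case using zero cong[of c "\<lambda>k. 0"] by simp
next
  case (Suc s)
  have "\<exists>j\<in>I. c j > 0"
  proof (rule ccontr)
    assume "\<not> ?thesis"
    then have "(\<Sum>k\<in>I. nat (c k)) = 0" by (intro sum.neutral) (auto simp: not_less)
    then show False using Suc.hyps(2) by simp
  qed
  then obtain j where j: "j \<in> I" "c j > 0" by blast
  let ?d = "\<lambda>k. c k - of_bool (k = j)"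
  have "(\<Sum>k\<in>I. nat (c k)) = nat (c j) + (\<Sum>k\<in>I - {j}. nat (c k))"
    using j fin by (simp add: sum.remove)
  moreover have "(\<Sum>k\<in>I. nat (?d k)) = nat (c j - 1) + (\<Sum>k\<in>I - {j}. nat (c k))"
    using j fin by (simp add: sum.remove)
  ultimately have "s = (\<Sum>k\<in>I. nat (?d k))" using Suc.hyps(2) j by simp
  then have "N ?d" using Suc.hyps(1)[of ?d] Suc.prems j by auto
  from add[OF this unit[OF j(1)]] show ?case by simp
qed

lemma null_cong: "(\<forall>i\<in>I. c i = d i) \<Longrightarrow> null c = null d"
  using cong[of c d] cong[of "\<lambda>k. - c k" "\<lambda>k. - d k"] by (simp add: null_def)

lemma null_add: "null c \<Longrightarrow> null d \<Longrightarrow> null (\<lambda>k. c k + d k)"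
  using add[of c d] add[of "\<lambda>k. - c k" "\<lambda>k. - d k"] by (simp add: null_def)

lemma null_uminus: "null c \<Longrightarrow> null (\<lambda>k. - c k)"
  by (simp add: null_def)

lemma null_scale_nat: "null c \<Longrightarrow> null (\<lambda>k. int a * c k)"
proof (induction a)
  case 0
  then show ?case using zero by (simp add: null_def)
next
  case (Suc a)
  then show ?case using null_add[of c "\<lambda>k. int a * c k"] by (simp add: algebra_simps)
qed

lemma null_scale:
  assumes "null c" shows "null (\<lambda>k. a * c k)"
proof (cases "a \<ge> 0")
  case True
  then show ?thesis using null_scale_nat[OF assms, of "nat a"] by simp
next
  case False
  then show ?thesis using null_uminus[OF null_scale_nat[OF assms, of "nat (- a)"]] by simp
qed

text \<open>Otherwise \<open>c\<close> minus the unit vector at \<open>i\<close> is nonnegative, and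
  adding the null combination \<open>- c\<close> makes the negative of \<open>g i\<close>
  nonnegative. This supplies the second generator for each step of the Euclidean algorithm.\<close>

lemma null_ex_neg:
  assumes "null c" "i \<in> I" "c i > 0"
  shows "\<exists>j\<in>I. c j < 0"
proof (rule ccontr)
  assume "\<not> ?thesis"
  then have "N (\<lambda>k. c k - of_bool (k = i))" using assms(2,3) by (intro nonneg) force
  from add[OF this] have "N (\<lambda>k. - of_bool (k = i))"
    using assms(1) unfolding null_def by fastforce
  then show False using pos assms(2) by blast
qed

end

text \<open>\<open>M i\<close> are the coordinates of \<open>g i\<close> in an independent system of positive elements indexed by \<open>J\<close>.\<close>

definition simplicial :: "'i set \<Rightarrow> (('i \<Rightarrow> int) \<Rightarrow> bool) \<Rightarrow> bool" where
  "simplicial I N \<longleftrightarrow> (\<exists>(J :: 'i set) (M :: 'i \<Rightarrow> 'i \<Rightarrow> nat). finite J \<and>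
     (\<forall>i\<in>I. \<exists>j\<in>J. M i j > 0) \<and>
     (\<forall>c. int_cone.null N c \<longleftrightarrow> (\<forall>j\<in>J. (\<Sum>i\<in>I. c i * int (M i j)) = 0)) \<and>
     (\<forall>i\<in>I. int_cone.least N i \<longrightarrow> (\<Sum>j\<in>J. M i j) = 1))"

section \<open>Changing the generators of an integer cone\<close>

context int_cone
begin

text \<open>With no relation left the generators form the independent system themselves, and the
  coordinate matrix is the identity.\<close>

lemma simplicial_independent:
  assumes "\<And>c. null c \<Longrightarrow> \<forall>i\<in>I. c i = 0"
  shows "simplicial I N"
  unfolding simplicial_def
proof (intro exI conjI)
  let ?M = "\<lambda>i j. of_bool (i = j) :: nat"
  show "finite I" by (rule fin)
  show "\<forall>i\<in>I. \<exists>j\<in>I. ?M i j > 0" by auto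
  have "(\<Sum>i\<in>I. c i * int (?M i j)) = c j" if "j \<in> I" for c j
    using that fin by (simp add: if_distrib of_bool_def cong: if_cong)
  moreover have "null c" if "\<forall>i\<in>I. c i = 0" for c
    using that zero null_cong[of c "\<lambda>k. 0"] by (simp add: null_def)
  ultimately show "\<forall>c. null c \<longleftrightarrow> (\<forall>j\<in>I. (\<Sum>i\<in>I. c i * int (?M i j)) = 0)"
    using assms by auto
  show "\<forall>i\<in>I. least i \<longrightarrow> (\<Sum>j\<in>I. ?M i j) = 1"
    using fin by (simp add: if_distrib of_bool_def cong: if_cong)
qed

text \<open>For \<open>g i = g j\<close> the generator \<open>j\<close> is redundant.
  \<open>N'\<close> reads combinations of the others by giving \<open>j\<close> the coefficient 0,
  and on the way back \<open>j\<close> inherits the coordinates of \<open>i\<close>.\<close>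

lemma drop_generator:
  assumes ij: "i \<in> I" "j \<in> I" "i \<noteq> j"
    and eq: "null (\<lambda>k. of_bool (k = j) - of_bool (k = i))"
  defines "N' \<equiv> \<lambda>c. N (c(j := 0))"
  shows "int_cone (I - {j}) N'"
    and "simplicial (I - {j}) N' \<Longrightarrow> simplicial I N"
proof -
  have upd: "(\<lambda>k. - c k)(j := 0) = (\<lambda>k. - (c(j := 0)) k)" for c :: "'i \<Rightarrow> int" by auto
  show cone': "int_cone (I - {j}) N'"
  proof
    show "finite (I - {j})" using fin by simp
    show "N' c = N' d" if "\<forall>i\<in>I - {j}. c i = d i" for c d
      unfolding N'_def using that by (intro cong) auto
    show "N' (\<lambda>k. c k + d k)" if "N' c" "N' d" for c d
    proof -
      have "(\<lambda>k. c k + d k)(j := 0) = (\<lambda>k. (c(j := 0)) k + (d(j := 0)) k)" by auto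
      then show ?thesis using add that unfolding N'_def by metis
    qed
    show "N' c \<or> N' (\<lambda>k. - c k)" for c
      unfolding N'_def upd by (rule total)
    show "\<not> N' (\<lambda>k. - of_bool (k = l))" if "l \<in> I - {j}" for l
    proof -
      have "(\<lambda>k. - of_bool (k = l) :: int)(j := 0) = (\<lambda>k. - of_bool (k = l))" using that by auto
      then show ?thesis unfolding N'_def using pos that by auto
    qed
  qed
  interpret c': int_cone "I - {j}" N' by (rule cone')
  have null': "c'.null c = null (c(j := 0))" for c
    unfolding c'.null_def null_def unfolding N'_def upd ..
  assume "simplicial (I - {j}) N'"
  then obtain J :: "'i set" and M :: "'i \<Rightarrow> 'i \<Rightarrow> nat" where JM': "finite J"
    "\<forall>i\<in>I - {j}. \<exists>j\<in>J. M i j > 0"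
    "\<forall>c. c'.null c \<longleftrightarrow> (\<forall>l\<in>J. (\<Sum>k\<in>I - {j}. c k * int (M k l)) = 0)"
    "\<forall>i\<in>I - {j}. c'.least i \<longrightarrow> (\<Sum>l\<in>J. M i l) = 1"
    unfolding simplicial_def by (elim exE conjE) (rule that)
  note JM = JM'(1) JM'(2)[rule_format] JM'(3)[rule_format] JM'(4)[rule_format]
  let ?M = "M(j := M i)"
  \<comment> \<open>Because \<open>g i = g j\<close>, the coefficient of \<open>j\<close> may be
    moved to \<open>i\<close> without changing the value of the combination.\<close>
  have shift: "null c = null (c(i := c i + c j, j := 0))" for c
  proof -
    let ?d = "c(i := c i + c j, j := 0)"
    have d1: "null (\<lambda>k. c j * (of_bool (k = j) - of_bool (k = i)))"
      by (rule null_scale[OF eq])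
    have d2: "null (\<lambda>k. - c j * (of_bool (k = j) - of_bool (k = i)))"
      by (rule null_scale[OF eq])
    have e1: "(\<lambda>k. ?d k + c j * (of_bool (k = j) - of_bool (k = i))) = c"
      using ij by (auto simp: fun_eq_iff)
    have e2: "(\<lambda>k. c k + - c j * (of_bool (k = j) - of_bool (k = i))) = ?d"
      using ij by (auto simp: fun_eq_iff)
    show ?thesis using null_add[OF _ d1, of ?d] null_add[OF _ d2, of c] e1 e2 by metis
  qed
  have sum: "(\<Sum>k\<in>I. c k * int (?M k l)) = (\<Sum>k\<in>I - {j}. (c(i := c i + c j, j := 0)) k * int (M k l))"
    for c l
  proof -
    have "(\<Sum>k\<in>I. c k * int (?M k l)) = c j * int (?M j l) + (\<Sum>k\<in>I - {j}. c k * int (?M k l))"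
      using ij fin by (intro sum.remove)
    also have "(\<Sum>k\<in>I - {j}. c k * int (?M k l)) = (\<Sum>k\<in>I - {j}. c k * int (M k l))"
      by (intro sum.cong) auto
    also have "\<dots> = c i * int (M i l) + (\<Sum>k\<in>I - {j} - {i}. c k * int (M k l))"
      using ij fin by (intro sum.remove) auto
    also have "(\<Sum>k\<in>I - {j} - {i}. c k * int (M k l)) =
        (\<Sum>k\<in>I - {j} - {i}. (c(i := c i + c j, j := 0)) k * int (M k l))"
      by (rule sum.cong) auto
    also have "c j * int (?M j l) + (c i * int (M i l) + \<dots>) =
       (\<Sum>k\<in>I - {j}. (c(i := c i + c j, j := 0)) k * int (M k l))"
    proof -
      have "(\<Sum>k\<in>I - {j}. (c(i := c i + c j, j := 0)) k * int (M k l)) =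
        (c(i := c i + c j, j := 0)) i * int (M i l) +
        (\<Sum>k\<in>I - {j} - {i}. (c(i := c i + c j, j := 0)) k * int (M k l))"
        using ij fin by (intro sum.remove) auto
      then show ?thesis using ij by (simp add: algebra_simps)
    qed
    finally show ?thesis .
  qed
  have least': "c'.least k" if "least k" "k \<noteq> j" for k
    unfolding c'.least_def
  proof (intro allI impI)
    fix c assume "\<not> N' (\<lambda>k. - c k)"
    then have "\<not> N (\<lambda>k. - (c(j := 0)) k)" unfolding N'_def upd .
    then have "N (\<lambda>l. (c(j := 0)) l - of_bool (l = k))" using that unfolding least_def by blast
    moreover have "(\<lambda>l. (c(j := 0)) l - of_bool (l = k)) = (\<lambda>l. c l - of_bool (l = k))(j := 0)"
      using that by auto
    ultimately show "N' (\<lambda>l. c l - of_bool (l = k))" unfolding N'_def by simp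
  qed
  have leasti: "least i" if "least j"
    unfolding least_def
  proof (intro allI impI)
    fix c assume "\<not> N (\<lambda>k. - c k)"
    then have "N (\<lambda>k. c k - of_bool (k = j))" using that unfolding least_def by blast
    from add[OF this] eq have "N (\<lambda>k. c k - of_bool (k = j) + (of_bool (k = j) - of_bool (k = i)))"
      unfolding null_def by blast
    then show "N (\<lambda>k. c k - of_bool (k = i))" by simp
  qed
  show "simplicial I N"
    unfolding simplicial_def
  proof (intro exI conjI)
    show "finite J" by fact
    show "\<forall>k\<in>I. \<exists>l\<in>J. ?M k l > 0" using JM(2) ij by auto
    show "\<forall>c. null c \<longleftrightarrow> (\<forall>l\<in>J. (\<Sum>k\<in>I. c k * int (?M k l)) = 0)"
    proof (intro allI)
      fix c
      have "null c \<longleftrightarrow> c'.null (c(i := c i + c j, j := 0))"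
        unfolding null' using shift[of c] by (simp add: fun_upd_idem)
      then show "null c \<longleftrightarrow> (\<forall>l\<in>J. (\<Sum>k\<in>I. c k * int (?M k l)) = 0)"
        unfolding JM(3) sum .
    qed
    show "\<forall>k\<in>I. least k \<longrightarrow> (\<Sum>l\<in>J. ?M k l) = 1"
      using JM(4) least' leasti ij by auto
  qed
qed

text \<open>\<open>N'\<close> belongs to the generators in which \<open>g j\<close> is replaced by
  \<open>g j - g i\<close>, positive by \<open>less\<close>: expanding a combination of them lowers
  the coefficient of \<open>g i\<close> by \<open>c j\<close>. Conversely
  \<open>g j = (g j - g i) + g i\<close>, so its coordinates are the sum of two rows, which keeps
  them nonnegative.\<close>

lemma subtract_generator:
  assumes ij: "i \<in> I" "j \<in> I" "i \<noteq> j"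
    and less: "\<not> N (\<lambda>k. of_bool (k = i) - of_bool (k = j))"
  defines "N' \<equiv> \<lambda>c. N (c(i := c i - c j))"
  shows "int_cone I N'"
    and "int_cone.null N' c \<longleftrightarrow> null (c(i := c i - c j))"
    and "simplicial I N' \<Longrightarrow> simplicial I N"
proof -
  have upd: "(\<lambda>k. - c k)(i := - c i - - c j) = (\<lambda>k. - (c(i := c i - c j)) k)" for c :: "'i \<Rightarrow> int"
    by auto
  show cone': "int_cone I N'"
  proof
    show "finite I" by (rule fin)
    show "N' c = N' d" if "\<forall>i\<in>I. c i = d i" for c d
      unfolding N'_def using that ij by (intro cong) auto
    show "N' (\<lambda>k. c k + d k)" if "N' c" "N' d" for c d
    proof -
      have "(\<lambda>k. c k + d k)(i := c i + d i - (c j + d j)) =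
          (\<lambda>k. (c(i := c i - c j)) k + (d(i := d i - d j)) k)" by auto
      then show ?thesis using add that unfolding N'_def by metis
    qed
    show "N' c \<or> N' (\<lambda>k. - c k)" for c
      unfolding N'_def upd by (rule total)
    show "\<not> N' (\<lambda>k. - of_bool (k = l))" if "l \<in> I" for l
    proof (cases "l = j")
      case True
      have "(\<lambda>k. - of_bool (k = l) :: int)(i := - of_bool (i = l) - - of_bool (j = l))
          = (\<lambda>k. of_bool (k = i) - of_bool (k = j))" using True ij by (auto simp: fun_eq_iff)
      then show ?thesis unfolding N'_def using less by simp
    next
      case False
      have "(\<lambda>k. - of_bool (k = l) :: int)(i := - of_bool (i = l) - - of_bool (j = l))
          = (\<lambda>k. - of_bool (k = l))" using False ij by (auto simp: fun_eq_iff)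
      then show ?thesis unfolding N'_def using pos that by simp
    qed
  qed
  interpret c': int_cone I N' by (rule cone')
  show null': "c'.null c = null (c(i := c i - c j))" for c
    unfolding c'.null_def null_def unfolding N'_def upd ..
  assume "simplicial I N'"
  then obtain J :: "'i set" and M :: "'i \<Rightarrow> 'i \<Rightarrow> nat" where JM': "finite J"
    "\<forall>i\<in>I. \<exists>j\<in>J. M i j > 0"
    "\<forall>c. c'.null c \<longleftrightarrow> (\<forall>l\<in>J. (\<Sum>k\<in>I. c k * int (M k l)) = 0)"
    "\<forall>i\<in>I. c'.least i \<longrightarrow> (\<Sum>l\<in>J. M i l) = 1"
    unfolding simplicial_def by (elim exE conjE) (rule that)
  note JM = JM'(1) JM'(2)[rule_format] JM'(3)[rule_format] JM'(4)[rule_format]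
  let ?M = "M(j := \<lambda>l. M j l + M i l)"
  have sum: "(\<Sum>k\<in>I. c k * int (?M k l)) = (\<Sum>k\<in>I. (c(i := c i + c j)) k * int (M k l))"
    for c l
  proof -
    have "(\<Sum>k\<in>I. c k * int (?M k l)) = (\<Sum>k\<in>I. c k * int (M k l) + of_bool (k = j) * c j * int (M i l))"
      by (rule sum.cong) (auto simp: algebra_simps)
    also have "\<dots> = (\<Sum>k\<in>I. c k * int (M k l)) + c j * int (M i l)"
      using ij fin by (simp add: sum.distrib of_bool_def if_distrib[of "\<lambda>x. x * _"] cong: if_cong)
    also have "\<dots> = (\<Sum>k\<in>I. c k * int (M k l) + of_bool (k = i) * c j * int (M i l))"
      using ij fin by (simp add: sum.distrib of_bool_def if_distrib[of "\<lambda>x. x * _"] cong: if_cong)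
    also have "\<dots> = (\<Sum>k\<in>I. (c(i := c i + c j)) k * int (M k l))"
      by (rule sum.cong) (auto simp: algebra_simps)
    finally show ?thesis .
  qed
  have least': "c'.least k" if "least k" "k \<noteq> j" for k
    unfolding c'.least_def
  proof (intro allI impI)
    fix c assume "\<not> N' (\<lambda>k. - c k)"
    then have "\<not> N (\<lambda>k. - (c(i := c i - c j)) k)" unfolding N'_def upd .
    then have "N (\<lambda>l. (c(i := c i - c j)) l - of_bool (l = k))" using that unfolding least_def by blast
    moreover have "(\<lambda>l. (c(i := c i - c j)) l - of_bool (l = k)) =
        (\<lambda>l. c l - of_bool (l = k))(i := c i - of_bool (i = k) - (c j - of_bool (j = k)))"
      using that by auto
    ultimately show "N' (\<lambda>l. c l - of_bool (l = k))" unfolding N'_def by simp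
  qed
  \<comment> \<open>The new row of \<open>j\<close> has sum at least 2. This is allowed, since
    \<open>g i\<close> is positive and smaller than \<open>g j\<close>.\<close>
  have notj: "\<not> least j"
  proof
    assume "least j"
    then have "N (\<lambda>k. of_bool (k = i) - of_bool (k = j))"
      using pos[OF ij(1)] unfolding least_def by (elim allE impE)
    then show False using less by contradiction
  qed
  show "simplicial I N"
    unfolding simplicial_def
  proof (intro exI conjI)
    show "finite J" by fact
    show "\<forall>k\<in>I. \<exists>l\<in>J. ?M k l > 0" using JM(2) ij by fastforce
    show "\<forall>c. null c \<longleftrightarrow> (\<forall>l\<in>J. (\<Sum>k\<in>I. c k * int (?M k l)) = 0)"
    proof (intro allI)
      fix c
      have "null c \<longleftrightarrow> c'.null (c(i := c i + c j))"
        unfolding null' using ij by simp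
      then show "null c \<longleftrightarrow> (\<forall>l\<in>J. (\<Sum>k\<in>I. c k * int (?M k l)) = 0)"
        unfolding JM(3) sum .
    qed
    show "\<forall>k\<in>I. least k \<longrightarrow> (\<Sum>l\<in>J. ?M k l) = 1"
      using JM(4) least' notj by auto
  qed
qed

end

text \<open>A Euclidean algorithm on a relation \<open>c\<close> between the generators: of two generators whose coefficients have
  opposite signs, the smaller one is subtracted from the larger one, and its own coefficient is replaced by the sum
  of the two.  If one of the two coefficients is maximal, this lowers the number of maximal coefficients or the
  number of coefficients of the opposite sign.\<close>

lemma simplicial_step:
  fixes N :: "('i \<Rightarrow> int) \<Rightarrow> bool"
  assumes "int_cone I N" "int_cone.null N c" "i \<in> I" "c i > 0" "\<forall>k\<in>I. \<bar>c k\<bar> \<le> c i"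
    and IH: "\<And>I' N'. I' \<subset> I \<Longrightarrow> int_cone I' N' \<Longrightarrow> simplicial I' (N' :: ('i \<Rightarrow> int) \<Rightarrow> bool)"
  shows "simplicial I N"
  using assms(1-5)
proof (induction "(N, c, i)" arbitrary: N c i rule: wf_induct_rule[OF wf_measures[where fs =
      "[\<lambda>(N, c, i). nat (c i), \<lambda>(N, c, i). card {k\<in>I. \<bar>c k\<bar> = c i}, \<lambda>(N, c, i). card {k\<in>I. c k < 0}]"]])
  case (1 N c i)
  interpret int_cone I N by (rule 1(2))
  obtain j where j: "j \<in> I" "c j < 0" using null_ex_neg 1 by blast
  have ij: "i \<noteq> j" using j 1 by auto
  show ?case
  proof (cases "N (\<lambda>k. of_bool (k = j) - of_bool (k = i))")
    case ji: True
    show ?thesis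
    proof (cases "N (\<lambda>k. of_bool (k = i) - of_bool (k = j))")
      case True
      then have "null (\<lambda>k. of_bool (k = j) - of_bool (k = i))"
        using ji by (simp add: null_def)
      from drop_generator[OF 1(4) j(1) ij this] IH j(1) show ?thesis by blast
    next
      case False
      let ?N = "\<lambda>c. N (c(i := c i - c j))" and ?c = "c(i := c i + c j)"
      note sub = subtract_generator[OF 1(4) j(1) ij False]
      have null': "int_cone.null ?N ?c" unfolding sub(2) using 1(3) ij by simp
      \<comment> \<open>The coefficient of \<open>i\<close> has shrunk, so the pivot moves to an
        index \<open>l\<close> of largest modulus; \<open>d\<close> is the relation with its sign
        chosen to make the coefficient of \<open>l\<close> positive. Either the maximum falls, or
        \<open>i\<close> has left the set of indices attaining it.\<close>
      define mx where "mx = Max ((\<lambda>k. \<bar>?c k\<bar>) ` I)"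
      have mx_ge: "\<bar>?c k\<bar> \<le> mx" if "k \<in> I" for k unfolding mx_def using that fin by (intro Max_ge) auto
      have "mx \<in> (\<lambda>k. \<bar>?c k\<bar>) ` I" unfolding mx_def using fin j by (intro Max_in) auto
      then obtain l where l: "l \<in> I" "mx = \<bar>?c l\<bar>" by auto
      have ci: "\<bar>?c i\<bar> < c i" using j 1(5,6) by (auto dest: bspec[of _ _ j])
      have le: "\<bar>?c k\<bar> \<le> c i" if "k \<in> I" for k using 1(6) ci that by (cases "k = i") auto
      have mpos: "mx > 0" using mx_ge[OF j(1)] j(2) ij by auto
      obtain d where d: "d = ?c \<or> d = (\<lambda>k. - ?c k)" "d l = mx" "int_cone.null ?N d"
        using null' int_cone.null_uminus[OF sub(1) null'] l(2) by (cases "?c l \<ge> 0") fastforce+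
      have dabs: "\<bar>d k\<bar> = \<bar>?c k\<bar>" for k using d(1) by auto
      have "((?N, d, l), (N, c, i)) \<in> measures [\<lambda>(N, c, i). nat (c i),
          \<lambda>(N, c, i). card {k\<in>I. \<bar>c k\<bar> = c i}, \<lambda>(N, c, i). card {k\<in>I. c k < 0}]"
      proof (cases "mx < c i")
        case True
        then show ?thesis using d(2) mpos by simp
      next
        case False
        then have eq: "mx = c i" using le[OF l(1)] l(2) by simp
        have "{k\<in>I. \<bar>d k\<bar> = d l} \<subset> {k\<in>I. \<bar>c k\<bar> = c i}"
          unfolding dabs d(2) eq using ci 1(4,5) by (auto simp: set_eq_iff psubset_eq split: if_splits)
        then have "card {k\<in>I. \<bar>d k\<bar> = d l} < card {k\<in>I. \<bar>c k\<bar> = c i}"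
          using fin by (intro psubset_card_mono) auto
        then show ?thesis using d(2) eq by simp
      qed
      from 1(1)[OF this sub(1) d(3) l(1)] d(2) mpos mx_ge dabs have "simplicial I ?N" by simp
      then show ?thesis by (rule sub(3))
    qed
  next
    case False
    \<comment> \<open>Now \<open>g i\<close> is the larger one. The pivot keeps its coefficient, and
      \<open>j\<close> leaves the set of negative coefficients.\<close>
    let ?N = "\<lambda>c. N (c(j := c j - c i))" and ?c = "c(j := c j + c i)"
    note sub = subtract_generator[OF j(1) 1(4) ij[symmetric] False]
    have null': "int_cone.null ?N ?c" unfolding sub(2) using 1(3) ij by simp
    have le: "\<forall>k\<in>I. \<bar>?c k\<bar> \<le> ?c i" using 1(5,6) j ij by (auto dest: bspec[of _ _ j])
    have "\<bar>?c j\<bar> < c i" "?c j \<ge> 0" using 1(5,6) j ij by (auto dest: bspec[of _ _ j])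
    then have "{k\<in>I. \<bar>?c k\<bar> = ?c i} \<subseteq> {k\<in>I. \<bar>c k\<bar> = c i}"
      "{k\<in>I. ?c k < 0} \<subset> {k\<in>I. c k < 0}"
      using j ij by (auto simp: psubset_eq set_eq_iff split: if_splits)
    then have "card {k\<in>I. \<bar>?c k\<bar> = ?c i} \<le> card {k\<in>I. \<bar>c k\<bar> = c i}"
      "card {k\<in>I. ?c k < 0} < card {k\<in>I. c k < 0}"
      using fin by (auto intro!: card_mono psubset_card_mono)
    then have "((?N, ?c, i), (N, c, i)) \<in> measures [\<lambda>(N, c, i). nat (c i),
          \<lambda>(N, c, i). card {k\<in>I. \<bar>c k\<bar> = c i}, \<lambda>(N, c, i). card {k\<in>I. c k < 0}]"
      using ij by (auto simp del: fun_upd_apply simp: fun_upd_other)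
    from 1(1)[OF this sub(1) null' 1(4) _ le] 1(5) ij have "simplicial I ?N" by simp
    then show ?thesis by (rule sub(3))
  qed
qed

text \<open>Induction on the number of generators: from a nontrivial relation the Euclidean
  algorithm reaches two equal generators, one of which is then dropped; the process ends when no
  relation is left.\<close>

theorem int_cone_simplicial:
  assumes "int_cone I N"
  shows "simplicial I N"
  using int_cone.fin[OF assms] assms
proof (induction arbitrary: N rule: finite_psubset_induct)
  case (psubset I)
  interpret int_cone I N by fact
  show ?case
  proof (cases "\<exists>c. null c \<and> (\<exists>i\<in>I. c i \<noteq> 0)")
    case False
    then show ?thesis by (intro simplicial_independent) blast
  next
    case True
    then obtain c i where c: "null c" "i \<in> I" "c i \<noteq> 0" by blast
    define mx where "mx = Max ((\<lambda>k. \<bar>c k\<bar>) ` I)"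
    have mx_ge: "\<bar>c k\<bar> \<le> mx" if "k \<in> I" for k unfolding mx_def using that fin by (intro Max_ge) auto
    have "mx \<in> (\<lambda>k. \<bar>c k\<bar>) ` I" unfolding mx_def using fin c by (intro Max_in) auto
    then obtain l where l: "l \<in> I" "mx = \<bar>c l\<bar>" by auto
    have mpos: "mx > 0" using mx_ge[OF c(2)] c(3) by linarith
    obtain d where d: "d = c \<or> d = (\<lambda>k. - c k)" "d l = mx" "null d"
      using c null_uminus[OF c(1)] l(2) by (cases "c l \<ge> 0") fastforce+
    have dabs: "\<bar>d k\<bar> = \<bar>c k\<bar>" for k using d(1) by auto
    show ?thesis
      by (rule simplicial_step[OF psubset.prems d(3) l(1)]) (use d(2) mpos mx_ge dabs psubset.IH in auto)
  qed
qed

section \<open>Finite sets in ordered abelian groups\<close>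

text \<open>A new real only has to avoid the rational span of the earlier ones. That span is the
  countable set \<open>D\<close>, and an open interval is uncountable.\<close>

lemma independent_reals:
  assumes "finite J"
  shows "\<exists>\<rho> :: 'i \<Rightarrow> real. (\<forall>j\<in>J. \<rho> j > 0) \<and>
    (\<forall>k :: 'i \<Rightarrow> int. (\<Sum>j\<in>J. of_int (k j) * \<rho> j) = 0 \<longrightarrow> (\<forall>j\<in>J. k j = (0 :: int)))"
  using assms
proof (induction J rule: finite_induct)
  case empty
  then show ?case by auto
next
  case (insert i J)
  from insert(3) obtain \<rho> :: "'i \<Rightarrow> real" where \<rho>: "\<forall>j\<in>J. \<rho> j > 0"
    "\<forall>k :: 'i \<Rightarrow> int. (\<Sum>j\<in>J. of_int (k j) * \<rho> j) = 0 \<longrightarrow> (\<forall>j\<in>J. k j = (0 :: int))"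
    by (elim exE conjE) (rule that)
  define D where "D = (\<lambda>(k, m :: int). - (\<Sum>j\<in>J. of_int (k j) * \<rho> j) / of_int m) ` (PiE J (\<lambda>_. UNIV :: int set) \<times> UNIV)"
  have "countable D"
    unfolding D_def using insert(1) by (intro countable_image countable_SIGMA countable_PiE) auto
  then have "\<not> {0<..<1 :: real} \<subseteq> D"
    using uncountable_open_interval[of "0::real" 1] countable_subset by auto
  then obtain x where x: "0 < x" "x \<notin> D" by (auto simp: subset_eq)
  show ?case
  proof (intro exI[of _ "\<rho>(i := x)"] conjI ballI allI impI)
    show "0 < (\<rho>(i := x)) j" if "j \<in> insert i J" for j using that \<rho> x by auto
  next
    fix k :: "'i \<Rightarrow> int" and j
    assume 0: "(\<Sum>j\<in>insert i J. k j * (\<rho>(i := x)) j) = 0" and j: "j \<in> insert i J"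
    have "(\<Sum>j\<in>J. k j * (\<rho>(i := x)) j) = (\<Sum>j\<in>J. of_int (k j) * \<rho> j)"
      using insert(2) by (intro sum.cong) auto
    then have eq: "k i * x = - (\<Sum>j\<in>J. of_int (k j) * \<rho> j)"
      using 0 insert(1,2) by simp
    have "k i = 0"
    proof (rule ccontr)
      assume "k i \<noteq> 0"
      then have "x = - (\<Sum>j\<in>J. of_int (k j) * \<rho> j) / k i" using eq by (simp add: field_simps)
      also have "(\<Sum>j\<in>J. of_int (k j) * \<rho> j) = (\<Sum>j\<in>J. restrict k J j * \<rho> j)" by (intro sum.cong) auto
      finally have "x = (\<lambda>(k, m :: int). - (\<Sum>j\<in>J. of_int (k j) * \<rho> j) / of_int m) (restrict k J, k i)"
        by simp
      moreover have "(restrict k J, k i) \<in> PiE J (\<lambda>_. UNIV :: int set) \<times> UNIV" by auto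
      ultimately show False using x(2) unfolding D_def by (metis (no_types, lifting) imageI)
    qed
    then show "k j = 0" using \<rho>(2)[rule_format, of k] eq j by auto
  qed
qed

section \<open>Integer coordinates on a finitely generated subgroup\<close>

locale ordered_comm_group = comm_group G for G :: "('a, 'b) monoid_scheme" (structure) +
  fixes le :: "'a \<Rightarrow> 'a \<Rightarrow> bool" (infix "\<preceq>" 50)
  assumes le_antisym: "\<lbrakk>x \<in> carrier G; y \<in> carrier G; x \<preceq> y; y \<preceq> x\<rbrakk> \<Longrightarrow> x = y"
    and le_trans: "\<lbrakk>x \<in> carrier G; y \<in> carrier G; z \<in> carrier G; x \<preceq> y; y \<preceq> z\<rbrakk> \<Longrightarrow> x \<preceq> z"
    and le_total: "\<lbrakk>x \<in> carrier G; y \<in> carrier G\<rbrakk> \<Longrightarrow> x \<preceq> y \<or> y \<preceq> x"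
    and le_mult: "\<lbrakk>x \<in> carrier G; y \<in> carrier G; z \<in> carrier G; x \<preceq> y\<rbrakk> \<Longrightarrow> x \<otimes> z \<preceq> y \<otimes> z"
begin

definition power_prod :: "'a set \<Rightarrow> ('a \<Rightarrow> int) \<Rightarrow> 'a" where
  "power_prod P c = (\<Otimes>p\<in>P. p [^] c p)"

context
  fixes P
  assumes P: "finite P" "P \<subseteq> carrier G"
begin

lemma power_prod_closed [simp]: "power_prod P c \<in> carrier G"
  unfolding power_prod_def using P by (intro finprod_closed) auto

lemma power_prod_add: "power_prod P (\<lambda>k. c k + d k) = power_prod P c \<otimes> power_prod P d"
proof -
  have "power_prod P (\<lambda>k. c k + d k) = (\<Otimes>p\<in>P. p [^] c p \<otimes> p [^] d p)"
    unfolding power_prod_def using P by (intro finprod_cong') (auto simp: int_pow_mult subset_eq)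
  also have "\<dots> = power_prod P c \<otimes> power_prod P d"
    unfolding power_prod_def using P by (intro finprod_multf) auto
  finally show ?thesis .
qed

lemma power_prod_cong: "(\<forall>k\<in>P. c k = d k) \<Longrightarrow> power_prod P c = power_prod P d"
  unfolding power_prod_def using P by (intro finprod_cong') auto

lemma power_prod_zero: "power_prod P (\<lambda>k. 0) = \<one>"
  unfolding power_prod_def by simp

lemma power_prod_uminus: "power_prod P (\<lambda>k. - c k) = inv (power_prod P c)"
proof -
  have "power_prod P (\<lambda>k. - c k) \<otimes> power_prod P c = \<one>"
    using power_prod_add[of "\<lambda>k. - c k" c] power_prod_zero by simp
  then show ?thesis by (simp add: inv_equality)
qed

lemma power_prod_of_bool: "p \<in> P \<Longrightarrow> power_prod P (\<lambda>k. of_bool (k = p)) = p"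
proof -
  assume p: "p \<in> P"
  have "power_prod P (\<lambda>k. of_bool (k = p)) = (\<Otimes>k\<in>P. if p = k then k else \<one>)"
    unfolding power_prod_def using P by (intro finprod_cong') (auto simp: subset_eq)
  also have "\<dots> = p" using P p by (intro finprod_singleton) auto
  finally show ?thesis .
qed

end

lemma one_le_mult:
  assumes "x \<in> carrier G" "y \<in> carrier G" "\<one> \<preceq> x" "\<one> \<preceq> y"
  shows "\<one> \<preceq> x \<otimes> y"
  using le_mult[of \<one> x y] le_trans[of \<one> y "x \<otimes> y"] assms by simp

lemma one_le_inv:
  assumes "x \<in> carrier G"
  shows "\<one> \<preceq> inv x \<longleftrightarrow> x \<preceq> \<one>"
  using le_mult[of \<one> "inv x" x] le_mult[of x \<one> "inv x"] assms by auto

lemma one_le_diff: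
  assumes "x \<in> carrier G" "y \<in> carrier G"
  shows "\<one> \<preceq> x \<otimes> inv y \<longleftrightarrow> y \<preceq> x" "x \<otimes> inv y \<preceq> \<one> \<longleftrightarrow> x \<preceq> y"
  using le_mult[of \<one> "x \<otimes> inv y" y] le_mult[of y x "inv y"]
    le_mult[of "x \<otimes> inv y" \<one> y] le_mult[of x y "inv y"] assms
  by (auto simp: m_assoc)

lemma int_cone_power_prod:
  assumes "finite P" "P \<subseteq> carrier G" "\<And>p. p \<in> P \<Longrightarrow> \<not> p \<preceq> \<one>"
  shows "int_cone P (\<lambda>c. \<one> \<preceq> power_prod P c)"
proof
  note [simp] = power_prod_closed[OF assms(1,2)]
  fix c d :: "'a \<Rightarrow> int" and p
  show "\<forall>k\<in>P. c k = d k \<Longrightarrow> (\<one> \<preceq> power_prod P c) = (\<one> \<preceq> power_prod P d)"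
    using power_prod_cong[OF assms(1,2)] by metis
  show "\<one> \<preceq> power_prod P c \<Longrightarrow> \<one> \<preceq> power_prod P d \<Longrightarrow> \<one> \<preceq> power_prod P (\<lambda>k. c k + d k)"
    by (simp add: power_prod_add[OF assms(1,2)] one_le_mult)
  show "\<one> \<preceq> power_prod P c \<or> \<one> \<preceq> power_prod P (\<lambda>k. - c k)"
    using le_total[of \<one> "power_prod P c"] by (simp add: power_prod_uminus[OF assms(1,2)] one_le_inv)
  show "p \<in> P \<Longrightarrow> \<not> \<one> \<preceq> power_prod P (\<lambda>k. - of_bool (k = p))"
    using assms by (simp add: power_prod_uminus[OF assms(1,2)] power_prod_of_bool[OF assms(1,2)] one_le_inv subset_eq)
qed (use assms in simp)

text \<open>The cone is generated by the positive differences \<open>P\<close> of elements of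
  \<open>E\<close>, not by \<open>E\<close>: a strict inequality in \<open>E\<close> thereby becomes
  a coordinatewise one, and the order on \<open>E\<close> survives every choice of positive weights.
  \<open>\<one> \<in> E\<close> puts each other element of \<open>E\<close> or its inverse into
  \<open>P\<close>, hence \<open>E\<close> into the group \<open>K\<close> generated by
  \<open>P\<close>.\<close>

lemma integer_coordinates:
  assumes E: "finite E" "E \<subseteq> carrier G" "\<one> \<in> E"
  shows "\<exists>K J (W :: 'a \<Rightarrow> 'a \<Rightarrow> int). finite J \<and> subgroup K G \<and> E \<subseteq> K \<and> countable K \<and>
    (\<forall>x\<in>K. \<forall>y\<in>K. \<forall>j\<in>J. W (x \<otimes> y) j = W x j + W y j) \<and>
    (\<forall>x\<in>K. (\<forall>j\<in>J. W x j = 0) \<longrightarrow> x = \<one>) \<and>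
    (\<forall>x\<in>E. \<forall>y\<in>E. \<not> x \<preceq> y \<longrightarrow> (\<forall>j\<in>J. W y j \<le> W x j) \<and> (\<exists>j\<in>J. W y j < W x j)) \<and>
    (\<forall>x\<in>E. \<not> x \<preceq> \<one> \<longrightarrow> (\<forall>y\<in>carrier G. \<not> y \<preceq> \<one> \<longrightarrow> x \<preceq> y) \<longrightarrow> (\<Sum>j\<in>J. W x j) = 1)"
proof -
  define P where "P = (\<lambda>(x, y). x \<otimes> inv y) ` {(x, y). x \<in> E \<and> y \<in> E \<and> \<not> x \<preceq> y}"
  have "finite {(x, y). x \<in> E \<and> y \<in> E \<and> \<not> x \<preceq> y}"
    by (rule finite_subset[of _ "E \<times> E"]) (use E in auto)
  then have finP: "finite P" unfolding P_def by simp
  have PG: "P \<subseteq> carrier G" unfolding P_def using E by auto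
  have Ppos: "\<not> p \<preceq> \<one>" if "p \<in> P" for p
    using that E one_le_diff(2) unfolding P_def by auto
  let ?\<psi> = "power_prod P"
  note [simp] = power_prod_closed[OF finP PG]
  note \<psi>_add = power_prod_add[OF finP PG] and \<psi>_uminus = power_prod_uminus[OF finP PG]
    and \<psi>_bool = power_prod_of_bool[OF finP PG] and \<psi>_zero = power_prod_zero[OF finP PG]
  define N where "N = (\<lambda>c. \<one> \<preceq> ?\<psi> c)"
  have cone: "int_cone P N" unfolding N_def using finP PG Ppos by (rule int_cone_power_prod)
  interpret int_cone P N by (rule cone)
  from int_cone_simplicial[OF cone] obtain J :: "'a set" and M :: "'a \<Rightarrow> 'a \<Rightarrow> nat" where JM: "finite J"
    "\<forall>i\<in>P. \<exists>j\<in>J. M i j > 0"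
    "\<forall>c. null c \<longleftrightarrow> (\<forall>l\<in>J. (\<Sum>k\<in>P. c k * int (M k l)) = 0)"
    "\<forall>i\<in>P. least i \<longrightarrow> (\<Sum>l\<in>J. M i l) = 1"
    unfolding simplicial_def by (elim exE conjE) (rule that)
  have null_iff: "null c \<longleftrightarrow> ?\<psi> c = \<one>" for c
  proof -
    have refl1: "\<one> \<preceq> \<one>" using le_total[of \<one> \<one>] by simp
    have "null c \<longleftrightarrow> \<one> \<preceq> ?\<psi> c \<and> ?\<psi> c \<preceq> \<one>"
      unfolding null_def unfolding N_def by (simp add: \<psi>_uminus one_le_inv)
    then show ?thesis using le_antisym[of \<one> "?\<psi> c"] refl1 by auto
  qed
  define K where "K = range ?\<psi>"
  define S where "S = (\<lambda>c j. \<Sum>p\<in>P. c p * int (M p j))"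
  \<comment> \<open>The exponents representing an element are not unique; two choices differ by a
    null combination, whose coordinates vanish, so the coordinates do not depend on the
    choice.\<close>
  define W where "W = (\<lambda>x. S (SOME c. ?\<psi> c = x))"
  have W: "W (?\<psi> c) j = S c j" if "j \<in> J" for c j
  proof -
    let ?d = "SOME d. ?\<psi> d = ?\<psi> c"
    have d: "?\<psi> ?d = ?\<psi> c" by (rule someI[of _ c]) simp
    have "?\<psi> (\<lambda>k. ?d k + - c k) = \<one>"
      unfolding \<psi>_add \<psi>_uminus d by simp
    then have "null (\<lambda>k. ?d k + - c k)" by (simp only: null_iff)
    then have "(\<Sum>k\<in>P. (?d k + - c k) * int (M k j)) = 0"
      using that by (rule JM(3)[rule_format, THEN iffD1, THEN bspec])
    then show ?thesis unfolding W_def S_def by (simp add: algebra_simps sum_subtractf)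
  qed
  have KG: "K \<subseteq> carrier G" unfolding K_def by auto
  have sub: "subgroup K G"
  proof
    show "K \<subseteq> carrier G" by fact
    show "x \<otimes> y \<in> K" if "x \<in> K" "y \<in> K" for x y
      using that unfolding K_def by (auto simp flip: \<psi>_add)
    show "\<one> \<in> K" unfolding K_def by (rule range_eqI, rule \<psi>_zero[symmetric])
    show "inv x \<in> K" if "x \<in> K" for x
      using that unfolding K_def by (auto simp flip: \<psi>_uminus)
  qed
  have PK: "P \<subseteq> K" unfolding K_def by (auto intro!: range_eqI \<psi>_bool[symmetric])
  have EK: "E \<subseteq> K"
  proof
    fix x assume x: "x \<in> E"
    then have xG: "x \<in> carrier G" using E by auto
    consider "\<not> x \<preceq> \<one>" | "\<not> \<one> \<preceq> x" | "x = \<one>"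
      using le_antisym[of x \<one>] xG by auto
    then show "x \<in> K"
    proof cases
      case 1
      then have "x \<otimes> inv \<one> \<in> P" unfolding P_def using x E(3) by force
      then show ?thesis using PK xG by auto
    next
      case 2
      then have "\<one> \<otimes> inv x \<in> P" unfolding P_def using x E(3) by force
      then have "inv x \<in> K" using PK xG by auto
      then show ?thesis using subgroup.m_inv_closed[OF sub, of "inv x"] xG by simp
    next
      case 3
      then show ?thesis using subgroup.one_closed[OF sub] by simp
    qed
  qed
  have "K = ?\<psi> ` (PiE P (\<lambda>_. UNIV))"
  proof -
    have r: "?\<psi> c = ?\<psi> (restrict c P)" for c by (rule power_prod_cong[OF finP PG]) auto
    have "?\<psi> c \<in> ?\<psi> ` (PiE P (\<lambda>_. UNIV))" for c
      by (rule image_eqI, rule r) auto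
    then show ?thesis unfolding K_def by blast
  qed
  moreover have "countable (PiE P (\<lambda>_. UNIV :: int set))" using finP by (intro countable_PiE) auto
  ultimately have cK: "countable K" by simp
  have Wadd: "W (x \<otimes> y) j = W x j + W y j" if "x \<in> K" "y \<in> K" "j \<in> J" for x y j
  proof -
    obtain c d where cd: "x = ?\<psi> c" "y = ?\<psi> d" using \<open>x \<in> K\<close> \<open>y \<in> K\<close> unfolding K_def by auto
    have "x \<otimes> y = ?\<psi> (\<lambda>k. c k + d k)" unfolding cd \<psi>_add ..
    then show ?thesis using W that unfolding cd by (simp add: S_def algebra_simps sum.distrib)
  qed
  have Winj: "x = \<one>" if "x \<in> K" "\<forall>j\<in>J. W x j = 0" for x
  proof -
    obtain c where c: "x = ?\<psi> c" using \<open>x \<in> K\<close> unfolding K_def by auto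
    have "\<forall>j\<in>J. S c j = 0" using that W c by simp
    then have "null c" unfolding S_def by (rule JM(3)[rule_format, THEN iffD2])
    then show ?thesis unfolding c null_iff .
  qed
  have WP: "W p j = int (M p j)" if "p \<in> P" "j \<in> J" for p j
  proof -
    have "W (?\<psi> (\<lambda>k. of_bool (k = p))) j = S (\<lambda>k. of_bool (k = p)) j" using W that by blast
    also have "\<dots> = int (M p j)"
      unfolding S_def of_bool_def using that finP by (simp add: if_distrib[of "\<lambda>x. x * _"] cong: if_cong)
    finally show ?thesis using \<psi>_bool that by simp
  qed
  have Wless: "(\<forall>j\<in>J. W y j \<le> W x j) \<and> (\<exists>j\<in>J. W y j < W x j)" if "x \<in> E" "y \<in> E" "\<not> x \<preceq> y" for x y
  proof -
    have p: "x \<otimes> inv y \<in> P" using that unfolding P_def by force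
    have xy: "x \<in> carrier G" "y \<in> carrier G" using that E by auto
    have "W (x \<otimes> inv y \<otimes> y) j = W (x \<otimes> inv y) j + W y j" if "j \<in> J" for j
      using Wadd[of "x \<otimes> inv y" y j] PK EK p \<open>y \<in> E\<close> that by auto
    then have "W x j = int (M (x \<otimes> inv y) j) + W y j" if "j \<in> J" for j
      using WP[OF p] xy that by (simp add: m_assoc)
    moreover obtain j where "j \<in> J" "M (x \<otimes> inv y) j > 0" using JM(2) p by blast
    ultimately show ?thesis by fastforce
  qed
  have Wleast: "(\<Sum>j\<in>J. W x j) = 1"
    if "x \<in> E" "\<not> x \<preceq> \<one>" "\<forall>y\<in>carrier G. \<not> y \<preceq> \<one> \<longrightarrow> x \<preceq> y" for x
  proof -
    have xG: "x \<in> carrier G" using that E by auto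
    have "x \<otimes> inv \<one> \<in> P" unfolding P_def using that E(3) by force
    then have xP: "x \<in> P" using xG by simp
    have "least x"
      unfolding least_def
    proof (intro allI impI)
      fix c assume "\<not> N (\<lambda>k. - c k)"
      then have "\<not> ?\<psi> c \<preceq> \<one>" unfolding N_def by (simp add: \<psi>_uminus one_le_inv)
      then have "x \<preceq> ?\<psi> c" using that by simp
      then have "\<one> \<preceq> ?\<psi> c \<otimes> inv x" using one_le_diff(1) xG by simp
      also have "?\<psi> c \<otimes> inv x = ?\<psi> (\<lambda>k. c k + - of_bool (k = x))"
        unfolding \<psi>_add \<psi>_uminus \<psi>_bool[OF xP] ..
      finally show "N (\<lambda>k. c k - of_bool (k = x))" unfolding N_def by simp
    qed
    then have "(\<Sum>l\<in>J. M x l) = 1" using JM(4) xP by blast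
    moreover have "(\<Sum>j\<in>J. W x j) = (\<Sum>j\<in>J. int (M x j))" using WP[OF xP] by (intro sum.cong) auto
    ultimately show ?thesis by (metis of_nat_1 of_nat_sum)
  qed
  show ?thesis
    using JM(1) sub EK cK Wadd Winj Wless Wleast by (intro exI[of _ K] exI[of _ J] exI[of _ W]) blast
qed

text \<open>Rationally independent weights make \<open>w\<close> injective on all of
  \<open>K\<close>, although it respects the order only on \<open>E\<close>. Injectivity serves to
  turn membership of a value in an image back into a statement about the group; countability of
  \<open>K\<close> serves to glue copies of a chain over that image.\<close>

theorem finite_embedding_real:
  assumes E: "finite E" "E \<subseteq> carrier G" "\<one> \<in> E"
  shows "\<exists>K (w :: 'a \<Rightarrow> real). subgroup K G \<and> E \<subseteq> K \<and> countable K \<and> inj_on w K \<and>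
    (\<forall>x\<in>K. \<forall>y\<in>K. w (x \<otimes> y) = w x + w y) \<and> (\<forall>x\<in>E. \<forall>y\<in>E. \<not> x \<preceq> y \<longrightarrow> w y < w x)"
proof -
  from integer_coordinates[OF E] obtain K J and W :: "'a \<Rightarrow> 'a \<Rightarrow> int" where
    J: "finite J" and K: "subgroup K G" "E \<subseteq> K" "countable K" and
    add: "\<forall>x\<in>K. \<forall>y\<in>K. \<forall>j\<in>J. W (x \<otimes> y) j = W x j + W y j" and
    inj: "\<forall>x\<in>K. (\<forall>j\<in>J. W x j = 0) \<longrightarrow> x = \<one>" and
    less: "\<forall>x\<in>E. \<forall>y\<in>E. \<not> x \<preceq> y \<longrightarrow> (\<forall>j\<in>J. W y j \<le> W x j) \<and> (\<exists>j\<in>J. W y j < W x j)"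
    by (elim exE conjE) (rule that)
  from independent_reals[OF J] obtain \<rho> :: "'a \<Rightarrow> real" where \<rho>: "\<forall>j\<in>J. \<rho> j > 0"
    "\<forall>k :: 'a \<Rightarrow> int. (\<Sum>j\<in>J. of_int (k j) * \<rho> j) = 0 \<longrightarrow> (\<forall>j\<in>J. k j = (0 :: int))"
    by (elim exE conjE) (rule that)
  define w where "w = (\<lambda>x. \<Sum>j\<in>J. W x j * \<rho> j)"
  have wadd: "w (x \<otimes> y) = w x + w y" if "x \<in> K" "y \<in> K" for x y
  proof -
    have "w (x \<otimes> y) = (\<Sum>j\<in>J. W x j * \<rho> j + W y j * \<rho> j)"
      unfolding w_def using add that by (intro sum.cong) (auto simp: algebra_simps)
    then show ?thesis unfolding w_def by (simp add: sum.distrib)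
  qed
  have "inj_on w K"
  proof (rule inj_onI)
    fix x y assume xy: "x \<in> K" "y \<in> K" "w x = w y"
    have G: "x \<in> carrier G" "y \<in> carrier G" using xy K subgroup.subset by blast+
    have iy: "inv y \<in> K" "x \<otimes> inv y \<in> K"
      using xy K by (auto intro: subgroup.m_inv_closed subgroup.m_closed)
    have "w (x \<otimes> inv y \<otimes> y) = w (x \<otimes> inv y) + w y" using iy xy by (intro wadd)
    then have "w (x \<otimes> inv y) = 0" using G xy by (simp add: m_assoc)
    then have "x \<otimes> inv y = \<one>" using \<rho>(2)[rule_format, of "W (x \<otimes> inv y)"] inj iy unfolding w_def by blast
    then have "x \<otimes> inv y \<otimes> y = \<one> \<otimes> y" by simp
    then show "x = y" using G by (simp add: m_assoc)
  qed
  moreover have "w y < w x" if "x \<in> E" "y \<in> E" "\<not> x \<preceq> y" for x y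
  proof -
    have *: "\<forall>j\<in>J. W y j \<le> W x j" "\<exists>j\<in>J. W y j < W x j" using less that by blast+
    show ?thesis
      unfolding w_def
    proof (rule sum_strict_mono_ex1)
      show "finite J" by fact
      show "\<forall>j\<in>J. W y j * \<rho> j \<le> W x j * \<rho> j" using * \<rho> by (auto intro!: mult_right_mono)
      show "\<exists>j\<in>J. W y j * \<rho> j < W x j * \<rho> j" using * \<rho> by (auto intro!: mult_strict_right_mono)
    qed
  qed
  ultimately show ?thesis using K wadd by (intro exI[of _ K] exI[of _ w]) blast
qed

text \<open>All weights are 1, so \<open>w\<close> takes integer values, and the least positive
  element \<open>e\<close>, whose coordinates add up to 1, is sent to 1.\<close>

theorem finite_embedding_int:
  assumes E: "finite E" "E \<subseteq> carrier G" "\<one> \<in> E"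
    and e: "e \<in> E" "\<not> e \<preceq> \<one>" "\<And>y. y \<in> carrier G \<Longrightarrow> \<not> y \<preceq> \<one> \<Longrightarrow> e \<preceq> y"
  shows "\<exists>K (w :: 'a \<Rightarrow> int). subgroup K G \<and> E \<subseteq> K \<and> w e = 1 \<and>
    (\<forall>x\<in>K. \<forall>y\<in>K. w (x \<otimes> y) = w x + w y) \<and> (\<forall>x\<in>E. \<forall>y\<in>E. \<not> x \<preceq> y \<longrightarrow> w y < w x)"
proof -
  from integer_coordinates[OF E] obtain K J and W :: "'a \<Rightarrow> 'a \<Rightarrow> int" where
    J: "finite J" and K: "subgroup K G" "E \<subseteq> K" "countable K" and
    add: "\<forall>x\<in>K. \<forall>y\<in>K. \<forall>j\<in>J. W (x \<otimes> y) j = W x j + W y j" and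
    inj: "\<forall>x\<in>K. (\<forall>j\<in>J. W x j = 0) \<longrightarrow> x = \<one>" and
    less: "\<forall>x\<in>E. \<forall>y\<in>E. \<not> x \<preceq> y \<longrightarrow> (\<forall>j\<in>J. W y j \<le> W x j) \<and> (\<exists>j\<in>J. W y j < W x j)" and
    least: "\<forall>x\<in>E. \<not> x \<preceq> \<one> \<longrightarrow> (\<forall>y\<in>carrier G. \<not> y \<preceq> \<one> \<longrightarrow> x \<preceq> y) \<longrightarrow> (\<Sum>j\<in>J. W x j) = 1"
    by (elim exE conjE) (rule that)
  define w where "w = (\<lambda>x. \<Sum>j\<in>J. W x j)"
  have "w (x \<otimes> y) = w x + w y" if "x \<in> K" "y \<in> K" for x y
    unfolding w_def using add that by (simp add: sum.distrib)
  moreover have "w y < w x" if "x \<in> E" "y \<in> E" "\<not> x \<preceq> y" for x y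
    unfolding w_def using less J that by (intro sum_strict_mono_ex1) blast+
  moreover have "w e = 1" unfolding w_def using e least by blast
  ultimately show ?thesis using K by (intro exI[of _ K] exI[of _ w]) blast
qed

end

section \<open>Lexicographic orders that are isomorphic to intervals\<close>

definition squash :: "ereal \<Rightarrow> real" where
  "squash y = (case y of ereal r \<Rightarrow> 1 / 2 + arctan r / pi | PInfty \<Rightarrow> 1 | MInfty \<Rightarrow> 0)"

lemma squash_simps [simp]: "squash \<infinity> = 1" "squash (-\<infinity>) = 0" "squash (ereal r) = 1 / 2 + arctan r / pi"
  by (simp_all add: squash_def)

lemma squash_real: "0 < squash (ereal r)" "squash (ereal r) < 1"
  using arctan_lbound[of r] arctan_ubound[of r] by (simp_all add: field_simps)

lemma squash_less: "x < y \<Longrightarrow> squash x < squash y"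
  using squash_real by (cases x; cases y) (auto simp: divide_strict_right_mono arctan_less_iff)

lemma squash_less_iff [simp]: "squash x < squash y \<longleftrightarrow> x < y"
  using squash_less by (metis linorder_less_linear order_less_asym)

lemma squash_le_iff [simp]: "squash x \<le> squash y \<longleftrightarrow> x \<le> y"
  by (simp flip: not_less)

lemma squash_eq_iff [simp]: "squash x = squash y \<longleftrightarrow> x = y"
  by (metis order_antisym_conv squash_le_iff order_refl)

lemma squash_bounds: "0 \<le> squash x" "squash x \<le> 1"
  using squash_le_iff[of "-\<infinity>" x] squash_le_iff[of x \<infinity>] by simp_all

lemma squash_pos_iff [simp]: "0 < squash x \<longleftrightarrow> x \<noteq> -\<infinity>"
  using squash_less_iff[of "-\<infinity>" x] by simp

lemma squash_surj:
  assumes "0 \<le> t" "t \<le> 1"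
  shows "\<exists>y. squash y = t"
proof -
  consider "t = 0" | "t = 1" | "0 < t" "t < 1" using assms by linarith
  then show ?thesis
  proof cases
    case 3
    then have *: "- (pi / 2) < (t - 1 / 2) * pi" "(t - 1 / 2) * pi < pi / 2"
      by (simp_all add: algebra_simps)
    then have "squash (ereal (tan ((t - 1 / 2) * pi))) = t"
      using pi_neq_zero by (simp add: arctan_tan)
    then show ?thesis by blast
  qed (auto intro: exI[of _ "-\<infinity>"] exI[of _ \<infinity>])
qed

lemma bij_betw_squash: "bij_betw squash UNIV {0..1}"
  unfolding bij_betw_def inj_on_def using squash_surj squash_bounds by (auto simp: image_iff) metis

text \<open>The copy over \<open>z\<close> has a top but no bottom, so it fills the interval from
  \<open>z\<close> (excluded) to \<open>z + 1\<close> (included). This is why the inverse uses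
  \<open>\<lceil>x\<rceil> - 1\<close> and not the floor.\<close>

lemma bij_betw_lex_int:
  "bij_betw (\<lambda>(z, y). real_of_int z + squash y) {(z, y). y \<noteq> -\<infinity>} UNIV" (is "bij_betw ?\<beta> ?C _")
  and lex_int_le: "\<lbrakk>y \<noteq> -\<infinity>; y' \<noteq> -\<infinity>\<rbrakk> \<Longrightarrow>
    real_of_int z + squash y \<le> real_of_int z' + squash y' \<longleftrightarrow> z < z' \<or> z = z' \<and> y \<le> y'"
proof -
  show le: "real_of_int z + squash y \<le> real_of_int z' + squash y' \<longleftrightarrow> z < z' \<or> z = z' \<and> y \<le> y'"
    if y: "y \<noteq> -\<infinity>" "y' \<noteq> -\<infinity>" for z z' y y'
  proof -
    have b: "0 < squash y" "0 < squash y'" using y by simp_all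
    consider "z < z'" | "z = z'" | "z' < z" by linarith
    then show ?thesis
    proof cases
      case 1
      then have "real_of_int z + 1 \<le> z'" by linarith
      then show ?thesis using 1 b squash_bounds(2)[of y] by linarith
    next
      case 3
      then have "real_of_int z' + 1 \<le> z" by linarith
      then show ?thesis using 3 b squash_bounds(2)[of y'] by linarith
    qed simp
  qed
  show "bij_betw ?\<beta> ?C UNIV"
    unfolding bij_betw_def
  proof
    show "inj_on ?\<beta> ?C"
    proof (rule inj_onI, clarify)
      fix z z' y y' assume y: "y \<noteq> -\<infinity>" "y' \<noteq> -\<infinity>" and "real_of_int z + squash y = real_of_int z' + squash y'"
      then have "real_of_int z + squash y \<le> real_of_int z' + squash y'"
        "real_of_int z' + squash y' \<le> real_of_int z + squash y" by simp_all
      then show "z = z' \<and> y = y'" unfolding le[OF y] le[OF y(2,1)] by auto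
    qed
    show "?\<beta> ` ?C = UNIV"
    proof (intro equalityI subset_UNIV subsetI)
      fix x :: real
      let ?z = "\<lceil>x\<rceil> - 1"
      have x: "0 < x - ?z" "x - ?z \<le> 1" by linarith+
      then obtain y where y: "squash y = x - ?z" using squash_surj[of "x - ?z"] by auto
      then have "y \<noteq> -\<infinity>" using x squash_pos_iff[of y] by metis
      then have "(?z, y) \<in> ?C" "x = ?\<beta> (?z, y)" using y by auto
      then show "x \<in> ?\<beta> ` ?C" by blast
    qed
  qed
qed

lemma summable_on_half_powers:
  assumes "countable H"
  shows "(\<lambda>h :: 'a. if h \<in> H then (1 / 2 :: real) ^ to_nat_on H h else 0) summable_on UNIV"
proof -
  have "(\<lambda>n. (1 / 2 :: real) ^ n) summable_on UNIV"
    by (intro norm_summable_imp_summable_on) (simp add: summable_geometric)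
  then have "(\<lambda>n. (1 / 2 :: real) ^ n) summable_on to_nat_on H ` H"
    by (rule summable_on_subset_banach) simp
  then have "(\<lambda>h. (1 / 2 :: real) ^ to_nat_on H h) summable_on H"
    using summable_on_reindex[OF inj_on_to_nat_on[OF assms], of "\<lambda>n. (1 / 2 :: real) ^ n"] by (simp add: o_def)
  then show ?thesis
    by (rule summable_on_cong_neutral[THEN iffD1, rotated -1]) auto
qed

text \<open>Stretching the real line by a gap of length \<open>\<mu> h\<close> at every \<open>h\<close> of the countable set \<open>H\<close> makes
  room for a copy of the extended reals there.\<close>

lemma bij_betw_lex_real:
  assumes "countable H"
  shows "\<exists>\<beta> :: real \<times> ereal \<Rightarrow> real. bij_betw \<beta> {(r, y). r \<in> H \<or> y = -\<infinity>} UNIV \<and>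
    (\<forall>r y r' y'. (r \<in> H \<or> y = -\<infinity>) \<longrightarrow> (r' \<in> H \<or> y' = -\<infinity>) \<longrightarrow>
      (\<beta> (r, y) \<le> \<beta> (r', y') \<longleftrightarrow> r < r' \<or> r = r' \<and> y \<le> y'))"
proof -
  define \<mu> where "\<mu> = (\<lambda>h. if h \<in> H then (1 / 2 :: real) ^ to_nat_on H h else 0)"
  have \<mu>: "\<mu> h \<ge> 0" "\<mu> h > 0 \<longleftrightarrow> h \<in> H" for h by (simp_all add: \<mu>_def)
  have summ: "\<mu> summable_on A" for A
    using summable_on_half_powers[OF assms] unfolding \<mu>_def by (rule summable_on_subset_banach) simp
  define s where "s = infsum \<mu>"
  have s_Un: "s (A \<union> B) = s A + s B" if "A \<inter> B = {}" for A B
    unfolding s_def using summ that by (intro infsum_Un_disjoint)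
  have s_nonneg: "s A \<ge> 0" for A unfolding s_def using \<mu> by (intro infsum_nonneg)
  have s_mono: "s A \<le> s B" if "A \<subseteq> B" for A B
    using s_Un[of A "B - A"] s_nonneg[of "B - A"] that by (simp add: Un_absorb1)
  have s_fin: "s F = sum \<mu> F" if "finite F" for F unfolding s_def using that by simp
  have approx: "\<exists>F. finite F \<and> F \<subseteq> A \<and> s A - e \<le> s F" if "e > 0" for A e
  proof -
    obtain F where "finite F" "F \<subseteq> A" "dist (sum \<mu> F) (infsum \<mu> A) \<le> e"
      using infsum_finite_approximation[OF summ \<open>e > 0\<close>] by blast
    then show ?thesis using s_fin unfolding s_def dist_real_def by (intro exI[of _ F]) auto
  qed
  \<comment> \<open>Position of \<open>r\<close> after inserting all gaps to its left; the gap at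
    \<open>r\<close> itself occupies the interval from \<open>\<phi> r\<close> to
    \<open>\<phi> r + \<mu> r\<close>, and the gaps of different points are disjoint by
    \<open>jump\<close>.\<close>
  define \<phi> where "\<phi> = (\<lambda>r. r + s {..<r})"
  have \<phi>\<mu>: "\<phi> r + \<mu> r = r + s {..r}" for r
  proof -
    have "{..r} = {..<r} \<union> {r}" by auto
    then have "s {..r} = s {..<r} + s {r}" using s_Un[of "{..<r}" "{r}"] by simp
    then show ?thesis using s_fin[of "{r}"] by (simp add: \<phi>_def)
  qed
  have jump: "\<phi> r + \<mu> r < \<phi> r'" if "r < r'" for r r'
  proof -
    have "s {..r} \<le> s {..<r'}" using that by (intro s_mono) auto
    then show ?thesis unfolding \<phi>\<mu> using that by (simp add: \<phi>_def)
  qed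
  define \<beta> where "\<beta> = (\<lambda>(r, y). \<phi> r + \<mu> r * squash y)"
  have \<beta>_bounds: "\<phi> r \<le> \<beta> (r, y)" "\<beta> (r, y) \<le> \<phi> r + \<mu> r" for r y
    using \<mu>(1)[of r] squash_bounds[of y] by (simp_all add: \<beta>_def mult_left_le)
  have less: "\<beta> (r, y) < \<beta> (r', y')" if "r < r'" for r r' y y'
    using jump[OF that] \<beta>_bounds(2)[of r y] \<beta>_bounds(1)[of r' y'] by linarith
  have le: "\<beta> (r, y) \<le> \<beta> (r', y') \<longleftrightarrow> r < r' \<or> r = r' \<and> y \<le> y'"
    if "r \<in> H \<or> y = -\<infinity>" "r' \<in> H \<or> y' = -\<infinity>" for r r' y y'
  proof -
    consider "r < r'" | "r = r'" "r \<in> H" | "r = r'" "r \<notin> H" | "r' < r" by linarith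
    then show ?thesis
    proof cases
      case 1
      then show ?thesis using less[OF 1, of y y'] by auto
    next
      case 2
      then show ?thesis using \<mu>(2)[of r] by (simp add: \<beta>_def)
    next
      case 3
      then show ?thesis using that by auto
    next
      case 4
      then show ?thesis using less[OF 4, of y' y] by auto
    qed
  qed
  have surj: "\<exists>r z. (r \<in> H \<or> z = -\<infinity>) \<and> \<beta> (r, z) = y" for y
  proof -
    \<comment> \<open>The point whose gap contains \<open>y\<close> is the supremum of
      \<open>S\<close>; off \<open>H\<close> the gap has length 0. That no \<open>y\<close> is
      skipped means that \<open>\<phi>\<close> tends to \<open>\<phi> r\<close> from the left and to
      \<open>\<phi> r + \<mu> r\<close> from the right.\<close>
    define S where "S = {r. \<phi> r \<le> y}"
    have S_down: "r' \<in> S" if "r \<in> S" "r' < r" for r r'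
      using that jump[of r' r] \<mu>(1)[of r'] unfolding S_def by auto
    have "y - s UNIV \<in> S"
      using s_mono[of "{..<y - s UNIV}" UNIV] unfolding S_def \<phi>_def by auto
    then have ne: "S \<noteq> {}" by auto
    have bdd: "bdd_above S"
      unfolding S_def \<phi>_def using s_nonneg by (intro bdd_aboveI[of _ y]) (smt (verit) mem_Collect_eq)
    define r where "r = Sup S"
    have below: "q \<in> S" if "q < r" for q
      using less_cSupD[OF ne, of q] that S_down unfolding r_def by blast
    have above: "q \<notin> S" if "r < q" for q
      using cSup_upper[OF _ bdd, of q] that unfolding r_def by auto
    have lo: "\<phi> r \<le> y"
    proof (rule ccontr)
      assume "\<not> ?thesis"
      then have \<delta>: "\<phi> r - y > 0" (is "?\<delta> > 0") by simp
      \<comment> \<open>Finitely many gaps carry the mass left of \<open>r\<close> up to half of the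
        defect \<open>\<phi> r - y\<close>. A point \<open>q\<close> to the right of them and within
        a quarter of the defect from \<open>r\<close> loses at most three quarters in total, so
        \<open>\<phi> q\<close> still exceeds \<open>y\<close>.\<close>
      obtain F where F: "finite F" "F \<subseteq> {..<r}" "s {..<r} - ?\<delta> / 2 \<le> s F"
        using approx[of "?\<delta> / 2"] \<delta> by auto
      define m where "m = Max (insert (r - ?\<delta> / 4) F)"
      have m: "m < r" "r - ?\<delta> / 4 \<le> m" "\<And>f. f \<in> F \<Longrightarrow> f \<le> m"
        unfolding m_def using F(1,2) \<delta> by (auto simp: subset_eq)
      define q where "q = (m + r) / 2"
      have q: "m < q" "q < r" using m unfolding q_def by auto
      have "s F \<le> s {..<q}" using m(3) q by (intro s_mono) force
      then have "\<phi> q > y" using F(3) m(2) q \<delta> unfolding \<phi>_def by argo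
      then show False using below[OF q(2)] unfolding S_def by simp
    qed
    have hi: "y \<le> \<phi> r + \<mu> r"
    proof (rule ccontr)
      assume "\<not> ?thesis"
      then have \<delta>: "y - (\<phi> r + \<mu> r) > 0" (is "?\<delta> > 0") by simp
      obtain F where F: "finite F" "F \<subseteq> {r<..}" "s {r<..} - ?\<delta> / 2 \<le> s F"
        using approx[of "?\<delta> / 2"] \<delta> by auto
      define m where "m = Min (insert (r + ?\<delta> / 4) F)"
      have m: "r < m" "m \<le> r + ?\<delta> / 4" "\<And>f. f \<in> F \<Longrightarrow> m \<le> f"
        unfolding m_def using F(1,2) \<delta> by (auto simp: subset_eq)
      define q where "q = (m + r) / 2"
      have q: "q < m" "r < q" using m unfolding q_def by auto
      have "s F \<le> s {q..}" using m(3) q by (intro s_mono) force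
      moreover have "s {..<q} + s {q..} = s UNIV" "s {..r} + s {r<..} = s UNIV"
        by (subst s_Un[symmetric]; force intro: arg_cong[of _ _ s])+
      ultimately have "\<phi> q \<le> y" using F(3) m(2) q \<delta> unfolding \<phi>\<mu> unfolding \<phi>_def by argo
      then show False using above[OF q(2)] unfolding S_def by simp
    qed
    show ?thesis
    proof (cases "r \<in> H")
      case True
      then have "\<mu> r > 0" using \<mu>(2) by blast
      then have "0 \<le> (y - \<phi> r) / \<mu> r" "(y - \<phi> r) / \<mu> r \<le> 1"
        using lo hi by (simp_all add: field_simps)
      then obtain z where "squash z = (y - \<phi> r) / \<mu> r" using squash_surj by blast
      then have "\<beta> (r, z) = y" using \<open>\<mu> r > 0\<close> by (simp add: \<beta>_def)
      then show ?thesis using True by blast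
    next
      case False
      then have "\<mu> r = 0" by (simp add: \<mu>_def)
      then have "\<beta> (r, -\<infinity>) = y" using lo hi by (simp add: \<beta>_def)
      then show ?thesis by blast
    qed
  qed
  show ?thesis
  proof (intro exI[of _ \<beta>] conjI)
    show "bij_betw \<beta> {(r, y). r \<in> H \<or> y = -\<infinity>} UNIV"
      unfolding bij_betw_def
    proof
      show "inj_on \<beta> {(r, y). r \<in> H \<or> y = -\<infinity>}"
      proof (rule inj_onI, clarify)
        fix r y r' y'
        assume H: "r \<in> H \<or> y = -\<infinity>" "r' \<in> H \<or> y' = -\<infinity>" and "\<beta> (r, y) = \<beta> (r', y')"
        then have "\<beta> (r, y) \<le> \<beta> (r', y')" "\<beta> (r', y') \<le> \<beta> (r, y)" by simp_all
        then show "r = r' \<and> y = y'" unfolding le[OF H] le[OF H(2,1)] by auto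
      qed
      show "\<beta> ` {(r, y). r \<in> H \<or> y = -\<infinity>} = UNIV"
      proof (intro equalityI subset_UNIV subsetI)
        fix y
        obtain r z where "r \<in> H \<or> z = -\<infinity>" "\<beta> (r, z) = y" using surj by blast
        then show "y \<in> \<beta> ` {(r, y). r \<in> H \<or> y = -\<infinity>}" by (intro image_eqI[of _ _ "(r, z)"]) auto
      qed
    qed
  qed (use le in blast)
qed

section \<open>Odd chains and their layers\<close>

text \<open>Product, unit, negation and order determine everything else: meet and join come from
  linearity, and the residual of \<open>z\<close> by \<open>x\<close> is
  \<open>n (x \<cdot> n z)\<close>, so residuation is demanded only at \<open>e\<close>. Bounds are
  left out in order that the real line can serve as a carrier.\<close>

locale odd_chain =
  fixes C :: "'a set" and mul :: "'a \<Rightarrow> 'a \<Rightarrow> 'a" (infixl "\<cdot>" 70)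
    and e :: 'a and n :: "'a \<Rightarrow> 'a" and le :: "'a \<Rightarrow> 'a \<Rightarrow> bool" (infix "\<preceq>" 50)
  assumes mul_closed [simp]: "\<lbrakk>x \<in> C; y \<in> C\<rbrakk> \<Longrightarrow> x \<cdot> y \<in> C"
    and e_closed [simp]: "e \<in> C"
    and n_closed [simp]: "x \<in> C \<Longrightarrow> n x \<in> C"
    and assoc: "\<lbrakk>x \<in> C; y \<in> C; z \<in> C\<rbrakk> \<Longrightarrow> x \<cdot> y \<cdot> z = x \<cdot> (y \<cdot> z)"
    and comm: "\<lbrakk>x \<in> C; y \<in> C\<rbrakk> \<Longrightarrow> x \<cdot> y = y \<cdot> x"
    and e_mul [simp]: "x \<in> C \<Longrightarrow> e \<cdot> x = x"
    and trans: "\<lbrakk>x \<in> C; y \<in> C; z \<in> C; x \<preceq> y; y \<preceq> z\<rbrakk> \<Longrightarrow> x \<preceq> z"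
    and antisym: "\<lbrakk>x \<in> C; y \<in> C; x \<preceq> y; y \<preceq> x\<rbrakk> \<Longrightarrow> x = y"
    and total: "\<lbrakk>x \<in> C; y \<in> C\<rbrakk> \<Longrightarrow> x \<preceq> y \<or> y \<preceq> x"
    and mul_le_e: "\<lbrakk>x \<in> C; y \<in> C\<rbrakk> \<Longrightarrow> x \<cdot> y \<preceq> e \<longleftrightarrow> y \<preceq> n x"
    and n_n [simp]: "x \<in> C \<Longrightarrow> n (n x) = x"
begin

lemma lcomm: "\<lbrakk>x \<in> C; y \<in> C; z \<in> C\<rbrakk> \<Longrightarrow> x \<cdot> (y \<cdot> z) = y \<cdot> (x \<cdot> z)"
  by (metis assoc comm)

lemmas ac = assoc comm lcomm

lemma refl [simp]: "x \<in> C \<Longrightarrow> x \<preceq> x"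
  using total by blast

lemma mul_e [simp]: "x \<in> C \<Longrightarrow> x \<cdot> e = x"
  by (simp add: comm[of x e])

lemma n_e [simp]: "n e = e"
proof (rule antisym)
  show "e \<preceq> n e" using mul_le_e[of e e] by simp
  show "n e \<preceq> e" using mul_le_e[of e "n e"] by simp
qed simp_all

lemma n_le_iff: "\<lbrakk>x \<in> C; y \<in> C\<rbrakk> \<Longrightarrow> n y \<preceq> n x \<longleftrightarrow> x \<preceq> y"
  using mul_le_e[of x "n y"] mul_le_e[of "n y" x] by (simp add: comm)

text \<open>By involution \<open>x \<cdot> y \<preceq> z\<close> says that
  \<open>x \<cdot> y \<cdot> n z \<preceq> e\<close>, to which the axiom at \<open>e\<close> applies
  with the factor \<open>x \<cdot> n z\<close>.\<close>

lemma mul_le_iff: "\<lbrakk>x \<in> C; y \<in> C; z \<in> C\<rbrakk> \<Longrightarrow> x \<cdot> y \<preceq> z \<longleftrightarrow> y \<preceq> n (x \<cdot> n z)"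
  using mul_le_e[of "n z" "x \<cdot> y"] mul_le_e[of "x \<cdot> n z" y] by (simp add: ac)

lemma mul_mono:
  assumes "x \<in> C" "y \<in> C" "z \<in> C" "x \<preceq> y"
  shows "z \<cdot> x \<preceq> z \<cdot> y" "x \<cdot> z \<preceq> y \<cdot> z"
proof -
  have "y \<preceq> n (z \<cdot> n (z \<cdot> y))" using mul_le_iff[of z y "z \<cdot> y"] assms by simp
  then have "x \<preceq> n (z \<cdot> n (z \<cdot> y))" using assms trans[of x y "n (z \<cdot> n (z \<cdot> y))"] by simp
  then show "z \<cdot> x \<preceq> z \<cdot> y" using mul_le_iff[of z x "z \<cdot> y"] assms by simp
  then show "x \<cdot> z \<preceq> y \<cdot> z" using assms by (simp add: comm)
qed

lemma mul_n_le: "x \<in> C \<Longrightarrow> x \<cdot> n x \<preceq> e"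
  by (simp add: mul_le_e)

lemma increasing: "\<lbrakk>e \<preceq> u; u \<in> C; x \<in> C\<rbrakk> \<Longrightarrow> x \<preceq> u \<cdot> x"
  using mul_mono(2)[of e u x] by simp

lemma decreasing: "\<lbrakk>u \<preceq> e; u \<in> C; x \<in> C\<rbrakk> \<Longrightarrow> u \<cdot> x \<preceq> x"
  using mul_mono(2)[of u e x] by simp

text \<open>The residual of \<open>x\<close> by itself. The formula is symmetric in \<open>x\<close>
  and \<open>n x\<close>, so a layer, the set of elements with a common value of
  \<open>\<tau>\<close>, is closed under negation.\<close>

definition \<tau> :: "'a \<Rightarrow> 'a" where
  "\<tau> x = n (x \<cdot> n x)"

lemma \<tau>_closed [simp]: "x \<in> C \<Longrightarrow> \<tau> x \<in> C"
  by (simp add: \<tau>_def)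

lemma \<tau>_n [simp]: "x \<in> C \<Longrightarrow> \<tau> (n x) = \<tau> x"
  by (simp add: \<tau>_def comm)

lemma mul_n_eq: "x \<in> C \<Longrightarrow> x \<cdot> n x = n (\<tau> x)"
  by (simp add: \<tau>_def)

lemma e_le_\<tau>: "x \<in> C \<Longrightarrow> e \<preceq> \<tau> x"
  using n_le_iff[of "x \<cdot> n x" e] mul_n_le[of x] by (simp add: \<tau>_def)

lemma le_\<tau>_iff: "\<lbrakk>v \<in> C; x \<in> C\<rbrakk> \<Longrightarrow> v \<preceq> \<tau> x \<longleftrightarrow> v \<cdot> x \<preceq> x"
  using mul_le_iff[of x v x] by (simp add: \<tau>_def comm)

lemma fixed_le_\<tau>: "\<lbrakk>v \<in> C; x \<in> C; v \<cdot> x = x\<rbrakk> \<Longrightarrow> v \<preceq> \<tau> x"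
  by (simp add: le_\<tau>_iff)

lemma fixed_iff_le_\<tau>: "\<lbrakk>v \<in> C; x \<in> C; e \<preceq> v\<rbrakk> \<Longrightarrow> v \<cdot> x = x \<longleftrightarrow> v \<preceq> \<tau> x"
  using le_\<tau>_iff[of v x] increasing[of v x] antisym[of "v \<cdot> x" x] by auto

lemma \<tau>_e [simp]: "\<tau> e = e"
  by (simp add: \<tau>_def)

definition pos_idem :: "'a \<Rightarrow> bool" where
  "pos_idem u \<longleftrightarrow> u \<in> C \<and> e \<preceq> u \<and> u \<cdot> u = u"

lemma \<tau>_pos_idem: "pos_idem u \<Longrightarrow> \<tau> u = u"
proof (rule antisym)
  assume u: "pos_idem u"
  then show "u \<preceq> \<tau> u" by (simp add: pos_idem_def fixed_le_\<tau>)
  have "\<tau> u \<cdot> u = u" using u by (simp add: pos_idem_def fixed_iff_le_\<tau> e_le_\<tau>)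
  moreover have "\<tau> u \<cdot> e \<preceq> \<tau> u \<cdot> u" using u by (intro mul_mono) (auto simp: pos_idem_def)
  ultimately show "\<tau> u \<preceq> u" using u by (simp add: pos_idem_def)
qed (simp_all add: pos_idem_def)

lemma pos_idem_\<tau>: "x \<in> C \<Longrightarrow> pos_idem (\<tau> x)"
proof -
  assume x: "x \<in> C"
  then have fx: "\<tau> x \<cdot> x = x" by (simp add: fixed_iff_le_\<tau> e_le_\<tau>)
  have "\<tau> x \<cdot> \<tau> x \<cdot> x = x" using x fx by (simp add: assoc)
  then have "\<tau> x \<cdot> \<tau> x \<preceq> \<tau> x" using x by (intro fixed_le_\<tau>) auto
  moreover have "\<tau> x \<preceq> \<tau> x \<cdot> \<tau> x" using x by (intro increasing) (auto simp: e_le_\<tau>)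
  ultimately show ?thesis using x by (auto simp: pos_idem_def e_le_\<tau> intro: antisym)
qed

end

section \<open>The monoid of elements fixed by a positive idempotent\<close>

locale odd_chain_idem = odd_chain +
  fixes u
  assumes u: "pos_idem u"
begin

abbreviation d where "d \<equiv> n u"

lemma u_closed [simp]: "u \<in> C" and e_le_u: "e \<preceq> u" and uu [simp]: "u \<cdot> u = u"
  using u by (simp_all add: pos_idem_def)

lemma d_le_e: "d \<preceq> e"
  using n_le_iff[of e u] e_le_u by simp

lemma ud [simp]: "u \<cdot> d = d" "d \<cdot> u = d"
  using mul_n_eq[of u] \<tau>_pos_idem[OF u] by (simp_all add: comm)

lemma uu' [simp]: "x \<in> C \<Longrightarrow> u \<cdot> (u \<cdot> x) = u \<cdot> x"
  by (simp flip: assoc)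

lemma du' [simp]: "x \<in> C \<Longrightarrow> d \<cdot> (u \<cdot> x) = d \<cdot> x" "x \<in> C \<Longrightarrow> u \<cdot> (d \<cdot> x) = d \<cdot> x"
  by (simp_all flip: assoc)

text \<open>If \<open>z\<close> were not below \<open>e\<close>, then \<open>e \<preceq> z\<close>
  would give \<open>u \<preceq> u \<cdot> z = z\<close>; so
  \<open>u \<cdot> z = z \<preceq> e\<close>, that is \<open>z \<preceq> n u\<close>. Thus no
  element fixed by \<open>u\<close> lies strictly between \<open>d\<close> and \<open>u\<close>, the
  dichotomy behind most arguments on a layer.\<close>

lemma below_u:
  assumes z: "z \<in> C" "u \<cdot> z = z" "\<not> u \<preceq> z"
  shows "z \<preceq> d"
proof -
  have "z \<preceq> e"
  proof (rule ccontr)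
    assume "\<not> z \<preceq> e"
    then have "e \<preceq> z" using total[of z e] z(1) by simp
    then have "u \<cdot> e \<preceq> u \<cdot> z" using z(1) by (intro mul_mono) auto
    then show False using z by simp
  qed
  then show ?thesis using mul_le_e[of u z] z by simp
qed

lemma fixed_iff: "x \<in> C \<Longrightarrow> u \<cdot> x = x \<longleftrightarrow> u \<preceq> \<tau> x"
  by (simp add: fixed_iff_le_\<tau> e_le_u)

text \<open>The product is fixed by \<open>u\<close> and lies below \<open>u\<close>. Were it
  different from \<open>u\<close>, it would be at most \<open>d\<close>, hence at most
  \<open>e\<close>, so \<open>x \<cdot> n x \<preceq> n u\<close>, and negating this gives
  \<open>u \<preceq> \<tau> x\<close>. So the elements of lower layers become invertible after
  multiplication by \<open>u\<close>.\<close>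

lemma low_inverse:
  assumes x: "x \<in> C" "\<not> u \<preceq> \<tau> x"
  shows "u \<cdot> (x \<cdot> n x) = u"
proof (rule ccontr)
  let ?z = "u \<cdot> (x \<cdot> n x)"
  assume ne: "?z \<noteq> u"
  have le: "?z \<preceq> u" using mul_mono(1)[of "x \<cdot> n x" e u] mul_n_le[of x] x by simp
  have "?z \<preceq> d" using ne le antisym[of ?z u] x by (intro below_u) auto
  then have "?z \<preceq> e" using d_le_e x trans[of ?z d e] by simp
  then have "x \<cdot> n x \<preceq> d" using mul_le_e[of u "x \<cdot> n x"] x by simp
  then have "u \<preceq> \<tau> x" unfolding \<tau>_def using n_le_iff[of "x \<cdot> n x" d] x by simp
  then show False using x by simp
qed

definition unit :: "'a \<Rightarrow> bool" where
  "unit g \<longleftrightarrow> g \<in> C \<and> u \<cdot> g = g \<and> (\<exists>h\<in>C. u \<cdot> h = h \<and> g \<cdot> h = u)"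

lemma unit_closed: "unit g \<Longrightarrow> g \<in> C" "unit g \<Longrightarrow> u \<cdot> g = g"
  by (auto simp: unit_def)

lemma unitI: "\<lbrakk>g \<in> C; h \<in> C; u \<cdot> g = g; u \<cdot> h = h; g \<cdot> h = u\<rbrakk> \<Longrightarrow> unit g"
  by (auto simp: unit_def)

lemma unitE:
  assumes "unit g"
  obtains h where "unit h" "g \<in> C" "h \<in> C" "u \<cdot> g = g" "u \<cdot> h = h" "g \<cdot> h = u" "h \<cdot> g = u"
  using assms unfolding unit_def by (metis comm)

lemma unit_u: "unit u"
  by (rule unitI[of u u]) simp_all

lemma unit_mul:
  assumes "unit g" "unit g'"
  shows "unit (g \<cdot> g')"
proof -
  obtain h where h: "h \<in> C" "u \<cdot> h = h" "g \<cdot> h = u" "g \<in> C" "u \<cdot> g = g" using assms(1) by (rule unitE)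
  obtain h' where h': "h' \<in> C" "u \<cdot> h' = h'" "g' \<cdot> h' = u" "g' \<in> C" using assms(2) by (rule unitE)
  have "g \<cdot> g' \<cdot> (h \<cdot> h') = (g \<cdot> h) \<cdot> (g' \<cdot> h')" using h(1,4) h'(1,4) by (simp add: ac)
  then show ?thesis
    using h h' by (intro unitI[of _ "h \<cdot> h'"]) (simp_all flip: assoc)
qed

lemma unit_low: "\<lbrakk>x \<in> C; \<not> u \<preceq> \<tau> x\<rbrakk> \<Longrightarrow> unit (u \<cdot> x)"
proof (rule unitI[of _ "u \<cdot> n x"])
  assume x: "x \<in> C" "\<not> u \<preceq> \<tau> x"
  have "u \<cdot> x \<cdot> (u \<cdot> n x) = u \<cdot> (u \<cdot> (x \<cdot> n x))" using x(1) by (simp add: ac del: uu')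
  then show "u \<cdot> x \<cdot> (u \<cdot> n x) = u" using low_inverse[OF x] by simp
qed simp_all

text \<open>The candidate for the inverse is the residual of \<open>u\<close> by \<open>x\<close>,
  which is \<open>n (x \<cdot> d)\<close>. If its product with \<open>x\<close> misses
  \<open>u\<close>, that product is at most \<open>d\<close>, which unwinds to
  \<open>x \<preceq> x \<cdot> d\<close>, so \<open>x\<close> is fixed by \<open>d\<close>. An
  element fixed by \<open>u\<close> is therefore invertible or fixed by \<open>d\<close>.\<close>

lemma unit_fixed:
  assumes x: "x \<in> C" "u \<cdot> x = x" "d \<cdot> x \<noteq> x"
  shows "unit x"
proof -
  let ?h = "n (x \<cdot> d)"
  have xd: "u \<cdot> (x \<cdot> d) = x \<cdot> d" using x by (simp flip: assoc)
  then have uh: "u \<cdot> ?h = ?h" using x fixed_iff[of "x \<cdot> d"] fixed_iff[of ?h] by simp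
  have le: "x \<cdot> ?h \<preceq> u" using mul_le_iff[of x ?h u] x by simp
  have "x \<cdot> ?h = u"
  proof (rule ccontr)
    assume "x \<cdot> ?h \<noteq> u"
    then have "\<not> u \<preceq> x \<cdot> ?h" using le antisym[of "x \<cdot> ?h" u] x by auto
    then have "x \<cdot> ?h \<preceq> d" using x uh by (intro below_u) (auto simp flip: assoc)
    then have "?h \<preceq> n x" using mul_le_iff[of x ?h d] x by (simp add: comm)
    then have "x \<preceq> x \<cdot> d" using n_le_iff[of x "x \<cdot> d"] x by simp
    moreover have "x \<cdot> d \<preceq> x" using decreasing[OF d_le_e, of x] x by (simp add: comm)
    ultimately show False using antisym[of x "x \<cdot> d"] x by (simp add: comm)
  qed
  then show ?thesis using x uh by (intro unitI[of x ?h]) auto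
qed

text \<open>\<open>\<tau> (x \<cdot> y)\<close> fixes \<open>x \<cdot> y\<close>, hence also its
  multiple \<open>(x \<cdot> n x) \<cdot> d\<close>. This is \<open>d\<close> if \<open>x\<close> is
  in a lower layer and \<open>d \<cdot> d\<close> otherwise; in the second case \<open>d\<close> is
  idempotent or can be cancelled. So \<open>d\<close> is fixed, and every element fixing
  \<open>d\<close> is at most \<open>\<tau> d = u\<close>.\<close>

lemma \<tau>_mul_le:
  assumes xy: "x \<in> C" "y \<in> C" "\<tau> x \<preceq> u" "\<tau> y = u"
  shows "\<tau> (x \<cdot> y) \<preceq> u"
proof -
  let ?w = "\<tau> (x \<cdot> y)"
  have w: "?w \<cdot> (x \<cdot> y) = x \<cdot> y" using xy by (simp add: fixed_iff_le_\<tau> e_le_\<tau>)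
  have "?w \<cdot> ((x \<cdot> n x) \<cdot> (y \<cdot> n y)) = (?w \<cdot> (x \<cdot> y)) \<cdot> (n x \<cdot> n y)" using xy(1,2) by (simp add: ac)
  also have "\<dots> = (x \<cdot> n x) \<cdot> (y \<cdot> n y)" unfolding w using xy(1,2) by (simp add: ac)
  finally have w2: "?w \<cdot> ((x \<cdot> n x) \<cdot> d) = (x \<cdot> n x) \<cdot> d"
    using mul_n_eq[of y] xy by simp
  have "?w \<cdot> d = d"
  proof (cases "u \<preceq> \<tau> x")
    case False
    have "(u \<cdot> (x \<cdot> n x)) \<cdot> d = (x \<cdot> n x) \<cdot> (u \<cdot> d)" using xy(1) by (simp add: ac del: ud du')
    then have "(x \<cdot> n x) \<cdot> d = d" unfolding low_inverse[OF xy(1) False] by simp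
    then show ?thesis using w2 by simp
  next
    case True
    then have "\<tau> x = u" using xy antisym by simp
    then have w3: "?w \<cdot> (d \<cdot> d) = d \<cdot> d" using w2 mul_n_eq[of x] xy by simp
    show ?thesis
    proof (cases "d \<cdot> d = d")
      case False
      then have "unit d" by (intro unit_fixed) simp_all
      then obtain h where h: "h \<in> C" "d \<cdot> h = u" by (rule unitE)
      have "?w \<cdot> d = ?w \<cdot> (d \<cdot> (d \<cdot> h))" using h by simp
      also have "\<dots> = (?w \<cdot> (d \<cdot> d)) \<cdot> h" using h(1) xy(1,2) by (simp add: assoc)
      also have "\<dots> = d \<cdot> (d \<cdot> h)" unfolding w3 using h(1) by (simp add: assoc)
      finally show ?thesis using h by simp
    qed (use w3 in simp)
  qed
  then have "?w \<preceq> \<tau> d" using xy by (intro fixed_le_\<tau>) auto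
  then show ?thesis using \<tau>_pos_idem[OF u] by simp
qed

end

context odd_chain
begin

lemma \<tau>_mul:
  assumes "x \<in> C" "y \<in> C"
  shows "\<tau> (x \<cdot> y) \<preceq> \<tau> x \<or> \<tau> (x \<cdot> y) \<preceq> \<tau> y"
proof -
  have *: "\<tau> (x \<cdot> y) \<preceq> \<tau> y" if "x \<in> C" "y \<in> C" "\<tau> x \<preceq> \<tau> y" for x y
  proof -
    interpret odd_chain_idem C mul e n le "\<tau> y"
      by unfold_locales (simp add: pos_idem_\<tau> that)
    show ?thesis using \<tau>_mul_le that by simp
  qed
  show ?thesis using total[of "\<tau> x" "\<tau> y"] *[of x y] *[of y x] assms by (auto simp: comm)
qed

end

locale odd_chain_pos = odd_chain_idem +
  assumes u_not_le_e: "\<not> u \<preceq> e"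
begin

lemma d_ne_u: "\<not> u \<preceq> d"
  using trans[of u d e] d_le_e u_not_le_e by auto

lemma low_mul:
  assumes "x \<in> C" "y \<in> C" "\<not> u \<preceq> \<tau> x" "\<not> u \<preceq> \<tau> y"
  shows "\<not> u \<preceq> \<tau> (x \<cdot> y)"
  using \<tau>_mul[of x y] assms trans[of u "\<tau> (x \<cdot> y)" "\<tau> x"] trans[of u "\<tau> (x \<cdot> y)" "\<tau> y"] by auto

lemma unit_not_d_fixed:
  assumes "unit g"
  shows "d \<cdot> g \<noteq> g"
proof
  assume g: "d \<cdot> g = g"
  obtain h where h: "g \<in> C" "h \<in> C" "g \<cdot> h = u" using assms by (rule unitE)
  have "d \<cdot> (g \<cdot> h) = g \<cdot> h" using g h(1,2) by (simp flip: assoc)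
  then show False using h d_ne_u by simp
qed

text \<open>The quotient of the two units and the inverse of that quotient both leave
  \<open>d\<close> unchanged. If one of them were not above \<open>u\<close>, it would be at most
  \<open>d\<close>, and the product of both would be at most \<open>d\<close>, but it is
  \<open>u\<close>. Being above \<open>u\<close> together with its inverse, the quotient is
  \<open>u\<close>.\<close>

lemma unit_d_inj:
  assumes "unit g" "unit g'" "d \<cdot> g = d \<cdot> g'"
  shows "g = g'"
proof -
  obtain h where h: "unit h" "g \<in> C" "h \<in> C" "u \<cdot> g = g" "g \<cdot> h = u" using assms(1) by (rule unitE)
  obtain h' where h': "unit h'" "g' \<in> C" "h' \<in> C" "u \<cdot> g' = g'" "h' \<cdot> g' = u" "g' \<cdot> h' = u"
    using assms(2) by (rule unitE)
  have uk: "unit (g \<cdot> h')" using assms h' by (intro unit_mul)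
  then obtain k where k: "k \<in> C" "u \<cdot> k = k" "(g \<cdot> h') \<cdot> k = u" by (rule unitE)
  have "d \<cdot> (g \<cdot> h') = (d \<cdot> g) \<cdot> h'" using h h' by (simp add: assoc)
  also have "\<dots> = d \<cdot> (g' \<cdot> h')" unfolding assms(3) using h'(2,3) by (simp add: assoc)
  finally have dk: "d \<cdot> (g \<cdot> h') = d" using h' by simp
  have "d \<cdot> k = d \<cdot> (g \<cdot> h') \<cdot> k" using dk by simp
  also have "\<dots> = d" using k h(2) h'(3) by (simp add: assoc)
  finally have dk': "d \<cdot> k = d" .
  have 1: "u \<preceq> g \<cdot> h'"
  proof (rule ccontr)
    assume "\<not> ?thesis"
    then have "g \<cdot> h' \<preceq> d" using h(2) h'(3) unit_closed[OF uk] by (intro below_u)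
    then have "g \<cdot> h' \<cdot> k \<preceq> d \<cdot> k" using h(2) h'(3) k(1) by (intro mul_mono) auto
    then show False using k dk' d_ne_u by simp
  qed
  have 2: "u \<preceq> k"
  proof (rule ccontr)
    assume "\<not> ?thesis"
    then have "k \<preceq> d" using k by (intro below_u)
    then have "g \<cdot> h' \<cdot> k \<preceq> g \<cdot> h' \<cdot> d" using h(2) h'(3) k(1) by (intro mul_mono) auto
    then show False using k dk d_ne_u h(2) h'(3) by (simp add: comm)
  qed
  have "g \<cdot> h' \<cdot> u \<preceq> g \<cdot> h' \<cdot> k" using 2 h(2) h'(3) k(1) by (intro mul_mono) auto
  then have "g \<cdot> h' \<preceq> u" using k uk unit_closed[OF uk] h(2) h'(3) by (simp add: comm)
  then have "g \<cdot> h' = u" using 1 antisym h(2) h'(3) by simp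
  then have "g \<cdot> (h' \<cdot> g') = u \<cdot> g'" using h(2) h'(2,3) by (simp flip: assoc)
  then show ?thesis using h h' by (simp add: comm)
qed

text \<open>For idempotent \<open>d\<close> the fibre of \<open>x \<mapsto> d \<cdot> x\<close>
  through a unit \<open>g\<close> runs from \<open>d \<cdot> g\<close> up to \<open>g\<close>.
  Negation sends the bottom of this fibre to the top of the inverse fibre, and \<open>n_unit\<close>
  is the opposite exchange.\<close>

lemma n_d_mul_unit:
  assumes "unit g" "unit h" "g \<cdot> h = u"
  shows "n (d \<cdot> g) = h"
proof (rule antisym)
  have c: "g \<in> C" "h \<in> C" "u \<cdot> g = g" "u \<cdot> h = h" using assms unit_closed by auto
  show "n (d \<cdot> g) \<in> C" "h \<in> C" using c by simp_all
  have "d \<cdot> g \<cdot> h = d" using c assms by (simp add: assoc)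
  then show "h \<preceq> n (d \<cdot> g)" using mul_le_e[of "d \<cdot> g" h] c d_le_e by simp
  let ?z = "n (d \<cdot> g)"
  have "d \<cdot> (g \<cdot> ?z) \<preceq> e" using mul_le_e[of "d \<cdot> g" ?z] c by (simp add: assoc)
  then have "g \<cdot> ?z \<preceq> u" using mul_le_e[of d "g \<cdot> ?z"] c by simp
  then have "h \<cdot> (g \<cdot> ?z) \<preceq> h \<cdot> u" using c by (intro mul_mono) auto
  moreover have "h \<cdot> (g \<cdot> ?z) = (g \<cdot> h) \<cdot> ?z" using c(1,2) by (simp add: ac)
  ultimately have "u \<cdot> ?z \<preceq> h" using c assms by (simp add: comm)
  then show "?z \<preceq> h" using increasing[OF e_le_u, of ?z] c trans[of ?z "u \<cdot> ?z" h] by simp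
qed

lemma n_unit:
  assumes "x \<in> C" "\<tau> x = u" "unit x" "unit h" "x \<cdot> h = u"
  shows "n x = d \<cdot> h"
proof -
  have c: "h \<in> C" using assms unit_closed by auto
  have "u \<cdot> n x = n x" using fixed_iff[of "n x"] assms by simp
  then have "n x = h \<cdot> (x \<cdot> n x)" using assms c by (simp add: lcomm[of h x "n x"] flip: assoc) (simp add: comm)
  then show ?thesis using mul_n_eq[of x] assms c by (simp add: comm)
qed

end

section \<open>Constructions of odd chains on the reals\<close>

text \<open>The bottom absorbs even the top, as residuation requires; only then does the top absorb
  the rest.\<close>

definition ext_mul :: "(real \<Rightarrow> real \<Rightarrow> real) \<Rightarrow> ereal \<Rightarrow> ereal \<Rightarrow> ereal" where
  "ext_mul m x y = (if x = -\<infinity> \<or> y = -\<infinity> then -\<infinity> else if x = \<infinity> \<or> y = \<infinity> then \<infinity>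
     else ereal (m (real_of_ereal x) (real_of_ereal y)))"

definition ext_neg :: "(real \<Rightarrow> real) \<Rightarrow> ereal \<Rightarrow> ereal" where
  "ext_neg n x = (if x = \<infinity> then -\<infinity> else if x = -\<infinity> then \<infinity> else ereal (n (real_of_ereal x)))"

lemma ext_simps [simp]:
  "ext_mul m (-\<infinity>) y = -\<infinity>" "ext_mul m x (-\<infinity>) = -\<infinity>"
  "x \<noteq> -\<infinity> \<Longrightarrow> ext_mul m x \<infinity> = \<infinity>" "x \<noteq> -\<infinity> \<Longrightarrow> ext_mul m \<infinity> x = \<infinity>"
  "ext_mul m (ereal a) (ereal b) = ereal (m a b)"
  "ext_neg n \<infinity> = -\<infinity>" "ext_neg n (-\<infinity>) = \<infinity>" "ext_neg n (ereal a) = ereal (n a)"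
  by (simp_all add: ext_mul_def ext_neg_def)

lemma ext_mul_eq_MInf [simp]: "ext_mul m x y = -\<infinity> \<longleftrightarrow> x = -\<infinity> \<or> y = -\<infinity>"
  by (simp add: ext_mul_def)

lemma ext_neg_eq_MInf [simp]: "ext_neg n x = -\<infinity> \<longleftrightarrow> x = \<infinity>"
  by (simp add: ext_neg_def)

lemma odd_chain_ext:
  assumes "odd_chain UNIV m e n (\<le>)"
  shows "odd_chain UNIV (ext_mul m) (ereal e) (ext_neg n) (\<le>)"
proof -
  interpret odd_chain UNIV m e n "(\<le>)" by fact
  show ?thesis
  proof
    fix x y z :: ereal
    show "ext_mul m (ext_mul m x y) z = ext_mul m x (ext_mul m y z)"
      by (cases x; cases y; cases z) (simp_all add: assoc)
    show "ext_mul m x y = ext_mul m y x"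
      by (cases x; cases y) (simp_all add: comm)
    show "ext_mul m (ereal e) x = x" by (cases x) simp_all
    show "ext_mul m x y \<le> ereal e \<longleftrightarrow> y \<le> ext_neg n x"
      by (cases x; cases y) (simp_all add: mul_le_e)
    show "ext_neg n (ext_neg n x) = x" by (cases x) simp_all
  qed auto
qed

definition lex_le :: "('r :: order) \<times> ereal \<Rightarrow> 'r \<times> ereal \<Rightarrow> bool" where
  "lex_le p q \<longleftrightarrow> fst p < fst q \<or> fst p = fst q \<and> snd p \<le> snd q"

definition lex_mul :: "(real \<Rightarrow> real \<Rightarrow> real) \<Rightarrow> ('r :: plus) \<times> ereal \<Rightarrow> 'r \<times> ereal \<Rightarrow> 'r \<times> ereal" where
  "lex_mul m p q = (fst p + fst q, ext_mul m (snd p) (snd q))"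

text \<open>Every element of \<open>H\<close> is replaced by a bounded copy of the given chain.\<close>

definition lex_carrier :: "'r set \<Rightarrow> ('r \<times> ereal) set" where
  "lex_carrier H = {(r, y). r \<in> H \<or> y = -\<infinity>}"

lemma mem_lex_carrier: "p \<in> lex_carrier H \<longleftrightarrow> fst p \<in> H \<or> snd p = -\<infinity>"
  by (cases p) (simp add: lex_carrier_def)

definition lex_neg :: "'r set \<Rightarrow> (real \<Rightarrow> real) \<Rightarrow> ('r :: uminus) \<times> ereal \<Rightarrow> 'r \<times> ereal" where
  "lex_neg H n p = (- fst p, if fst p \<in> H then ext_neg n (snd p) else -\<infinity>)"

text \<open>All reals stay as first coordinates, so that the order has no holes, but outside
  \<open>H\<close> only the bottom \<open>(r, -\<infinity>)\<close> is present. Over such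
  \<open>r\<close> negation can only change the sign of \<open>r\<close>; over \<open>H\<close> it
  exchanges top and bottom. Closure of \<open>H\<close> under negation and addition makes the two
  cases compatible.\<close>

lemma odd_chain_lex:
  fixes H :: "real set"
  assumes "odd_chain UNIV m e n (\<le>)" and H: "0 \<in> H"
    "\<And>r s. r \<in> H \<Longrightarrow> s \<in> H \<Longrightarrow> r + s \<in> H" "\<And>r. r \<in> H \<Longrightarrow> - r \<in> H"
  shows "odd_chain (lex_carrier H) (lex_mul m) (0, ereal e) (lex_neg H n) lex_le"
proof -
  interpret ext: odd_chain UNIV "ext_mul m" "ereal e" "ext_neg n" "(\<le>)"
    by (rule odd_chain_ext) fact
  have Hm: "- r \<in> H \<longleftrightarrow> r \<in> H" for r using H(3)[of r] H(3)[of "- r"] by auto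
  show ?thesis
  proof
    fix p q s :: "real \<times> ereal"
    assume p: "p \<in> lex_carrier H"
    show "lex_neg H n p \<in> lex_carrier H"
      using p H by (auto simp: lex_neg_def mem_lex_carrier prod_eq_iff)
    show "lex_mul m (0, ereal e) p = p" by (cases p) (simp add: lex_mul_def)
    show "lex_neg H n (lex_neg H n p) = p"
      using p by (auto simp: lex_neg_def mem_lex_carrier prod_eq_iff Hm)
    assume q: "q \<in> lex_carrier H"
    show "lex_mul m p q \<in> lex_carrier H"
      using p q H(2) by (auto simp: lex_mul_def mem_lex_carrier)
    show "lex_mul m p q = lex_mul m q p" by (simp add: lex_mul_def ext.comm add.commute)
    show "lex_le p q \<Longrightarrow> lex_le q p \<Longrightarrow> p = q" by (auto simp: lex_le_def prod_eq_iff)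
    show "lex_le p q \<or> lex_le q p" by (auto simp: lex_le_def)
    show "lex_le (lex_mul m p q) (0, ereal e) \<longleftrightarrow> lex_le q (lex_neg H n p)"
    proof (cases "fst p + fst q = 0")
      case True
      then have q': "fst q = - fst p" by simp
      show ?thesis
      proof (cases "fst p \<in> H")
        case True
        then show ?thesis by (simp add: lex_le_def lex_mul_def lex_neg_def q' ext.mul_le_e)
      next
        case False
        then have "snd p = -\<infinity>" "snd q = -\<infinity>"
            using p q Hm[of "fst p"] unfolding q'[symmetric] by (simp_all add: mem_lex_carrier)
        then show ?thesis using False by (simp add: lex_le_def lex_mul_def lex_neg_def q')
      qed
    qed (auto simp: lex_le_def lex_mul_def lex_neg_def)
    assume "s \<in> lex_carrier H"
    show "lex_mul m (lex_mul m p q) s = lex_mul m p (lex_mul m q s)"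
      by (simp add: lex_mul_def ext.assoc add.assoc)
    show "lex_le p q \<Longrightarrow> lex_le q s \<Longrightarrow> lex_le p s" by (auto simp: lex_le_def)
  qed (use H in \<open>simp add: lex_carrier_def\<close>)
qed

text \<open>Every integer \<open>z\<close> is replaced by a copy of the given chain with a top \<open>(z, \<infinity>)\<close> but no bottom.
  The negation of a top is shifted by one: the residual unit of the tops is \<open>(0, \<infinity>)\<close>, whose
  negation is the next smaller top.\<close>

definition shift_carrier :: "(int \<times> ereal) set" where
  "shift_carrier = {(z, y). y \<noteq> -\<infinity>}"

definition shift_neg :: "(real \<Rightarrow> real) \<Rightarrow> int \<times> ereal \<Rightarrow> int \<times> ereal" where
  "shift_neg n p = (if snd p = \<infinity> then (- fst p - 1, \<infinity>) else (- fst p, ext_neg n (snd p)))"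

lemma odd_chain_shift:
  assumes "odd_chain UNIV m e n (\<le>)"
  shows "odd_chain shift_carrier (lex_mul m) (0, ereal e) (shift_neg n) lex_le"
proof -
  interpret ext: odd_chain UNIV "ext_mul m" "ereal e" "ext_neg n" "(\<le>)"
    by (rule odd_chain_ext) fact
  show ?thesis
  proof
    fix p q s :: "int \<times> ereal"
    assume p: "p \<in> shift_carrier"
    show "shift_neg n p \<in> shift_carrier"
      using p by (auto simp: shift_neg_def shift_carrier_def)
    show "lex_mul m (0, ereal e) p = p" by (cases p) (simp add: lex_mul_def)
    show "shift_neg n (shift_neg n p) = p"
      using p by (cases p; cases "snd p") (auto simp: shift_neg_def shift_carrier_def odd_chain.n_n[OF assms])
    assume q: "q \<in> shift_carrier"
    show "lex_mul m p q \<in> shift_carrier"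
      using p q by (auto simp: lex_mul_def shift_carrier_def)
    show "lex_mul m p q = lex_mul m q p" by (simp add: lex_mul_def ext.comm add.commute)
    show "lex_le p q \<Longrightarrow> lex_le q p \<Longrightarrow> p = q" by (auto simp: lex_le_def prod_eq_iff)
    show "lex_le p q \<or> lex_le q p" by (auto simp: lex_le_def)
    show "lex_le (lex_mul m p q) (0, ereal e) \<longleftrightarrow> lex_le q (shift_neg n p)"
    proof (cases "snd p = \<infinity>")
      case True
      moreover have "ext_mul m \<infinity> (snd q) = \<infinity>" using q by (auto simp: shift_carrier_def)
      ultimately show ?thesis by (auto simp: lex_le_def lex_mul_def shift_neg_def)
    next
      case False
      show ?thesis
      proof (cases "fst q = - fst p")
        case True
        then show ?thesis using False by (simp add: lex_le_def lex_mul_def shift_neg_def ext.mul_le_e)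
      next
        case ne: False
        then have "fst p + fst q \<noteq> 0" by simp
        then show ?thesis using False ne by (auto simp: lex_le_def lex_mul_def shift_neg_def)
      qed
    qed
    assume "s \<in> shift_carrier"
    show "lex_mul m (lex_mul m p q) s = lex_mul m p (lex_mul m q s)"
      by (simp add: lex_mul_def ext.assoc add.assoc)
    show "lex_le p q \<Longrightarrow> lex_le q s \<Longrightarrow> lex_le p s" by (auto simp: lex_le_def)
  qed (simp add: shift_carrier_def)
qed

lemma odd_chain_add: "odd_chain UNIV (+) (0 :: real) uminus (\<le>)"
  by unfold_locales auto

text \<open>The target is a full chain, while the operations of the source are respected only where
  arguments and result lie in \<open>E\<close>. This is all that evaluating finitely many formulas
  asks for, and it lets \<open>E\<close> stay finite.\<close>

locale partial_embedding = odd_chain C mul e n le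
    for C :: "'a set" and mul e n and le :: "'a \<Rightarrow> 'a \<Rightarrow> bool" +
  fixes E :: "'a set" and D :: "'b set" and mul' e' n' le' and \<rho> :: "'a \<Rightarrow> 'b"
  assumes E: "E \<subseteq> C" "e \<in> E"
    and target: "odd_chain D mul' e' n' le'"
    and \<rho>_closed: "x \<in> E \<Longrightarrow> \<rho> x \<in> D"
    and \<rho>_le: "\<lbrakk>x \<in> E; y \<in> E\<rbrakk> \<Longrightarrow> le x y \<longleftrightarrow> le' (\<rho> x) (\<rho> y)"
    and \<rho>_mul: "\<lbrakk>x \<in> E; y \<in> E; mul x y \<in> E\<rbrakk> \<Longrightarrow> \<rho> (mul x y) = mul' (\<rho> x) (\<rho> y)"
    and \<rho>_n: "\<lbrakk>x \<in> E; n x \<in> E\<rbrakk> \<Longrightarrow> \<rho> (n x) = n' (\<rho> x)"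
    and \<rho>_e: "\<rho> e = e'"

lemma odd_chain_transport:
  fixes le :: "'a \<Rightarrow> 'a \<Rightarrow> bool"
  assumes "odd_chain C m e n le" and \<beta>: "bij_betw \<beta> C D"
    and le: "\<And>x y. x \<in> C \<Longrightarrow> y \<in> C \<Longrightarrow> le x y \<longleftrightarrow> le' (\<beta> x) (\<beta> y)"
  defines "\<gamma> \<equiv> inv_into C \<beta>"
  shows "odd_chain D (\<lambda>x y. \<beta> (m (\<gamma> x) (\<gamma> y))) (\<beta> e) (\<lambda>x. \<beta> (n (\<gamma> x))) le'"
proof -
  interpret odd_chain C m e n le by fact
  have \<gamma> [simp]: "x \<in> C \<Longrightarrow> \<gamma> (\<beta> x) = x" "y \<in> D \<Longrightarrow> \<beta> (\<gamma> y) = y" "y \<in> D \<Longrightarrow> \<gamma> y \<in> C" for x y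
    using \<beta> unfolding \<gamma>_def bij_betw_def by (auto simp: f_inv_into_f inv_into_into)
  have \<beta>D [simp]: "x \<in> C \<Longrightarrow> \<beta> x \<in> D" for x using \<beta> unfolding bij_betw_def by auto
  have le': "le' x y \<longleftrightarrow> le (\<gamma> x) (\<gamma> y)" if "x \<in> D" "y \<in> D" for x y
    using le[of "\<gamma> x" "\<gamma> y"] that by simp
  show ?thesis
  proof
    fix x y z
    assume x: "x \<in> D"
    show "\<beta> (n (\<gamma> x)) \<in> D" "\<beta> (m (\<gamma> (\<beta> e)) (\<gamma> x)) = x" "\<beta> (n (\<gamma> (\<beta> (n (\<gamma> x))))) = x"
      using x by simp_all
    assume y: "y \<in> D"
    show "\<beta> (m (\<gamma> x) (\<gamma> y)) \<in> D" "\<beta> (m (\<gamma> x) (\<gamma> y)) = \<beta> (m (\<gamma> y) (\<gamma> x))"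
      using x y by (simp_all add: comm)
    show "le' x y \<Longrightarrow> le' y x \<Longrightarrow> x = y"
      using antisym[of "\<gamma> x" "\<gamma> y"] \<gamma>(2)[OF x] \<gamma>(2)[OF y] le'[OF x y] le'[OF y x] \<gamma>(3)[OF x] \<gamma>(3)[OF y]
      by metis
    show "le' x y \<or> le' y x" using x y by (simp add: le' total)
    show "le' (\<beta> (m (\<gamma> x) (\<gamma> y))) (\<beta> e) = le' y (\<beta> (n (\<gamma> x)))"
      using x y by (simp add: le' mul_le_e)
    assume z: "z \<in> D"
    show "\<beta> (m (\<gamma> (\<beta> (m (\<gamma> x) (\<gamma> y)))) (\<gamma> z)) = \<beta> (m (\<gamma> x) (\<gamma> (\<beta> (m (\<gamma> y) (\<gamma> z)))))"
      using x y z by (simp add: assoc)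
    show "le' x y \<Longrightarrow> le' y z \<Longrightarrow> le' x z"
      using trans[of "\<gamma> x" "\<gamma> y" "\<gamma> z"] \<gamma>(3)[OF x] \<gamma>(3)[OF y] \<gamma>(3)[OF z]
        le'[OF x y] le'[OF y z] le'[OF x z] by blast
  qed simp
qed

lemma partial_embedding_transport:
  fixes le :: "'a \<Rightarrow> 'a \<Rightarrow> bool"
  assumes "partial_embedding C m e n le E D m' e' n' le' \<rho>" and \<beta>: "bij_betw \<beta> D D'"
    and le: "\<And>x y. x \<in> D \<Longrightarrow> y \<in> D \<Longrightarrow> le' x y \<longleftrightarrow> le'' (\<beta> x) (\<beta> y)"
  shows "\<exists>m'' e'' n''. partial_embedding C m e n le E D' m'' e'' n'' le'' (\<beta> \<circ> \<rho>)"
proof (intro exI)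
  interpret partial_embedding C m e n le E D m' e' n' le' \<rho> by fact
  interpret D: odd_chain D m' e' n' le' by (rule target)
  let ?\<gamma> = "inv_into D \<beta>"
  have \<gamma>: "x \<in> D \<Longrightarrow> ?\<gamma> (\<beta> x) = x" for x
    using \<beta> unfolding bij_betw_def by simp
  have \<beta>D: "x \<in> D \<Longrightarrow> \<beta> x \<in> D'" for x using \<beta> unfolding bij_betw_def by auto
  show "partial_embedding C m e n le E D' (\<lambda>x y. \<beta> (m' (?\<gamma> x) (?\<gamma> y))) (\<beta> e') (\<lambda>x. \<beta> (n' (?\<gamma> x))) le'' (\<beta> \<circ> \<rho>)"
  proof (intro partial_embedding.intro partial_embedding_axioms.intro)
    show "odd_chain C m e n le" by (rule odd_chain_axioms)
    show "odd_chain D' (\<lambda>x y. \<beta> (m' (?\<gamma> x) (?\<gamma> y))) (\<beta> e') (\<lambda>x. \<beta> (n' (?\<gamma> x))) le''"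
      using target \<beta> le by (rule odd_chain_transport)
  qed (use E \<rho>_closed \<rho>_le \<rho>_mul \<rho>_n \<rho>_e in \<open>simp_all add: \<gamma> \<beta>D le\<close>)
qed

lemma bij_betw_lex_carrier:
  fixes H :: "real set"
  assumes "countable H"
  shows "\<exists>\<beta>. bij_betw \<beta> (lex_carrier H) (UNIV :: real set) \<and>
    (\<forall>p\<in>lex_carrier H. \<forall>q\<in>lex_carrier H. lex_le p q \<longleftrightarrow> \<beta> p \<le> \<beta> q)"
proof -
  obtain \<beta> :: "real \<times> ereal \<Rightarrow> real" where \<beta>: "bij_betw \<beta> {(r, y). r \<in> H \<or> y = -\<infinity>} (UNIV :: real set)"
    "\<forall>r y r' y'. (r \<in> H \<or> y = -\<infinity>) \<longrightarrow> (r' \<in> H \<or> y' = -\<infinity>) \<longrightarrow>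
      (\<beta> (r, y) \<le> \<beta> (r', y') \<longleftrightarrow> r < r' \<or> r = r' \<and> y \<le> y')"
    using bij_betw_lex_real[OF assms] by (elim exE conjE) (rule that)
  then show ?thesis
    by (intro exI[of _ \<beta>]) (auto simp: lex_carrier_def lex_le_def)
qed

lemma bij_betw_shift_carrier:
  "\<exists>\<beta>. bij_betw \<beta> shift_carrier (UNIV :: real set) \<and>
    (\<forall>p\<in>shift_carrier. \<forall>q\<in>shift_carrier. lex_le p q \<longleftrightarrow> \<beta> p \<le> \<beta> q)"
  using bij_betw_lex_int lex_int_le unfolding shift_carrier_def
  by (intro exI[of _ "\<lambda>(z, y). real_of_int z + squash y"]) (auto simp: lex_le_def)

section \<open>Embedding a finite set layer by layer\<close>

context odd_chain
begin

text \<open>The invertible elements of the monoid of all elements fixed by the idempotent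
  \<open>v\<close>, which is its unit. It is used for \<open>e\<close>, for \<open>u\<close>, and
  for \<open>d\<close>, which lies below \<open>e\<close>.\<close>

definition local_group :: "'a \<Rightarrow> 'a monoid" where
  "local_group v = units_of \<lparr>carrier = {x\<in>C. v \<cdot> x = x}, monoid.mult = mul, one = v\<rparr>"

lemma local_group_simps [simp]:
  "monoid.mult (local_group v) = mul" "one (local_group v) = v"
  by (simp_all add: local_group_def units_of_def)

lemma mem_local_group:
  "x \<in> carrier (local_group v) \<longleftrightarrow> x \<in> C \<and> v \<cdot> x = x \<and> (\<exists>h\<in>C. v \<cdot> h = h \<and> x \<cdot> h = v)"
  by (auto simp: local_group_def units_of_def Units_def comm)

lemma ordered_comm_group_local:
  assumes v: "v \<in> C" "v \<cdot> v = v"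
  shows "ordered_comm_group (local_group v) le"
proof -
  let ?M = "\<lparr>carrier = {x\<in>C. v \<cdot> x = x}, monoid.mult = mul, one = v\<rparr>"
  have "comm_monoid ?M"
  proof
    fix x y z
    assume x: "x \<in> carrier ?M"
    show "x \<otimes>\<^bsub>?M\<^esub> \<one>\<^bsub>?M\<^esub> = x" using comm[of x v] x v by simp
    assume "y \<in> carrier ?M"
    then show "x \<otimes>\<^bsub>?M\<^esub> y = y \<otimes>\<^bsub>?M\<^esub> x" "x \<otimes>\<^bsub>?M\<^esub> y \<in> carrier ?M"
      using x v comm[of x y] assoc[of v x y] by simp_all
    assume "z \<in> carrier ?M"
    then show "x \<otimes>\<^bsub>?M\<^esub> y \<otimes>\<^bsub>?M\<^esub> z = x \<otimes>\<^bsub>?M\<^esub> (y \<otimes>\<^bsub>?M\<^esub> z)"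
      using x \<open>y \<in> carrier ?M\<close> assoc[of x y z] by simp
  qed (use v in auto)
  then interpret G: comm_group "local_group v"
    unfolding local_group_def by (rule comm_monoid.units_comm_group)
  show ?thesis
  proof
    fix x y z
    assume x: "x \<in> carrier (local_group v)" and y: "y \<in> carrier (local_group v)"
    then have c: "x \<in> C" "y \<in> C" by (simp_all add: mem_local_group)
    show "x \<preceq> y \<Longrightarrow> y \<preceq> x \<Longrightarrow> x = y" using c antisym by simp
    show "x \<preceq> y \<or> y \<preceq> x" using c total by simp
    assume "z \<in> carrier (local_group v)"
    then have z: "z \<in> C" by (simp add: mem_local_group)
    show "x \<preceq> y \<Longrightarrow> y \<preceq> z \<Longrightarrow> x \<preceq> z" using c z trans[of x y z] by simp
    show "x \<preceq> y \<Longrightarrow> x \<otimes>\<^bsub>local_group v\<^esub> z \<preceq> y \<otimes>\<^bsub>local_group v\<^esub> z" using c z mul_mono(2) by simp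
  qed
qed

lemma local_subgroup:
  assumes v: "v \<in> C" "v \<cdot> v = v" and K: "subgroup K (local_group v)"
  shows "K \<subseteq> C" "v \<in> K" "\<forall>x\<in>K. v \<cdot> x = x" "\<forall>x\<in>K. \<exists>y\<in>K. x \<cdot> y = v" "\<forall>x\<in>K. \<forall>y\<in>K. x \<cdot> y \<in> K"
proof -
  interpret G: ordered_comm_group "local_group v" le using v by (rule ordered_comm_group_local)
  interpret K: subgroup K "local_group v" by (rule K)
  show "K \<subseteq> C" "\<forall>x\<in>K. v \<cdot> x = x" using K.subset by (auto simp: mem_local_group)
  show "v \<in> K" using K.one_closed by simp
  show "\<forall>x\<in>K. \<forall>y\<in>K. x \<cdot> y \<in> K" using K.m_closed by simp
  show "\<forall>x\<in>K. \<exists>y\<in>K. x \<cdot> y = v"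
  proof
    fix x assume "x \<in> K"
    then show "\<exists>y\<in>K. x \<cdot> y = v"
      using G.r_inv[of x] K.subset K.m_inv_closed[of x] by (intro bexI[of _ "inv\<^bsub>local_group v\<^esub> x"]) auto
  qed
qed

lemma local_embedding_real:
  assumes v: "v \<in> C" "v \<cdot> v = v" and E: "finite E" "E \<subseteq> carrier (local_group v)" "v \<in> E"
  shows "\<exists>K (w :: 'a \<Rightarrow> real). subgroup K (local_group v) \<and> E \<subseteq> K \<and> countable K \<and> inj_on w K \<and>
    (\<forall>x\<in>K. \<forall>y\<in>K. w (x \<cdot> y) = w x + w y) \<and> (\<forall>x\<in>E. \<forall>y\<in>E. \<not> x \<preceq> y \<longrightarrow> w y < w x)"
proof -
  interpret G: ordered_comm_group "local_group v" le using v by (rule ordered_comm_group_local)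
  show ?thesis using G.finite_embedding_real[of E] E by simp
qed

lemma local_embedding_int:
  assumes v: "v \<in> C" "v \<cdot> v = v" and E: "finite E" "E \<subseteq> carrier (local_group v)" "v \<in> E"
    and a: "a \<in> E" "\<not> a \<preceq> v" "\<And>y. y \<in> carrier (local_group v) \<Longrightarrow> \<not> y \<preceq> v \<Longrightarrow> a \<preceq> y"
  shows "\<exists>K (w :: 'a \<Rightarrow> int). subgroup K (local_group v) \<and> E \<subseteq> K \<and> w a = 1 \<and>
    (\<forall>x\<in>K. \<forall>y\<in>K. w (x \<cdot> y) = w x + w y) \<and> (\<forall>x\<in>E. \<forall>y\<in>E. \<not> x \<preceq> y \<longrightarrow> w y < w x)"
proof -
  interpret G: ordered_comm_group "local_group v" le using v by (rule ordered_comm_group_local)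
  show ?thesis using G.finite_embedding_int[of E a] E a by simp
qed

text \<open>With \<open>\<tau> x = e\<close> the product \<open>x \<cdot> n x\<close> equals
  \<open>n e = e\<close>: negation is inversion, and \<open>E\<close> lies in an ordered
  group.\<close>

lemma embedding_group:
  assumes E: "finite E" "E \<subseteq> C" "e \<in> E" and low: "\<And>x. x \<in> E \<Longrightarrow> \<tau> x = e"
  shows "\<exists>w. partial_embedding C mul e n le E (UNIV :: real set) (+) 0 uminus (\<le>) w"
proof -
  have inv: "x \<cdot> n x = e" if "x \<in> E" for x
    using mul_n_eq[of x] low[OF that] E that by auto
  have "E \<subseteq> carrier (local_group e)"
  proof
    fix x assume "x \<in> E"
    then show "x \<in> carrier (local_group e)"
      using E(2) inv by (auto simp: mem_local_group subset_eq intro!: bexI[of _ "n x"])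
  qed
  then obtain K and w :: "'a \<Rightarrow> real" where K: "subgroup K (local_group e)" "E \<subseteq> K" "inj_on w K"
    and add: "\<forall>x\<in>K. \<forall>y\<in>K. w (x \<cdot> y) = w x + w y"
    and less: "\<forall>x\<in>E. \<forall>y\<in>E. \<not> x \<preceq> y \<longrightarrow> w y < w x"
    using local_embedding_real[of e E] E by auto
  have "e \<in> K" using K E by auto
  then have w0: "w e = 0" using add[rule_format, of e e] by simp
  show ?thesis
  proof (intro exI[of _ w] partial_embedding.intro partial_embedding_axioms.intro)
    show "odd_chain C mul e n le" by (rule odd_chain_axioms)
    show "odd_chain UNIV (+) (0 :: real) uminus (\<le>)" by (rule odd_chain_add)
    fix x y assume x: "x \<in> E"
    show "n x \<in> E \<Longrightarrow> w (n x) = - w x"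
      using add[rule_format, of x "n x"] inv[OF x] w0 K(2) x by (auto simp: subset_eq)
    assume y: "y \<in> E"
    show "w (x \<cdot> y) = w x + w y" using add K(2) x y by auto
    show "x \<preceq> y \<longleftrightarrow> w x \<le> w y"
    proof (cases "x = y")
      case True
      then show ?thesis using x E by auto
    next
      case False
      then show ?thesis using less x y antisym[of x y] total[of x y] E by fastforce
    qed
  qed (use E w0 in auto)
qed

end

section \<open>Adding one layer on top of an embedding of the lower ones\<close>

locale embedding_step = odd_chain_pos C mul e n le u
  for C :: "'a set" and mul (infixl "\<cdot>" 70) and e n and le (infix "\<preceq>" 50) and u +
  fixes E m' e' n' \<rho>
  assumes finE: "finite E" and EC: "E \<subseteq> C" and eE: "e \<in> E" and \<tau>_le_u: "x \<in> E \<Longrightarrow> \<tau> x \<preceq> u"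
    and low_embedding: "partial_embedding C mul e n le {x\<in>E. \<not> u \<preceq> \<tau> x} (UNIV :: real set) m' e' n' (\<le>) \<rho>"
begin

text \<open>Position of \<open>x\<close> inside its fibre: the lower layers keep their real value,
  and an element of layer \<open>u\<close> is the bottom if \<open>d\<close> fixes it and otherwise,
  being a unit, the top.\<close>

definition hat :: "'a \<Rightarrow> ereal" where
  "hat x = (if \<not> u \<preceq> \<tau> x then ereal (\<rho> x) else if d \<cdot> x = x then -\<infinity> else \<infinity>)"

lemma E_closed [simp]: "x \<in> E \<Longrightarrow> x \<in> C"
  using EC by auto

lemma upper:
  assumes "x \<in> E" "u \<preceq> \<tau> x"
  shows "\<tau> x = u" "u \<cdot> x = x" "x \<cdot> n x = d"
proof -
  show t: "\<tau> x = u" using antisym[of "\<tau> x" u] assms \<tau>_le_u[of x] by simp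
  show "u \<cdot> x = x" using fixed_iff[of x] assms by simp
  show "x \<cdot> n x = d" using mul_n_eq[of x] t assms by simp
qed

lemma hat_target: "odd_chain UNIV m' e' n' (\<le>)"
  using partial_embedding.target[OF low_embedding] .

lemma hat_e: "hat e = ereal e'"
  using u_not_le_e partial_embedding.\<rho>_e[OF low_embedding] by (simp add: hat_def)

lemma hat_cases: "hat x = -\<infinity> \<or> hat x = \<infinity> \<or> hat x \<noteq> -\<infinity> \<and> \<not> u \<preceq> \<tau> x"
  by (simp add: hat_def)

lemma hat_MInf: "x \<in> E \<Longrightarrow> hat x = -\<infinity> \<longleftrightarrow> u \<preceq> \<tau> x \<and> d \<cdot> x = x"
  by (simp add: hat_def)

lemma d_fixed_upper: "x \<in> C \<Longrightarrow> d \<cdot> x = x \<Longrightarrow> u \<cdot> x = x"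
  using du'(2)[of x] by simp

lemma unit_of_hat: "x \<in> E \<Longrightarrow> hat x \<noteq> -\<infinity> \<Longrightarrow> unit (u \<cdot> x)"
  using unit_low[of x] unit_fixed[of x] upper[of x] by (auto simp: hat_def split: if_splits)

text \<open>Being fixed by \<open>d\<close> passes to all multiples, so the bottom absorbs. An
  element that is not a bottom becomes a unit after multiplication by \<open>u\<close>; a top is
  such a unit already, so its product with a non-bottom is a unit, which \<open>d\<close> does not
  fix, and hence again a top. Two low factors stay low by \<open>low_mul\<close>.\<close>

lemma hat_mul:
  assumes xy: "x \<in> E" "y \<in> E" "x \<cdot> y \<in> E"
  shows "hat (x \<cdot> y) = ext_mul m' (hat x) (hat y)"
proof -
  have bot: "hat (x \<cdot> y) = -\<infinity>" if "hat x = -\<infinity>" "x \<in> E" "y \<in> E" for x y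
  proof -
    have "d \<cdot> x = x" using that hat_MInf by blast
    then have "d \<cdot> (x \<cdot> y) = x \<cdot> y" using that(2,3) by (simp flip: assoc)
    moreover from this have "u \<preceq> \<tau> (x \<cdot> y)"
      using fixed_iff[of "x \<cdot> y"] d_fixed_upper[of "x \<cdot> y"] that(2,3) by simp
    ultimately show ?thesis by (simp add: hat_def)
  qed
  have top: "hat (x \<cdot> y) = \<infinity>" if "hat x = \<infinity>" "hat y \<noteq> -\<infinity>" "x \<in> E" "y \<in> E" for x y
  proof -
    have ux: "u \<cdot> x = x" using that upper[of x] by (auto simp: hat_def split: if_splits)
    have "unit (u \<cdot> x \<cdot> (u \<cdot> y))" using that by (intro unit_mul unit_of_hat) auto
    moreover have eq: "u \<cdot> x \<cdot> (u \<cdot> y) = x \<cdot> y" using ux that(3,4) by (simp add: lcomm flip: assoc)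
    ultimately have "d \<cdot> (x \<cdot> y) \<noteq> x \<cdot> y" "u \<cdot> (x \<cdot> y) = x \<cdot> y"
      using unit_not_d_fixed unit_closed by metis+
    then show ?thesis using fixed_iff[of "x \<cdot> y"] that(3,4) by (simp add: hat_def)
  qed
  consider "hat x = -\<infinity>" | "hat y = -\<infinity>" | "hat x = \<infinity>" "hat y \<noteq> -\<infinity>" | "hat y = \<infinity>" "hat x \<noteq> -\<infinity>"
    | "\<not> u \<preceq> \<tau> x" "\<not> u \<preceq> \<tau> y"
    using hat_cases[of x] hat_cases[of y] by argo
  then show ?thesis
  proof cases
    case 1
    then show ?thesis using bot[of x y] xy by simp
  next
    case 2
    then show ?thesis using bot[of y x] xy by (simp add: comm)
  next
    case 3
    then show ?thesis using top[of x y] xy by simp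
  next
    case 4
    then show ?thesis using top[of y x] xy by (simp add: comm)
  next
    case 5
    then have "\<not> u \<preceq> \<tau> (x \<cdot> y)" using low_mul xy by simp
    then show ?thesis using 5 xy partial_embedding.\<rho>_mul[OF low_embedding, of x y] by (simp add: hat_def)
  qed
qed

text \<open>A bottom \<open>x\<close> equals \<open>d \<cdot> x = d \<cdot> y \<preceq> y\<close>.
  For a top \<open>y\<close>, injectivity of \<open>d\<close> on units turns
  \<open>d \<cdot> x = d \<cdot> y\<close> into \<open>u \<cdot> x = u \<cdot> y = y\<close>, which
  lies above \<open>x\<close>.\<close>

lemma hat_less:
  assumes xy: "x \<in> E" "y \<in> E" "d \<cdot> x = d \<cdot> y" "hat x < hat y"
  shows "x \<preceq> y \<and> x \<noteq> y"
proof -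
  have ne: "x \<noteq> y" using xy by auto
  have y: "hat y \<noteq> -\<infinity>" using xy by auto
  consider "hat x = -\<infinity>" | "\<not> u \<preceq> \<tau> x" "hat y = \<infinity>" | "\<not> u \<preceq> \<tau> x" "\<not> u \<preceq> \<tau> y"
    using xy by (auto simp: hat_def split: if_splits)
  then show ?thesis
  proof cases
    case 1
    then have "x = d \<cdot> y" using xy hat_MInf[of x] by auto
    then show ?thesis using decreasing[OF d_le_e, of y] xy ne by simp
  next
    case 2
    then have y: "u \<cdot> y = y" using xy upper[of y] by (auto simp: hat_def split: if_splits)
    have "u \<cdot> x = u \<cdot> y"
      by (rule unit_d_inj[OF unit_of_hat unit_of_hat]) (use 2 xy in \<open>auto simp: hat_def\<close>)
    then show ?thesis using increasing[OF e_le_u, of x] xy y ne by simp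
  next
    case 3
    then show ?thesis using partial_embedding.\<rho>_le[OF low_embedding, of x y] xy ne by (simp add: hat_def)
  qed
qed

lemma hat_eq:
  assumes xy: "x \<in> E" "y \<in> E" "d \<cdot> x = d \<cdot> y" "hat x = hat y"
  shows "x = y"
proof -
  consider "hat x = -\<infinity>" | "hat x = \<infinity>" | "\<not> u \<preceq> \<tau> x" "\<not> u \<preceq> \<tau> y"
    using xy by (auto simp: hat_def split: if_splits)
  then show ?thesis
  proof cases
    case 1
    then show ?thesis using xy hat_MInf[of x] hat_MInf[of y] by metis
  next
    case 2
    then have "u \<cdot> x = x" "u \<cdot> y = y" using xy upper[of x] upper[of y] by (auto simp: hat_def split: if_splits)
    moreover have "u \<cdot> x = u \<cdot> y" by (rule unit_d_inj[OF unit_of_hat unit_of_hat]) (use 2 xy in auto)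
    ultimately show ?thesis by metis
  next
    case 3
    then have "x \<preceq> y" "y \<preceq> x"
      using partial_embedding.\<rho>_le[OF low_embedding, of x y] partial_embedding.\<rho>_le[OF low_embedding, of y x] xy
      by (simp_all add: hat_def)
    then show ?thesis using antisym xy by simp
  qed
qed

lemma hat_le:
  assumes xy: "x \<in> E" "y \<in> E" "d \<cdot> x = d \<cdot> y"
  shows "x \<preceq> y \<longleftrightarrow> hat x \<le> hat y"
  using hat_less[OF xy] hat_less[OF xy(2,1) xy(3)[symmetric]] hat_eq[OF xy] antisym[of x y] xy
  by (cases "hat x" "hat y" rule: linorder_cases) auto

text \<open>Within a fibre of \<open>x \<mapsto> v \<cdot> x\<close> also \<open>d \<cdot> x\<close>
  is constant, since \<open>d \<cdot> u = d\<close>, so \<open>hat\<close> decides; between fibres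
  \<open>w\<close> decides, because multiplication by \<open>v\<close> is monotone.\<close>

lemma lex_le_hat:
  fixes w :: "'a \<Rightarrow> 'r :: linorder"
  assumes v: "v = u \<or> v = d"
    and less: "\<forall>x\<in>(\<cdot>) v ` E. \<forall>y\<in>(\<cdot>) v ` E. \<not> x \<preceq> y \<longrightarrow> w y < w x"
    and xy: "x \<in> E" "y \<in> E"
  shows "x \<preceq> y \<longleftrightarrow> lex_le (w (v \<cdot> x), hat x) (w (v \<cdot> y), hat y)"
proof (cases "v \<cdot> x = v \<cdot> y")
  case True
  have "d \<cdot> x = d \<cdot> y"
    using v
  proof
    assume "v = u"
    then have "d \<cdot> (u \<cdot> x) = d \<cdot> (u \<cdot> y)" using True by simp
    then show ?thesis using xy by (simp only: du'(1) E_closed)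
  qed (use True in simp)
  then show ?thesis using hat_le[of x y] xy True by (simp add: lex_le_def)
next
  case False
  have c: "v \<in> C" "x \<in> C" "y \<in> C" using v xy by auto
  have *: "w (v \<cdot> x) < w (v \<cdot> y)" if "x \<preceq> y" "v \<cdot> x \<noteq> v \<cdot> y" "x \<in> E" "y \<in> E" for x y
  proof -
    have "v \<cdot> x \<preceq> v \<cdot> y" using that c(1) by (intro mul_mono) auto
    then have "\<not> v \<cdot> y \<preceq> v \<cdot> x" using antisym[of "v \<cdot> x" "v \<cdot> y"] that c(1) by auto
    then show ?thesis using less that by blast
  qed
  have "x \<preceq> y \<longleftrightarrow> w (v \<cdot> x) < w (v \<cdot> y)" "w (v \<cdot> x) \<noteq> w (v \<cdot> y)"
    using *[of x y] *[of y x] False xy total[of x y] c by force+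
  then show ?thesis by (simp add: lex_le_def)
qed

end

context embedding_step
begin

text \<open>Every \<open>d \<cdot> x\<close> with \<open>x \<in> E\<close> has the inverse
  \<open>d \<cdot> n x\<close> in the monoid of elements fixed by \<open>d\<close>: on the upper
  layer because \<open>x \<cdot> n x = d\<close>, below it because
  \<open>u \<cdot> (x \<cdot> n x) = u\<close>.\<close>

lemma embedding_idem:
  assumes dd: "d \<cdot> d = d"
  shows "\<exists>m e'' n'' \<rho>'. partial_embedding C mul e n le E (UNIV :: real set) m e'' n'' (\<le>) \<rho>'"
proof -
  let ?G = "local_group d" and ?E = "(\<cdot>) d ` E"
  have dd' [simp]: "d \<cdot> (d \<cdot> x) = d \<cdot> x" if "x \<in> C" for x
    using that dd by (simp flip: assoc)
  have dmul: "d \<cdot> (x \<cdot> y) = (d \<cdot> x) \<cdot> (d \<cdot> y)" if "x \<in> C" "y \<in> C" for x y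
  proof -
    have "(d \<cdot> x) \<cdot> (d \<cdot> y) = d \<cdot> (d \<cdot> (x \<cdot> y))" using that by (simp add: ac del: dd')
    then show ?thesis using that by simp
  qed
  have dinv: "(d \<cdot> x) \<cdot> (d \<cdot> n x) = d" if "x \<in> E" for x
  proof (cases "u \<preceq> \<tau> x")
    case True
    then show ?thesis using dmul[of x "n x"] upper[OF that] that dd by simp
  next
    case False
    have "d \<cdot> (u \<cdot> (x \<cdot> n x)) = d" using low_inverse[OF _ False] that by simp
    then show ?thesis using dmul[of x "n x"] that by simp
  qed
  have EG: "?E \<subseteq> carrier ?G"
  proof
    fix y assume "y \<in> ?E"
    then obtain x where x: "x \<in> E" "y = d \<cdot> x" by auto
    then show "y \<in> carrier ?G"
      using dinv[of x] by (auto simp: mem_local_group intro!: bexI[of _ "d \<cdot> n x"])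
  qed
  have dE: "d \<in> ?E" using eE by force
  obtain K and w :: "'a \<Rightarrow> real" where K: "subgroup K ?G" "?E \<subseteq> K" "countable K" "inj_on w K"
    and add: "\<forall>x\<in>K. \<forall>y\<in>K. w (x \<cdot> y) = w x + w y"
    and less: "\<forall>x\<in>?E. \<forall>y\<in>?E. \<not> x \<preceq> y \<longrightarrow> w y < w x"
    using local_embedding_real[OF _ dd _ EG dE] finE by auto
  note sub = local_subgroup[OF _ dd K(1), simplified]
  have KC: "x \<in> C" if "x \<in> K" for x using sub(1) that by auto
  have wd: "w d = 0" using add[rule_format, of d d] sub(2) dd by simp
  \<comment> \<open>\<open>H\<close> marks the points \<open>d \<cdot> g\<close> whose fibre has a
    top \<open>g\<close>; over any other point the fibre is the bottom alone. Only over
    \<open>H\<close> is a copy of the lower chain inserted.\<close>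
  define H where "H = w ` {x\<in>K. \<exists>g. unit g \<and> x = d \<cdot> g}"
  have H0: "0 \<in> H"
    unfolding H_def using wd sub(2) unit_u by (intro image_eqI[of _ _ d]) auto
  have Hadd: "r + s \<in> H" if rs: "r \<in> H" "s \<in> H" for r s
  proof -
    obtain g g' where g: "unit g" "unit g'" "d \<cdot> g \<in> K" "d \<cdot> g' \<in> K" "r = w (d \<cdot> g)" "s = w (d \<cdot> g')"
      using rs unfolding H_def by auto
    have "(d \<cdot> g) \<cdot> (d \<cdot> g') = d \<cdot> (g \<cdot> g')" using dmul g unit_closed by simp
    then have "d \<cdot> (g \<cdot> g') \<in> K" "r + s = w (d \<cdot> (g \<cdot> g'))"
      using sub(5) add g by metis+
    then show ?thesis unfolding H_def using unit_mul[OF g(1,2)] by blast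
  qed
  have Huminus: "- r \<in> H" if r: "r \<in> H" for r
  proof -
    obtain g where g: "unit g" "d \<cdot> g \<in> K" "r = w (d \<cdot> g)" using r unfolding H_def by auto
    obtain h where h: "unit h" "g \<in> C" "h \<in> C" "g \<cdot> h = u" using g(1) by (rule unitE)
    obtain y where y: "y \<in> K" "(d \<cdot> g) \<cdot> y = d" using sub(4) g(2) by blast
    have yC: "y \<in> C" and dy: "d \<cdot> y = y" using y KC sub(3) by auto
    have "d \<cdot> h = ((d \<cdot> g) \<cdot> y) \<cdot> h" using y by simp
    also have "\<dots> = (d \<cdot> y) \<cdot> (g \<cdot> h)" using yC h(2,3) by (simp add: ac)
    also have "\<dots> = u \<cdot> (d \<cdot> y)" using h yC by (simp add: comm)
    also have "\<dots> = y" using d_fixed_upper[OF yC dy] dy by simp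
    finally have "y = d \<cdot> h" ..
    moreover have "w y = - r" using add[rule_format, OF g(2) y(1)] y wd g(3) by simp
    ultimately show ?thesis unfolding H_def using y(1) h(1) by (metis (mono_tags, lifting) imageI mem_Collect_eq)
  qed
  have cH: "countable H"
    unfolding H_def by (intro countable_image) (rule countable_subset[OF _ K(3)], auto)
  let ?\<rho> = "\<lambda>x. (w (d \<cdot> x), hat x)"
  have dK: "d \<cdot> x \<in> K" if "x \<in> E" for x using K(2) that by auto
  have wH: "w (d \<cdot> x) \<in> H" if "x \<in> E" "hat x \<noteq> -\<infinity>" for x
  proof -
    have "unit (u \<cdot> x)" using that by (rule unit_of_hat)
    moreover have "d \<cdot> x = d \<cdot> (u \<cdot> x)" using that by simp
    ultimately show ?thesis unfolding H_def using dK[OF that(1)] by blast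
  qed
  have wn: "w (d \<cdot> n x) = - w (d \<cdot> x)" if "x \<in> E" "n x \<in> E" for x
    using add[rule_format, OF dK[OF that(1)] dK[OF that(2)]] dinv[OF that(1)] wd by simp
  have hat_n: "hat (n x) = (if w (d \<cdot> x) \<in> H then ext_neg n' (hat x) else -\<infinity>)" if x: "x \<in> E" "n x \<in> E" for x
  proof (cases "u \<preceq> \<tau> x")
    case False
    then have "w (d \<cdot> x) \<in> H" using wH x by (simp add: hat_def)
    then show ?thesis
      using False x partial_embedding.\<rho>_n[OF low_embedding, of x] by (simp add: hat_def)
  next
    case True
    note up = upper[OF x(1) True]
    have upn: "u \<cdot> n x = n x" using upper[OF x(2)] True x(1) by simp
    show ?thesis
    proof (cases "d \<cdot> x = x")
      case False
      then have ux: "unit x" using x up by (intro unit_fixed) auto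
      then obtain h where h: "unit h" "h \<in> C" "x \<cdot> h = u" by (rule unitE)
      then have "n x = d \<cdot> h" using n_unit[of x h] ux up x by simp
      then have "d \<cdot> n x = n x" using h by simp
      moreover have "w (d \<cdot> x) \<in> H" using wH False True x by (simp add: hat_def)
      ultimately show ?thesis using False True x by (simp add: hat_def)
    next
      case fx: True
      have hx: "hat x = -\<infinity>" using fx True by (simp add: hat_def)
      show ?thesis
      proof (cases "d \<cdot> n x = n x")
        case True
        \<comment> \<open>If \<open>x\<close> were the bottom below a unit \<open>g\<close>, its
          negation would be the inverse unit, which \<open>d\<close> does not fix. Injectivity of
          \<open>w\<close> on \<open>K\<close> is what recovers \<open>g\<close> from the real
          number \<open>w (d \<cdot> x)\<close>.\<close>
        have "w (d \<cdot> x) \<notin> H"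
        proof
          assume "w (d \<cdot> x) \<in> H"
          then obtain g where g: "unit g" "d \<cdot> g \<in> K" "w (d \<cdot> x) = w (d \<cdot> g)" unfolding H_def by auto
          have "d \<cdot> x = d \<cdot> g" using inj_onD[OF K(4) g(3) dK[OF x(1)] g(2)] .
          then have xg: "x = d \<cdot> g" using fx by metis
          obtain h where h: "unit h" "g \<cdot> h = u" using g(1) by (rule unitE)
          have "n x = h" unfolding xg using g(1) h by (rule n_d_mul_unit)
          then show False using unit_not_d_fixed[OF h(1)] True by simp
        qed
        then show ?thesis using True \<open>u \<preceq> \<tau> x\<close> x(1) by (simp add: hat_def)
      next
        case False
        then have hn: "hat (n x) = \<infinity>" using \<open>u \<preceq> \<tau> x\<close> x(1) by (simp add: hat_def)
        then have "w (d \<cdot> n x) \<in> H" using wH x by simp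
        then have "w (d \<cdot> x) \<in> H" using wn[OF x] Huminus[of "w (d \<cdot> n x)"] by simp
        then show ?thesis using hn hx by simp
      qed
    qed
  qed
  have "partial_embedding C mul e n le E (lex_carrier H) (lex_mul m') (0, ereal e') (lex_neg H n') lex_le ?\<rho>"
  proof (intro partial_embedding.intro partial_embedding_axioms.intro)
    show "odd_chain C mul e n le" by (rule odd_chain_axioms)
    show "odd_chain (lex_carrier H) (lex_mul m') (0, ereal e') (lex_neg H n') lex_le"
      using hat_target H0 Hadd Huminus by (rule odd_chain_lex)
    show "(w (d \<cdot> e), hat e) = (0, ereal e')" using hat_e wd by simp
    fix x y assume x: "x \<in> E"
    show "(w (d \<cdot> x), hat x) \<in> lex_carrier H" using wH x by (auto simp: mem_lex_carrier)
    show "n x \<in> E \<Longrightarrow> (w (d \<cdot> n x), hat (n x)) = lex_neg H n' (w (d \<cdot> x), hat x)"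
      using wn hat_n x by (simp add: lex_neg_def)
    assume y: "y \<in> E"
    show "x \<preceq> y \<longleftrightarrow> lex_le (w (d \<cdot> x), hat x) (w (d \<cdot> y), hat y)"
      using less x y by (intro lex_le_hat) auto
    show "x \<cdot> y \<in> E \<Longrightarrow> (w (d \<cdot> (x \<cdot> y)), hat (x \<cdot> y)) = lex_mul m' (w (d \<cdot> x), hat x) (w (d \<cdot> y), hat y)"
      using hat_mul[of x y] x y add dK dmul by (simp add: lex_mul_def)
  qed (use EC eE in auto)
  note emb = this
  obtain \<beta> :: "real \<times> ereal \<Rightarrow> real" where \<beta>: "bij_betw \<beta> (lex_carrier H) UNIV"
    "\<forall>p\<in>lex_carrier H. \<forall>q\<in>lex_carrier H. lex_le p q \<longleftrightarrow> \<beta> p \<le> \<beta> q"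
    using bij_betw_lex_carrier[OF cH] by blast
  from partial_embedding_transport[OF emb \<beta>(1), of "(\<le>)"] \<beta>(2) show ?thesis by blast
qed

text \<open>On the upper layer \<open>d \<cdot> x = x\<close> would give
  \<open>d \<cdot> d = d\<close> through \<open>x \<cdot> n x = d\<close>. So no element of
  \<open>E\<close> is a bottom, and the fibres of \<open>x \<mapsto> u \<cdot> x\<close> get a top
  only.\<close>

lemma embedding_nonidem:
  assumes dd: "d \<cdot> d \<noteq> d"
  shows "\<exists>m e'' n'' \<rho>'. partial_embedding C mul e n le E (UNIV :: real set) m e'' n'' (\<le>) \<rho>'"
proof -
  let ?G = "local_group u"
  have G: "g \<in> carrier ?G \<longleftrightarrow> unit g" for g by (simp add: mem_local_group unit_def)
  have umul: "u \<cdot> (x \<cdot> y) = (u \<cdot> x) \<cdot> (u \<cdot> y)" if "x \<in> C" "y \<in> C" for x y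
  proof -
    have "(u \<cdot> x) \<cdot> (u \<cdot> y) = u \<cdot> (u \<cdot> (x \<cdot> y))" using that by (simp add: ac del: uu')
    then show ?thesis using that by simp
  qed
  have d_not_fixed: "d \<cdot> x \<noteq> x" if "x \<in> E" "u \<preceq> \<tau> x" for x
  proof
    assume dx: "d \<cdot> x = x"
    have xn: "x \<cdot> n x = d" using upper[OF that] by simp
    have "d \<cdot> d = d \<cdot> (x \<cdot> n x)" using xn by simp
    also have "\<dots> = (d \<cdot> x) \<cdot> n x" using that by (simp add: assoc)
    finally show False using dx xn dd by simp
  qed
  have hat_fin: "hat x \<noteq> -\<infinity>" if "x \<in> E" for x
    using d_not_fixed that hat_MInf by blast
  have unit_E: "unit (u \<cdot> x)" if "x \<in> E" for x using unit_of_hat hat_fin that by blast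
  have "unit d" using dd by (intro unit_fixed) simp_all
  then obtain a where a: "unit a" "a \<in> C" "u \<cdot> a = a" "d \<cdot> a = u" by (rule unitE)
  have a_not_le: "\<not> a \<preceq> u"
  proof
    assume "a \<preceq> u"
    then have "d \<cdot> a \<preceq> d \<cdot> u" using a(2) by (intro mul_mono) auto
    then show False using a d_ne_u by simp
  qed
  \<comment> \<open>The inverse of a unit strictly above \<open>u\<close> is not above
    \<open>u\<close>, so it is at most \<open>d\<close>; multiplying by \<open>a \<cdot> y\<close>
    turns this into \<open>a \<preceq> y\<close>.\<close>
  have a_least: "a \<preceq> y" if y: "unit y" "\<not> y \<preceq> u" for y
  proof -
    obtain y' where y': "y \<in> C" "y' \<in> C" "u \<cdot> y = y" "u \<cdot> y' = y'" "y \<cdot> y' = u" using y(1) by (rule unitE)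
    have "\<not> u \<preceq> y'"
    proof
      assume "u \<preceq> y'"
      then have "y \<cdot> u \<preceq> y \<cdot> y'" using y'(1,2) by (intro mul_mono) auto
      then show False using y y' by (simp add: comm)
    qed
    then have "y' \<preceq> d" using y' by (intro below_u) auto
    then have "(a \<cdot> y) \<cdot> y' \<preceq> (a \<cdot> y) \<cdot> d" using y' a(2) by (intro mul_mono) auto
    moreover have "(a \<cdot> y) \<cdot> y' = u \<cdot> a" using y' a(2) by (simp add: assoc) (simp add: comm)
    moreover have "(a \<cdot> y) \<cdot> d = (d \<cdot> a) \<cdot> y" using y'(1) a(2) by (simp add: ac)
    ultimately show ?thesis using a y' by simp
  qed
  let ?E = "insert a ((\<cdot>) u ` E)"
  have EG: "?E \<subseteq> carrier ?G" using a(1) unit_E by (auto simp: G)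
  have uE: "u \<in> ?E" using eE by force
  obtain K and w :: "'a \<Rightarrow> int" where K: "subgroup K ?G" "?E \<subseteq> K" and wa: "w a = 1"
    and add: "\<forall>x\<in>K. \<forall>y\<in>K. w (x \<cdot> y) = w x + w y"
    and less: "\<forall>x\<in>?E. \<forall>y\<in>?E. \<not> x \<preceq> y \<longrightarrow> w y < w x"
    using local_embedding_int[OF u_closed uu _ EG uE, of a] a_not_le a_least finE unfolding G by auto
  note sub = local_subgroup[OF u_closed uu K(1)]
  have KC: "x \<in> C" if "x \<in> K" for x using sub(1) that by auto
  have wu: "w u = 0" using add[rule_format, of u u] sub(2) by simp
  have aK: "a \<in> K" using K(2) by auto
  have uK: "u \<cdot> x \<in> K" if "x \<in> E" for x using K(2) that by auto
  obtain a' where a': "a' \<in> K" "a \<cdot> a' = u" using sub(4) aK by blast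
  have "d = a'"
  proof -
    have "d \<cdot> (a \<cdot> a') = u \<cdot> a'" using a KC[OF a'(1)] by (simp flip: assoc)
    then show ?thesis using a' sub(3) by simp
  qed
  then have dK: "d \<in> K" using a' by simp
  have wd: "w d = - 1" using add[rule_format, OF dK aK] a wa wu by simp
  let ?\<rho> = "\<lambda>x. (w (u \<cdot> x), hat x)"
  have neg: "?\<rho> (n x) = shift_neg n' (?\<rho> x)" if x: "x \<in> E" "n x \<in> E" for x
  proof (cases "u \<preceq> \<tau> x")
    case False
    have "(u \<cdot> x) \<cdot> (u \<cdot> n x) = u" using umul[of x "n x"] low_inverse[OF _ False] x by simp
    then have "w (u \<cdot> n x) = - w (u \<cdot> x)" using add[rule_format, OF uK[OF x(1)] uK[OF x(2)]] wu by simp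
    then show ?thesis using False x partial_embedding.\<rho>_n[OF low_embedding, of x]
      by (simp add: hat_def shift_neg_def)
  next
    case True
    have "(u \<cdot> x) \<cdot> (u \<cdot> n x) = d" using umul[of x "n x"] upper[OF x(1) True] x by simp
    \<comment> \<open>On the upper layer \<open>x \<cdot> n x\<close> is \<open>d\<close> instead of
      \<open>u\<close>, and \<open>w d = - 1\<close>: this is the shift in
      \<open>shift_neg\<close>.\<close>
    then have "w (u \<cdot> n x) = - w (u \<cdot> x) - 1" using add[rule_format, OF uK[OF x(1)] uK[OF x(2)]] wd by simp
    moreover have "hat x = \<infinity>" "hat (n x) = \<infinity>"
      using True x d_not_fixed[of x] d_not_fixed[of "n x"] by (simp_all add: hat_def)
    ultimately show ?thesis by (simp add: shift_neg_def)
  qed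
  have "partial_embedding C mul e n le E shift_carrier (lex_mul m') (0, ereal e') (shift_neg n') lex_le ?\<rho>"
  proof (intro partial_embedding.intro partial_embedding_axioms.intro)
    show "odd_chain C mul e n le" by (rule odd_chain_axioms)
    show "odd_chain shift_carrier (lex_mul m') (0 :: int, ereal e') (shift_neg n') lex_le"
      using hat_target by (rule odd_chain_shift)
    show "(w (u \<cdot> e), hat e) = (0, ereal e')" using hat_e wu by simp
    fix x y assume x: "x \<in> E"
    show "(w (u \<cdot> x), hat x) \<in> shift_carrier" using hat_fin x by (simp add: shift_carrier_def)
    show "n x \<in> E \<Longrightarrow> ?\<rho> (n x) = shift_neg n' (?\<rho> x)" using neg x by blast
    assume y: "y \<in> E"
    show "x \<preceq> y \<longleftrightarrow> lex_le (w (u \<cdot> x), hat x) (w (u \<cdot> y), hat y)"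
      using less x y by (intro lex_le_hat) auto
    show "x \<cdot> y \<in> E \<Longrightarrow> (w (u \<cdot> (x \<cdot> y)), hat (x \<cdot> y)) = lex_mul m' (w (u \<cdot> x), hat x) (w (u \<cdot> y), hat y)"
      using hat_mul[of x y] x y add uK umul by (simp add: lex_mul_def)
  qed (use EC eE in auto)
  note emb = this
  obtain \<beta> :: "int \<times> ereal \<Rightarrow> real" where \<beta>: "bij_betw \<beta> shift_carrier UNIV"
    "\<forall>p\<in>shift_carrier. \<forall>q\<in>shift_carrier. lex_le p q \<longleftrightarrow> \<beta> p \<le> \<beta> q"
    using bij_betw_shift_carrier by blast
  from partial_embedding_transport[OF emb \<beta>(1), of "(\<le>)"] \<beta>(2) show ?thesis by blast
qed

end

section \<open>Induction on the layers, and the bounded case\<close>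

context odd_chain
begin

lemma finite_ex_greatest:
  assumes "finite T" "T \<noteq> {}" "T \<subseteq> C"
  shows "\<exists>u\<in>T. \<forall>x\<in>T. x \<preceq> u"
  using assms
proof (induction T rule: finite_ne_induct)
  case (insert a T)
  then obtain u where u: "u \<in> T" "\<forall>x\<in>T. x \<preceq> u" by auto
  show ?case
  proof (cases "a \<preceq> u")
    case False
    then have "u \<preceq> a" using total[of a u] u insert.prems by auto
    then have "\<forall>x\<in>T. x \<preceq> a" using u insert.prems by (metis insert_subset subsetD trans)
    then show ?thesis using insert.prems by auto
  qed (use u in auto)
qed auto

theorem real_embedding:
  assumes "finite E" "E \<subseteq> C" "e \<in> E"
  shows "\<exists>m' e' n' \<rho>. partial_embedding C mul e n le E (UNIV :: real set) m' e' n' (\<le>) \<rho>"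
  using assms
proof (induction "card (\<tau> ` E)" arbitrary: E rule: less_induct)
  case less
  have "\<tau> ` E \<noteq> {}" "\<tau> ` E \<subseteq> C" using less.prems by auto
  then obtain u where umax: "u \<in> \<tau> ` E" "\<And>x. x \<in> E \<Longrightarrow> \<tau> x \<preceq> u"
    using finite_ex_greatest[of "\<tau> ` E"] less.prems(1) by blast
  have pu: "pos_idem u" using umax(1) less.prems pos_idem_\<tau> by auto
  show ?case
  proof (cases "u = e")
    case True
    then have "\<tau> x = e" if "x \<in> E" for x
      using umax(2)[OF that] e_le_\<tau>[of x] antisym[of "\<tau> x" e] that less.prems by auto
    then show ?thesis using embedding_group[of E] less.prems by blast
  next
    case False
    then have "\<not> u \<preceq> e" using pu antisym[of u e] by (auto simp: pos_idem_def)
    then interpret odd_chain_pos C mul e n le u using pu by unfold_locales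
    let ?L = "{x\<in>E. \<not> u \<preceq> \<tau> x}"
    have "u \<preceq> u" by simp
    then have "u \<notin> \<tau> ` ?L" by blast
    then have "\<tau> ` ?L \<subset> \<tau> ` E" using umax(1) by auto
    then have "card (\<tau> ` ?L) < card (\<tau> ` E)" using less.prems by (intro psubset_card_mono) auto
    moreover have "e \<in> ?L" "finite ?L" "?L \<subseteq> C" using less.prems u_not_le_e by auto
    ultimately obtain m' e' n' \<rho> where
      "partial_embedding C mul e n le ?L (UNIV :: real set) m' e' n' (\<le>) \<rho>"
      using less.hyps[of ?L] by blast
    with odd_chain_pos_axioms less.prems umax(2) interpret embedding_step C mul e n le u E m' e' n' \<rho>
      by (intro embedding_step.intro embedding_step_axioms.intro)
    show ?thesis using embedding_idem embedding_nonidem by blast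
  qed
qed

text \<open>A top \<open>u\<close> of the whole chain is a positive idempotent, and \<open>d\<close>
  is then an absorbing bottom. So \<open>x \<mapsto> d \<cdot> x\<close> has a single fibre, the
  layer of \<open>u\<close> consists of \<open>u\<close> and \<open>d\<close>, and
  \<open>hat\<close> alone embeds \<open>E\<close> into the extended reals, an interval with both
  ends. \<open>u \<noteq> e\<close> rules out the one-element chain.\<close>

theorem unit_interval_embedding:
  assumes E: "finite E" "E \<subseteq> C" "e \<in> E"
    and top: "u \<in> C" "\<And>x. x \<in> C \<Longrightarrow> x \<preceq> u" "u \<noteq> e"
  shows "\<exists>m' e' n' \<rho>. partial_embedding C mul e n le E {0..1 :: real} m' e' n' (\<le>) \<rho> \<and> \<rho> u = 1 \<and> \<rho> (n u) = 0"
proof -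
  have "\<not> u \<preceq> e" using top antisym[of e u] by auto
  moreover have "pos_idem u"
    using top mul_mono(1)[of e u u] antisym[of u "u \<cdot> u"] by (simp add: pos_idem_def)
  ultimately interpret odd_chain_pos C mul e n le u by unfold_locales
  let ?L = "{x\<in>E. \<not> u \<preceq> \<tau> x}"
  have "e \<in> ?L" using E u_not_le_e by simp
  moreover have "finite ?L" "?L \<subseteq> C" using E by auto
  ultimately obtain m' e' n' \<rho> where
    "partial_embedding C mul e n le ?L (UNIV :: real set) m' e' n' (\<le>) \<rho>"
    using real_embedding[of ?L] E by blast
  moreover have "\<tau> x \<preceq> u" if "x \<in> E" for x using top(2) E(2) that by auto
  moreover note odd_chain_pos_axioms E
  ultimately interpret embedding_step C mul e n le u E m' e' n' \<rho>
    by (intro embedding_step.intro embedding_step_axioms.intro)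
  have d_le: "d \<preceq> x" if "x \<in> C" for x
    using n_le_iff[of "n x" u] top(2)[of "n x"] that by simp
  have d_mul: "d \<cdot> x = d" if "x \<in> C" for x
    using mul_le_iff[of d x d] top(2)[OF that] d_le[of "d \<cdot> x"] antisym[of "d \<cdot> x" d] that by simp
  have dnu: "d \<noteq> u" using d_ne_u by auto
  have "partial_embedding C mul e n le E (UNIV :: ereal set) (ext_mul m') (ereal e') (ext_neg n') (\<le>) hat"
  proof (intro partial_embedding.intro partial_embedding_axioms.intro)
    show "odd_chain C mul e n le" by (rule odd_chain_axioms)
    show "odd_chain UNIV (ext_mul m') (ereal e') (ext_neg n') (\<le>)" using hat_target by (rule odd_chain_ext)
    show "hat e = ereal e'" by (rule hat_e)
    fix x y assume x: "x \<in> E"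
    show "hat (n x) = ext_neg n' (hat x)" if nx: "n x \<in> E"
    proof (cases "u \<preceq> \<tau> x")
      case False
      then show ?thesis using x nx partial_embedding.\<rho>_n[OF low_embedding, of x] by (simp add: hat_def)
    next
      case True
      have "x = u \<or> x = d"
        using below_u[of x] upper[OF x True] d_le[of x] antisym[of x d] antisym[of x u] top(2)[of x] x by auto
      then show ?thesis
        using d_mul dnu True x by (auto simp: hat_def)
    qed
    assume y: "y \<in> E"
    show "x \<preceq> y \<longleftrightarrow> hat x \<le> hat y" using hat_le x y d_mul by simp
    show "x \<cdot> y \<in> E \<Longrightarrow> hat (x \<cdot> y) = ext_mul m' (hat x) (hat y)" using hat_mul x y by blast
  qed (use E in auto)
  from partial_embedding_transport[OF this bij_betw_squash, of "(\<le>)"]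
  obtain m'' e'' n'' where "partial_embedding C mul e n le E {0..1} m'' e'' n'' (\<le>) (squash \<circ> hat)"
    by auto
  \<comment> \<open>\<open>hat\<close> is defined outside \<open>E\<close> too, so this holds even
    if \<open>u\<close> and \<open>d\<close> do not occur in \<open>E\<close>.\<close>
  moreover have "hat u = \<infinity>" "hat d = -\<infinity>"
    using d_mul[of u] d_mul[of d] dnu \<tau>_pos_idem[OF u] by (simp_all add: hat_def)
  ultimately show ?thesis by (intro exI[of _ m''] exI[of _ e''] exI[of _ n''] exI[of _ "squash \<circ> hat"]) simp
qed

end

section \<open>The logic\<close>

context FLe_algebra
begin

abbreviation fle (infix "\<preceq>" 50) where "x \<preceq> y \<equiv> fle_le A x y"

lemma meet_idem: "x \<in> carrier A \<Longrightarrow> meet A x x = x"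
  using meet_absorb[of x "meet A x x"] join_absorb[of x x] meet_closed by simp

lemma fle_refl: "x \<in> carrier A \<Longrightarrow> x \<preceq> x"
  by (simp add: fle_le_def meet_idem)

lemma fle_trans:
  "\<lbrakk>x \<preceq> y; y \<preceq> z; x \<in> carrier A; y \<in> carrier A; z \<in> carrier A\<rbrakk> \<Longrightarrow> x \<preceq> z"
  unfolding fle_le_def by (metis meet_assoc)

lemma meet_le:
  assumes "x \<in> carrier A" "y \<in> carrier A"
  shows "meet A x y \<preceq> x" "meet A x y \<preceq> y"
  using assms unfolding fle_le_def by (metis meet_assoc meet_closed meet_commute meet_idem)+

lemma le_meet:
  "\<lbrakk>z \<preceq> x; z \<preceq> y; x \<in> carrier A; y \<in> carrier A; z \<in> carrier A\<rbrakk> \<Longrightarrow> z \<preceq> meet A x y"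
  unfolding fle_le_def by (metis meet_assoc)

lemma le_join:
  assumes "x \<in> carrier A" "y \<in> carrier A"
  shows "x \<preceq> join A x y" "y \<preceq> join A x y"
  using assms unfolding fle_le_def by (metis meet_absorb join_commute)+

lemma join_le:
  assumes "x \<preceq> z" "y \<preceq> z" "x \<in> carrier A" "y \<in> carrier A" "z \<in> carrier A"
  shows "join A x y \<preceq> z"
proof -
  have "join A x z = z" "join A y z = z"
    using assms join_absorb[of z x] join_absorb[of z y]
    by (simp_all add: fle_le_def meet_commute[of z] join_commute[of z])
  then have "join A (join A x y) z = z" using assms by (simp add: join_assoc)
  then show ?thesis
    using meet_absorb[of "join A x y" z] assms join_closed by (simp add: fle_le_def)
qed

lemma one_le_res: "\<lbrakk>x \<in> carrier A; y \<in> carrier A\<rbrakk> \<Longrightarrow> \<one> \<preceq> res A x y \<longleftrightarrow> x \<preceq> y"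
  using residuation[of x \<one> y] by simp

lemma mult_res: "\<lbrakk>x \<in> carrier A; y \<in> carrier A\<rbrakk> \<Longrightarrow> x \<otimes> res A x y \<preceq> y"
  by (simp add: residuation res_closed fle_refl)

lemma mult_mono:
  assumes "x \<preceq> y" "x \<in> carrier A" "y \<in> carrier A" "z \<in> carrier A"
  shows "z \<otimes> x \<preceq> z \<otimes> y"
proof -
  have "y \<preceq> res A z (z \<otimes> y)" using residuation[of z y "z \<otimes> y"] assms fle_refl by simp
  then have "x \<preceq> res A z (z \<otimes> y)" using assms res_closed fle_trans[of x y "res A z (z \<otimes> y)"] by simp
  then show ?thesis using residuation[of z x "z \<otimes> y"] assms by simp
qed

end

text \<open>Soundness is proved for chains, which covers the standard algebras; linearity enters in
  the prelinearity axiom.\<close>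

locale bounded_odd_FLe_chain = bounded_odd_FLe_algebra +
  assumes linear: "\<lbrakk>x \<in> carrier A; y \<in> carrier A\<rbrakk> \<Longrightarrow> fle_le A x y \<or> fle_le A y x"
begin

lemma eval_closed: "(\<forall>n. e n \<in> carrier A) \<Longrightarrow> eval_fm A e \<alpha> \<in> carrier A"
  by (induction \<alpha>)
    (simp_all add: meet_closed join_closed res_closed falsum_closed top_closed bot_closed)

lemma axiom_sound:
  assumes e: "\<forall>n. e n \<in> carrier A" and "\<alpha> \<in> IULfp_axioms"
  shows "\<one> \<preceq> eval_fm A e \<alpha>"
proof -
  note [simp] = eval_closed[OF e] meet_closed join_closed res_closed falsum_closed top_closed bot_closed
    one_le_res fle_refl
  have iff: "\<one> \<preceq> eval_fm A e (\<alpha> \<sqdot>\<leftrightarrow> \<beta>)" if "eval_fm A e \<alpha> = eval_fm A e \<beta>" for \<alpha> \<beta>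
    using that by (simp add: Iff_def le_meet)
  from assms(2) show ?thesis
  proof cases
    case (L1 \<alpha>)
    then show ?thesis by simp
  next
    case (L2 \<alpha> \<beta> \<gamma>)
    let ?a = "eval_fm A e \<alpha>" and ?b = "eval_fm A e \<beta>" and ?c = "eval_fm A e \<gamma>"
    have "res A ?b ?c \<otimes> (?a \<otimes> res A ?a ?b) \<preceq> res A ?b ?c \<otimes> ?b"
      by (intro mult_mono mult_res) simp_all
    from fle_trans[OF this, of ?c] have "res A ?b ?c \<otimes> (?a \<otimes> res A ?a ?b) \<preceq> ?c"
      using mult_res[of ?b ?c] by (simp add: m_comm)
    then show ?thesis
      using L2 by (simp flip: residuation) (simp add: m_lcomm)
  next
    case (L3 \<alpha> \<beta> \<gamma>)
    let ?a = "eval_fm A e \<alpha>" and ?b = "eval_fm A e \<beta>" and ?c = "eval_fm A e \<gamma>"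
    have "?b \<otimes> (?a \<otimes> res A ?a (res A ?b ?c)) \<preceq> ?b \<otimes> res A ?b ?c"
      by (intro mult_mono mult_res) simp_all
    from fle_trans[OF this, of ?c] have "?b \<otimes> (?a \<otimes> res A ?a (res A ?b ?c)) \<preceq> ?c"
      using mult_res[of ?b ?c] by simp
    then show ?thesis
      using L3 by (simp flip: residuation) (simp add: m_lcomm)
  next
    case (L4 \<alpha> \<beta> \<gamma>)
    let ?a = "eval_fm A e \<alpha>" and ?b = "eval_fm A e \<beta>" and ?c = "eval_fm A e \<gamma>"
    have eq: "x \<preceq> res A (?a \<otimes> ?b) ?c \<longleftrightarrow> x \<preceq> res A ?a (res A ?b ?c)" if "x \<in> carrier A" for x
      using that by (simp flip: residuation) (simp add: m_ac)
    have "res A (?a \<otimes> ?b) ?c \<preceq> res A ?a (res A ?b ?c)" "res A ?a (res A ?b ?c) \<preceq> res A (?a \<otimes> ?b) ?c"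
      using eq[of "res A (?a \<otimes> ?b) ?c"] eq[of "res A ?a (res A ?b ?c)"] by simp_all
    then show ?thesis using L4 by (simp add: Iff_def le_meet)
  next
    case (L5 \<alpha> \<beta>)
    then show ?thesis by (simp add: meet_le)
  next
    case (L6 \<alpha> \<beta>)
    then show ?thesis by (simp add: meet_le)
  next
    case (L7 \<alpha> \<beta> \<gamma>)
    let ?a = "eval_fm A e \<alpha>" and ?b = "eval_fm A e \<beta>" and ?c = "eval_fm A e \<gamma>"
    let ?m = "meet A (res A ?a ?b) (res A ?a ?c)"
    have "?a \<otimes> ?m \<preceq> ?b" "?a \<otimes> ?m \<preceq> ?c"
      by (simp_all add: residuation meet_le)
    then show ?thesis using L7 by (simp flip: residuation) (simp add: le_meet)
  next
    case (L8 \<alpha> \<beta>)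
    then show ?thesis by (simp add: le_join)
  next
    case (L9 \<beta> \<alpha>)
    then show ?thesis by (simp add: le_join)
  next
    case (L10 \<alpha> \<gamma> \<beta>)
    let ?a = "eval_fm A e \<alpha>" and ?b = "eval_fm A e \<beta>" and ?c = "eval_fm A e \<gamma>"
    let ?m = "meet A (res A ?a ?c) (res A ?b ?c)"
    have "?a \<otimes> ?m \<preceq> ?c" "?b \<otimes> ?m \<preceq> ?c"
      by (simp_all add: residuation meet_le)
    then have "?a \<preceq> res A ?m ?c" "?b \<preceq> res A ?m ?c"
      by (simp_all add: m_comm[of _ ?m] flip: residuation)
    then have "join A ?a ?b \<preceq> res A ?m ?c" by (simp add: join_le)
    then have "?m \<otimes> join A ?a ?b \<preceq> ?c" by (simp add: residuation)
    then show ?thesis using L10 by (simp add: m_comm[of ?m] flip: residuation)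
  next
    case (L11 \<alpha>)
    let ?a = "eval_fm A e \<alpha>"
    have "?a \<preceq> res A \<one> ?a" "res A \<one> ?a \<preceq> ?a"
      using residuation[of \<one> ?a ?a] mult_res[of \<one> ?a] by simp_all
    then show ?thesis using L11 by (simp add: Iff_def le_meet)
  next
    case (L12 \<alpha>)
    then show ?thesis by (simp add: bot_least)
  next
    case (L13 \<alpha>)
    then show ?thesis by (simp add: top_greatest)
  next
    case (PRL \<alpha> \<beta>)
    let ?a = "eval_fm A e \<alpha>" and ?b = "eval_fm A e \<beta>"
    let ?x = "meet A (res A ?a ?b) \<one>" and ?y = "meet A (res A ?b ?a) \<one>"
    have "\<one> \<preceq> ?x \<or> \<one> \<preceq> ?y" using linear[of ?a ?b] by (auto intro!: le_meet)
    moreover have "\<one> \<preceq> join A ?x ?y" if "\<one> \<preceq> ?x"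
      using that le_join(1)[of ?x ?y] fle_trans[of \<one> ?x "join A ?x ?y"] by simp
    moreover have "\<one> \<preceq> join A ?x ?y" if "\<one> \<preceq> ?y"
      using that le_join(2)[of ?x ?y] fle_trans[of \<one> ?y "join A ?x ?y"] by simp
    ultimately show ?thesis using PRL by auto
  next
    case (INV \<alpha>)
    then show ?thesis using involutive[of "eval_fm A e \<alpha>"] by (simp add: Neg_def fle_neg_def)
  next
    case FP
    then show ?thesis using iff odd by simp
  qed
qed

lemma consequence_sound:
  assumes "T \<Turnstile>\<^sub>I\<^sub>U\<^sub>L\<^sub>f\<^sub>p \<phi>" and "is_model A e T"
  shows "\<one> \<preceq> eval_fm A e \<phi>"
proof -
  have e: "\<forall>n. e n \<in> carrier A" using assms(2) by (simp add: is_model_def)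
  note [simp] = eval_closed[OF e]
  from assms(1) show ?thesis
  proof induction
    case (Hyp \<alpha>)
    then show ?case using assms(2) by (simp add: is_model_def)
  next
    case (Ax \<alpha>)
    then show ?case using axiom_sound e by blast
  next
    case (MP \<alpha> \<beta>)
    then show ?case using fle_trans[of \<one> "eval_fm A e \<alpha>" "eval_fm A e \<beta>"] by (simp add: one_le_res)
  next
    case (Adj \<alpha> \<beta>)
    then show ?case by (simp add: le_meet)
  qed
qed

end

section \<open>Derivability, proof by cases and linear theories\<close>

abbreviation provable (infix "\<turnstile>" 50) where "T \<turnstile> \<phi> \<equiv> T \<Turnstile>\<^sub>I\<^sub>U\<^sub>L\<^sub>f\<^sub>p \<phi>"

lemma prov_mono: "T \<turnstile> \<phi> \<Longrightarrow> T \<subseteq> T' \<Longrightarrow> T' \<turnstile> \<phi>"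
  by (induction rule: IULfp_consequence.induct) (auto intro: IULfp_consequence.intros)

lemmas prov_mp = IULfp_consequence.MP
lemmas prov_ax = IULfp_consequence.Ax

lemma imp_refl: "T \<turnstile> a \<sqdot>\<rightarrow> a"
  by (rule prov_ax, rule L1)

lemma imp_trans: "T \<turnstile> a \<sqdot>\<rightarrow> b \<Longrightarrow> T \<turnstile> b \<sqdot>\<rightarrow> c \<Longrightarrow> T \<turnstile> a \<sqdot>\<rightarrow> c"
  using prov_mp[OF _ prov_mp[OF _ prov_ax[OF L2]]] by blast

lemma imp_exchange: "T \<turnstile> a \<sqdot>\<rightarrow> (b \<sqdot>\<rightarrow> c) \<Longrightarrow> T \<turnstile> b \<sqdot>\<rightarrow> (a \<sqdot>\<rightarrow> c)"
  using prov_mp[OF _ prov_ax[OF L3]] by blast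

lemma and_imp: "T \<turnstile> (a \<sqdot>\<and> b) \<sqdot>\<rightarrow> a" "T \<turnstile> (a \<sqdot>\<and> b) \<sqdot>\<rightarrow> b"
  by (rule prov_ax, rule L5) (rule prov_ax, rule L6)

lemma iffD: "T \<turnstile> a \<sqdot>\<leftrightarrow> b \<Longrightarrow> T \<turnstile> a \<sqdot>\<rightarrow> b" "T \<turnstile> a \<sqdot>\<leftrightarrow> b \<Longrightarrow> T \<turnstile> b \<sqdot>\<rightarrow> a"
  unfolding Iff_def using and_imp prov_mp by blast+

lemma fuse_imp_iff: "T \<turnstile> (a \<sqdot>& b) \<sqdot>\<rightarrow> c \<longleftrightarrow> T \<turnstile> a \<sqdot>\<rightarrow> (b \<sqdot>\<rightarrow> c)"
  using iffD[OF prov_ax[OF L4]] prov_mp by blast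

lemma imp_and: "T \<turnstile> c \<sqdot>\<rightarrow> a \<Longrightarrow> T \<turnstile> c \<sqdot>\<rightarrow> b \<Longrightarrow> T \<turnstile> c \<sqdot>\<rightarrow> (a \<sqdot>\<and> b)"
  using prov_mp[OF IULfp_consequence.Adj prov_ax[OF L7]] by blast

lemma imp_or: "T \<turnstile> a \<sqdot>\<rightarrow> (a \<sqdot>\<or> b)" "T \<turnstile> b \<sqdot>\<rightarrow> (a \<sqdot>\<or> b)"
  by (rule prov_ax, rule L8) (rule prov_ax, rule L9)

lemma or_imp: "T \<turnstile> a \<sqdot>\<rightarrow> c \<Longrightarrow> T \<turnstile> b \<sqdot>\<rightarrow> c \<Longrightarrow> T \<turnstile> (a \<sqdot>\<or> b) \<sqdot>\<rightarrow> c"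
  using prov_mp[OF IULfp_consequence.Adj prov_ax[OF L10]] by blast

lemma truth: "T \<turnstile> \<^bold>t"
  using iffD(2)[OF prov_ax[OF L11]] prov_mp imp_refl by blast

lemma truth_imp_iff: "T \<turnstile> \<^bold>t \<sqdot>\<rightarrow> a \<longleftrightarrow> T \<turnstile> a"
  using iffD[OF prov_ax[OF L11]] prov_mp by blast

lemma pair_imp: "T \<turnstile> a \<sqdot>\<rightarrow> (b \<sqdot>\<rightarrow> (a \<sqdot>& b))"
  using fuse_imp_iff imp_refl by blast

lemma fuse_comm: "T \<turnstile> (a \<sqdot>& b) \<sqdot>\<rightarrow> (b \<sqdot>& a)"
  unfolding fuse_imp_iff using pair_imp by (rule imp_exchange)

lemma fuse_mono1: "T \<turnstile> a \<sqdot>\<rightarrow> a' \<Longrightarrow> T \<turnstile> (a \<sqdot>& b) \<sqdot>\<rightarrow> (a' \<sqdot>& b)"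
  unfolding fuse_imp_iff using imp_trans[OF _ pair_imp] .

lemma fuse_mono: "T \<turnstile> a \<sqdot>\<rightarrow> a' \<Longrightarrow> T \<turnstile> b \<sqdot>\<rightarrow> b' \<Longrightarrow> T \<turnstile> (a \<sqdot>& b) \<sqdot>\<rightarrow> (a' \<sqdot>& b')"
  using fuse_mono1 fuse_comm imp_trans by meson

lemma fuse_assoc1: "T \<turnstile> ((a \<sqdot>& b) \<sqdot>& c) \<sqdot>\<rightarrow> (a \<sqdot>& (b \<sqdot>& c))"
  unfolding fuse_imp_iff by (rule imp_trans[OF pair_imp iffD(1)[OF prov_ax[OF L4]]])

lemma fuse_assoc2: "T \<turnstile> (a \<sqdot>& (b \<sqdot>& c)) \<sqdot>\<rightarrow> ((a \<sqdot>& b) \<sqdot>& c)"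
proof -
  have "T \<turnstile> (a \<sqdot>& (b \<sqdot>& c)) \<sqdot>\<rightarrow> ((c \<sqdot>& b) \<sqdot>& a)"
    by (rule imp_trans[OF fuse_comm fuse_mono1[OF fuse_comm]])
  moreover have "T \<turnstile> (c \<sqdot>& (b \<sqdot>& a)) \<sqdot>\<rightarrow> ((a \<sqdot>& b) \<sqdot>& c)"
    by (rule imp_trans[OF fuse_comm fuse_mono1[OF fuse_comm]])
  ultimately show ?thesis using fuse_assoc1 imp_trans by blast
qed

lemma truth_fuse: "T \<turnstile> (\<^bold>t \<sqdot>& a) \<sqdot>\<rightarrow> a" "T \<turnstile> a \<sqdot>\<rightarrow> (\<^bold>t \<sqdot>& a)"
  using fuse_imp_iff truth_imp_iff imp_refl prov_mp[OF truth pair_imp] by blast+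

lemma truth_falsity: "T \<turnstile> \<^bold>t \<sqdot>\<rightarrow> \<^bold>f" "T \<turnstile> \<^bold>f \<sqdot>\<rightarrow> \<^bold>t"
  using iffD[OF prov_ax[OF FP]] by blast+

text \<open>The two constants imply each other, so the adjunction can be stated at the unit of the
  product; this is the form of \<open>mul_le_e\<close> for the chain of formulas.\<close>

lemma imp_Neg_iff: "T \<turnstile> (a \<sqdot>& b) \<sqdot>\<rightarrow> \<^bold>t \<longleftrightarrow> T \<turnstile> b \<sqdot>\<rightarrow> Neg a"
proof -
  have "T \<turnstile> (a \<sqdot>& b) \<sqdot>\<rightarrow> \<^bold>t \<longleftrightarrow> T \<turnstile> (a \<sqdot>& b) \<sqdot>\<rightarrow> \<^bold>f"
    using truth_falsity imp_trans by blast
  then show ?thesis unfolding fuse_imp_iff Neg_def using imp_exchange by blast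
qed

lemma Neg_Neg: "T \<turnstile> Neg (Neg a) \<sqdot>\<rightarrow> a" "T \<turnstile> a \<sqdot>\<rightarrow> Neg (Neg a)"
  using prov_ax[OF INV] imp_exchange imp_refl unfolding Neg_def by blast+

lemma Neg_mono: "T \<turnstile> a \<sqdot>\<rightarrow> b \<Longrightarrow> T \<turnstile> Neg b \<sqdot>\<rightarrow> Neg a"
  unfolding Neg_def using prov_mp[OF _ prov_ax[OF L2]] by blast

text \<open>The disjunctive conclusions of this shape are closed under the rules, because their
  disjuncts lie below \<open>\<^bold>t\<close>: the product of two of them lies below the disjunction again.\<close>

lemma or_fuse:
  assumes xy: "T \<turnstile> (x \<sqdot>& y) \<sqdot>\<rightarrow> w" and "T \<turnstile> x \<sqdot>\<rightarrow> \<^bold>t" "T \<turnstile> y \<sqdot>\<rightarrow> \<^bold>t" "T \<turnstile> z \<sqdot>\<rightarrow> \<^bold>t"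
    and or: "T \<turnstile> x \<sqdot>\<or> z" "T \<turnstile> y \<sqdot>\<or> z"
  shows "T \<turnstile> w \<sqdot>\<or> z"
proof -
  let ?r = "w \<sqdot>\<or> z"
  have z: "T \<turnstile> z \<sqdot>\<rightarrow> (v \<sqdot>\<rightarrow> ?r)" if "T \<turnstile> v \<sqdot>\<rightarrow> \<^bold>t" for v
  proof -
    have "T \<turnstile> (v \<sqdot>& z) \<sqdot>\<rightarrow> ?r"
      using fuse_mono1[OF that, of z] truth_fuse(1) imp_or(2) imp_trans by blast
    then show ?thesis unfolding fuse_imp_iff by (rule imp_exchange)
  qed
  have "T \<turnstile> y \<sqdot>\<rightarrow> (x \<sqdot>\<rightarrow> ?r)"
    using imp_trans[OF xy imp_or(1)] unfolding fuse_imp_iff by (rule imp_exchange)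
  then have "T \<turnstile> (y \<sqdot>\<or> z) \<sqdot>\<rightarrow> (x \<sqdot>\<rightarrow> ?r)" using z[OF assms(2)] by (rule or_imp)
  then have "T \<turnstile> x \<sqdot>\<rightarrow> ((y \<sqdot>\<or> z) \<sqdot>\<rightarrow> ?r)" by (rule imp_exchange)
  moreover have "T \<turnstile> z \<sqdot>\<rightarrow> ((y \<sqdot>\<or> z) \<sqdot>\<rightarrow> ?r)"
    using assms(3,4) by (intro z or_imp)
  ultimately have "T \<turnstile> (x \<sqdot>\<or> z) \<sqdot>\<rightarrow> ((y \<sqdot>\<or> z) \<sqdot>\<rightarrow> ?r)" by (rule or_imp)
  then show ?thesis using or prov_mp by blast
qed

text \<open>This takes the place of a deduction theorem, which would need powers of the hypothesis
  because modus ponens can use it repeatedly. The side disjunct, kept below the unit, is carried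
  through the derivation, and \<open>or_fuse\<close> merges the two premises of a rule.\<close>

lemma prov_disjunct:
  assumes "insert a T \<turnstile> \<gamma>" and "T \<turnstile> (a \<sqdot>\<and> \<^bold>t) \<sqdot>\<or> (z \<sqdot>\<and> \<^bold>t)"
  shows "T \<turnstile> (\<gamma> \<sqdot>\<and> \<^bold>t) \<sqdot>\<or> (z \<sqdot>\<and> \<^bold>t)"
  using assms(1)
proof induction
  have *: "T \<turnstile> (\<gamma> \<sqdot>\<and> \<^bold>t) \<sqdot>\<or> (z \<sqdot>\<and> \<^bold>t)" if "T \<turnstile> \<gamma>" for \<gamma>
    using that truth IULfp_consequence.Adj imp_or(1) prov_mp by blast
  {
    case (Hyp \<alpha>)
    then show ?case using * assms(2) IULfp_consequence.Hyp by blast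
  next
    case (Ax \<alpha>)
    then show ?case using * prov_ax by blast
  next
    case (MP \<alpha> \<beta>)
    have "T \<turnstile> (\<alpha> \<sqdot>& (\<alpha> \<sqdot>\<rightarrow> \<beta>)) \<sqdot>\<rightarrow> \<beta>"
      unfolding fuse_imp_iff using imp_refl by (rule imp_exchange)
    from imp_trans[OF fuse_mono[OF and_imp(1) and_imp(1)] this]
    have 1: "T \<turnstile> ((\<alpha> \<sqdot>\<and> \<^bold>t) \<sqdot>& ((\<alpha> \<sqdot>\<rightarrow> \<beta>) \<sqdot>\<and> \<^bold>t)) \<sqdot>\<rightarrow> \<beta>" .
    have 2: "T \<turnstile> ((\<alpha> \<sqdot>\<and> \<^bold>t) \<sqdot>& ((\<alpha> \<sqdot>\<rightarrow> \<beta>) \<sqdot>\<and> \<^bold>t)) \<sqdot>\<rightarrow> \<^bold>t"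
      using imp_trans[OF fuse_mono[OF and_imp(2) and_imp(2)] truth_fuse(1)] .
    show ?case
      using or_fuse[OF imp_and[OF 1 2] and_imp(2) and_imp(2) and_imp(2) MP.IH] .
  next
    case (Adj \<alpha> \<beta>)
    let ?x = "\<alpha> \<sqdot>\<and> \<^bold>t" and ?y = "\<beta> \<sqdot>\<and> \<^bold>t"
    have x: "T \<turnstile> (?x \<sqdot>& ?y) \<sqdot>\<rightarrow> ?x"
      using imp_trans[OF fuse_comm imp_trans[OF fuse_mono1[OF and_imp(2)] truth_fuse(1)]] .
    have y: "T \<turnstile> (?x \<sqdot>& ?y) \<sqdot>\<rightarrow> ?y"
      using imp_trans[OF fuse_mono1[OF and_imp(2)] truth_fuse(1)] .
    have "T \<turnstile> (?x \<sqdot>& ?y) \<sqdot>\<rightarrow> ((\<alpha> \<sqdot>\<and> \<beta>) \<sqdot>\<and> \<^bold>t)"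
      by (rule imp_and[OF imp_and[OF imp_trans[OF x and_imp(1)] imp_trans[OF y and_imp(1)]] imp_trans[OF x and_imp(2)]])
    from or_fuse[OF this and_imp(2) and_imp(2) and_imp(2) Adj.IH] show ?case .
  }
qed

text \<open>Proof by cases on the two implications: starting from the prelinearity axiom, each
  disjunct in turn is replaced by \<open>\<phi>\<close>.\<close>

lemma prov_prelinear:
  assumes "insert (a \<sqdot>\<rightarrow> b) T \<turnstile> \<phi>" "insert (b \<sqdot>\<rightarrow> a) T \<turnstile> \<phi>"
  shows "T \<turnstile> \<phi>"
proof -
  have swap: "T \<turnstile> x \<sqdot>\<or> y \<Longrightarrow> T \<turnstile> y \<sqdot>\<or> x" for x y
    using or_imp[OF imp_or(2) imp_or(1)] prov_mp by blast
  have "T \<turnstile> (\<phi> \<sqdot>\<and> \<^bold>t) \<sqdot>\<or> ((b \<sqdot>\<rightarrow> a) \<sqdot>\<and> \<^bold>t)"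
    using assms(1) prov_ax[OF PRL] by (rule prov_disjunct)
  then have "T \<turnstile> (\<phi> \<sqdot>\<and> \<^bold>t) \<sqdot>\<or> (\<phi> \<sqdot>\<and> \<^bold>t)"
    using assms(2) swap prov_disjunct by blast
  then show ?thesis using or_imp[OF and_imp(1) and_imp(1)] prov_mp by blast
qed

text \<open>Derivations are finite, and in a chain of theories the larger of two theories supports
  both premises of a rule.\<close>

lemma prov_Union_chain:
  assumes "subset.chain UNIV \<T>" "\<T> \<noteq> {}" "\<Union>\<T> \<turnstile> \<phi>"
  shows "\<exists>T\<in>\<T>. T \<turnstile> \<phi>"
proof -
  have join: "\<exists>T\<in>\<T>. T \<turnstile> \<alpha> \<and> T \<turnstile> \<beta>" if "\<exists>T\<in>\<T>. T \<turnstile> \<alpha>" "\<exists>T\<in>\<T>. T \<turnstile> \<beta>" for \<alpha> \<beta>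
  proof -
    from that obtain S T where ST: "S \<in> \<T>" "S \<turnstile> \<alpha>" "T \<in> \<T>" "T \<turnstile> \<beta>" by blast
    then have "S \<subseteq> T \<or> T \<subseteq> S" using assms(1) by (auto simp: subset_chain_def)
    then show ?thesis using ST prov_mono by blast
  qed
  from assms(3) show ?thesis
  proof induction
    case (Hyp \<alpha>)
    then show ?case using IULfp_consequence.Hyp by blast
  next
    case (Ax \<alpha>)
    then show ?case using assms(2) prov_ax by blast
  next
    case (MP \<alpha> \<beta>)
    then show ?case using join prov_mp by blast
  next
    case (Adj \<alpha> \<beta>)
    then show ?case using join IULfp_consequence.Adj by blast
  qed
qed

text \<open>Adding an underivable formula to a maximal theory yields \<open>\<phi>\<close>; if both
  implications were underivable, \<open>prov_prelinear\<close> would derive \<open>\<phi>\<close>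
  from the theory itself.\<close>

lemma linear_extension:
  assumes "\<not> T \<turnstile> \<phi>"
  obtains Th where "T \<subseteq> Th" "\<not> Th \<turnstile> \<phi>" "\<And>a b. Th \<turnstile> a \<sqdot>\<rightarrow> b \<or> Th \<turnstile> b \<sqdot>\<rightarrow> a"
proof -
  let ?S = "{Th. T \<subseteq> Th \<and> \<not> Th \<turnstile> \<phi>}"
  have "\<exists>M\<in>?S. \<forall>X\<in>?S. M \<subseteq> X \<longrightarrow> X = M"
  proof (rule subset_Zorn_nonempty)
    show "?S \<noteq> {}" using assms by auto
    fix \<T> assume \<T>: "\<T> \<noteq> {}" "subset.chain ?S \<T>"
    then have "subset.chain UNIV \<T>" "\<T> \<subseteq> ?S" by (auto simp: subset_chain_def)
    then show "\<Union>\<T> \<in> ?S" using prov_Union_chain \<T>(1) by blast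
  qed
  then obtain M where M: "T \<subseteq> M" "\<not> M \<turnstile> \<phi>" "\<And>X. T \<subseteq> X \<Longrightarrow> \<not> X \<turnstile> \<phi> \<Longrightarrow> M \<subseteq> X \<Longrightarrow> X = M" by auto
  have ext: "insert c M \<turnstile> \<phi>" if "\<not> M \<turnstile> c" for c
  proof (rule ccontr)
    assume "\<not> insert c M \<turnstile> \<phi>"
    then have "insert c M = M" using M by blast
    then show False using that IULfp_consequence.Hyp by blast
  qed
  have "M \<turnstile> a \<sqdot>\<rightarrow> b \<or> M \<turnstile> b \<sqdot>\<rightarrow> a" for a b
    using ext prov_prelinear M(2) by blast
  with M that show thesis by blast
qed

section \<open>The Lindenbaum chain and the countermodel\<close>

locale linear_theory =
  fixes Th :: "fm set"
  assumes linear: "Th \<turnstile> a \<sqdot>\<rightarrow> b \<or> Th \<turnstile> b \<sqdot>\<rightarrow> a"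
begin

text \<open>A chosen representative stands for the class of equivalent formulas, so the elements of
  the chain are formulas and its order is derivability of the implication itself.\<close>

definition rep :: "fm \<Rightarrow> fm" where
  "rep a = (SOME b. Th \<turnstile> a \<sqdot>\<rightarrow> b \<and> Th \<turnstile> b \<sqdot>\<rightarrow> a)"

lemma rep: "Th \<turnstile> a \<sqdot>\<rightarrow> rep a" "Th \<turnstile> rep a \<sqdot>\<rightarrow> a"
  using someI[of "\<lambda>b. Th \<turnstile> a \<sqdot>\<rightarrow> b \<and> Th \<turnstile> b \<sqdot>\<rightarrow> a" a] imp_refl unfolding rep_def by blast+

lemma rep_imp_iff [simp]: "Th \<turnstile> rep a \<sqdot>\<rightarrow> rep b \<longleftrightarrow> Th \<turnstile> a \<sqdot>\<rightarrow> b"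
  using rep imp_trans by meson

lemma rep_eqI: "Th \<turnstile> a \<sqdot>\<rightarrow> b \<Longrightarrow> Th \<turnstile> b \<sqdot>\<rightarrow> a \<Longrightarrow> rep a = rep b"
  unfolding rep_def by (rule arg_cong[of _ _ Eps]) (use imp_trans in blast)

abbreviation chain_mul where "chain_mul a b \<equiv> rep (a \<sqdot>& b)"
abbreviation chain_neg where "chain_neg a \<equiv> rep (Neg a)"
abbreviation chain_le where "chain_le a b \<equiv> Th \<turnstile> a \<sqdot>\<rightarrow> b"

lemma mul_rep: "chain_mul (rep a) (rep b) = rep (a \<sqdot>& b)"
  using rep by (intro rep_eqI fuse_mono)

lemma neg_rep: "chain_neg (rep a) = rep (Neg a)"
  using rep by (intro rep_eqI Neg_mono)

lemma odd_chain: "odd_chain (range rep) chain_mul (rep \<^bold>t) chain_neg chain_le"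
proof
  fix x y z
  assume "x \<in> range rep"
  then obtain a where x: "x = rep a" by blast
  show "chain_neg x \<in> range rep" by blast
  show "chain_mul (rep \<^bold>t) x = x"
    unfolding x mul_rep using truth_fuse by (intro rep_eqI)
  show "chain_neg (chain_neg x) = x"
    unfolding x neg_rep using Neg_Neg by (intro rep_eqI)
  assume "y \<in> range rep"
  then obtain b where y: "y = rep b" by blast
  show "chain_mul x y \<in> range rep" by blast
  show "chain_mul x y = chain_mul y x"
    unfolding x y mul_rep using fuse_comm by (intro rep_eqI)
  show "chain_le x y \<Longrightarrow> chain_le y x \<Longrightarrow> x = y"
    unfolding x y rep_imp_iff by (rule rep_eqI)
  show "chain_le x y \<or> chain_le y x" by (rule linear)
  show "chain_le (chain_mul x y) (rep \<^bold>t) \<longleftrightarrow> chain_le y (chain_neg x)"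
    unfolding x y mul_rep neg_rep rep_imp_iff by (rule imp_Neg_iff)
  assume "z \<in> range rep"
  then obtain c where z: "z = rep c" by blast
  show "chain_mul (chain_mul x y) z = chain_mul x (chain_mul y z)"
    unfolding x y z mul_rep using fuse_assoc1 fuse_assoc2 by (intro rep_eqI)
  show "chain_le x y \<Longrightarrow> chain_le y z \<Longrightarrow> chain_le x z" by (rule imp_trans)
qed blast

sublocale odd_chain "range rep" chain_mul "rep \<^bold>t" chain_neg chain_le
  by (rule odd_chain)

text \<open>An \<open>odd_chain\<close> has no residual of its own, so implication has to be
  expressed by product and negation; both sides have the same formulas below them by
  \<open>mul_le_iff\<close>.\<close>

lemma rep_imp: "rep (a \<sqdot>\<rightarrow> b) = rep (Neg (a \<sqdot>& Neg b))"
proof -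
  have *: "Th \<turnstile> c \<sqdot>\<rightarrow> (a \<sqdot>\<rightarrow> b) \<longleftrightarrow> Th \<turnstile> c \<sqdot>\<rightarrow> Neg (a \<sqdot>& Neg b)" for c
  proof -
    have "Th \<turnstile> c \<sqdot>\<rightarrow> (a \<sqdot>\<rightarrow> b) \<longleftrightarrow> Th \<turnstile> (a \<sqdot>& c) \<sqdot>\<rightarrow> b"
      unfolding fuse_imp_iff using imp_exchange by blast
    also have "\<dots> \<longleftrightarrow> chain_le (chain_mul (rep a) (rep c)) (rep b)" by (simp add: mul_rep)
    also have "\<dots> \<longleftrightarrow> chain_le (rep c) (chain_neg (chain_mul (rep a) (chain_neg (rep b))))"
      by (rule mul_le_iff) simp_all
    finally show ?thesis by (simp add: mul_rep neg_rep)
  qed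
  show ?thesis using *[of "a \<sqdot>\<rightarrow> b"] *[of "Neg (a \<sqdot>& Neg b)"] imp_refl by (intro rep_eqI) blast+
qed

lemma rep_and: "rep (a \<sqdot>\<and> b) = (if Th \<turnstile> a \<sqdot>\<rightarrow> b then rep a else rep b)"
proof (cases "Th \<turnstile> a \<sqdot>\<rightarrow> b")
  case True
  then show ?thesis using rep_eqI[of "a \<sqdot>\<and> b" a] and_imp imp_and imp_refl by simp
next
  case False
  then have "Th \<turnstile> b \<sqdot>\<rightarrow> a" using linear by blast
  then show ?thesis using False rep_eqI[of "a \<sqdot>\<and> b" b] and_imp imp_and imp_refl by simp
qed

lemma rep_or: "rep (a \<sqdot>\<or> b) = (if Th \<turnstile> a \<sqdot>\<rightarrow> b then rep b else rep a)"
proof (cases "Th \<turnstile> a \<sqdot>\<rightarrow> b")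
  case True
  then show ?thesis using rep_eqI[of "a \<sqdot>\<or> b" b] imp_or or_imp imp_refl by simp
next
  case False
  then have "Th \<turnstile> b \<sqdot>\<rightarrow> a" using linear by blast
  then show ?thesis using False rep_eqI[of "a \<sqdot>\<or> b" a] imp_or or_imp imp_refl by simp
qed

lemma rep_falsity: "rep \<^bold>f = rep \<^bold>t"
  using truth_falsity by (intro rep_eqI)

text \<open>The embedding into the unit interval controls the negation of the top, so the bottom
  constant has to be identified with it.\<close>

lemma rep_bot: "rep \<^bold>\<bottom> = chain_neg (rep \<^bold>\<top>)"
proof -
  have "Th \<turnstile> Neg \<^bold>\<top> \<sqdot>\<rightarrow> Neg (Neg \<^bold>\<bottom>)" using prov_ax[OF L13] by (rule Neg_mono)
  then have "Th \<turnstile> Neg \<^bold>\<top> \<sqdot>\<rightarrow> \<^bold>\<bottom>" using Neg_Neg(1) imp_trans by blast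
  then show ?thesis unfolding neg_rep using prov_ax[OF L12] by (intro rep_eqI)
qed

text \<open>If the top were the unit, the negation of every formula would lie below the unit, hence
  every formula above it, that is, every formula would be derivable. This excludes the trivial chain
  from the embedding into the unit interval.\<close>

lemma rep_top_ne:
  assumes "\<not> Th \<turnstile> \<phi>"
  shows "rep \<^bold>\<top> \<noteq> rep \<^bold>t"
proof
  assume "rep \<^bold>\<top> = rep \<^bold>t"
  then have "Th \<turnstile> \<^bold>\<top> \<sqdot>\<rightarrow> \<^bold>t" using rep_imp_iff[of "\<^bold>\<top>" "\<^bold>t"] imp_refl by metis
  then have "Th \<turnstile> Neg \<phi> \<sqdot>\<rightarrow> \<^bold>t" using prov_ax[OF L13] imp_trans by blast
  then have "chain_le (chain_neg (rep \<phi>)) (chain_neg (rep \<^bold>t))" unfolding n_e by (simp add: neg_rep)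
  then have "chain_le (rep \<^bold>t) (rep \<phi>)" using n_le_iff[of "rep \<^bold>t" "rep \<phi>"] by simp
  then show False using assms by (simp add: truth_imp_iff)
qed

end

text \<open>An implication is evaluated as \<open>n (x \<cdot> n y)\<close>, so its parts include the arguments of these operations.\<close>

primrec parts :: "fm \<Rightarrow> fm set" where
  "parts (Var i) = {Var i}"
| "parts (\<alpha> \<sqdot>\<and> \<beta>) = insert (\<alpha> \<sqdot>\<and> \<beta>) (parts \<alpha> \<union> parts \<beta>)"
| "parts (\<alpha> \<sqdot>\<or> \<beta>) = insert (\<alpha> \<sqdot>\<or> \<beta>) (parts \<alpha> \<union> parts \<beta>)"
| "parts (\<alpha> \<sqdot>& \<beta>) = insert (\<alpha> \<sqdot>& \<beta>) (parts \<alpha> \<union> parts \<beta>)"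
| "parts (\<alpha> \<sqdot>\<rightarrow> \<beta>) = {\<alpha> \<sqdot>\<rightarrow> \<beta>, Neg \<beta>, \<alpha> \<sqdot>& Neg \<beta>} \<union> (parts \<alpha> \<union> parts \<beta>)"
| "parts \<^bold>t = {\<^bold>t}"
| "parts \<^bold>f = {\<^bold>f}"
| "parts \<^bold>\<top> = {\<^bold>\<top>}"
| "parts \<^bold>\<bottom> = {\<^bold>\<bottom>}"

lemma finite_parts: "finite (parts \<alpha>)"
  by (induction \<alpha>) auto

lemma self_parts: "\<alpha> \<in> parts \<alpha>"
  by (cases \<alpha>) auto

definition interval_algebra :: "(real \<Rightarrow> real \<Rightarrow> real) \<Rightarrow> real \<Rightarrow> (real \<Rightarrow> real) \<Rightarrow> real bounded_fle" where
  "interval_algebra m e n = \<lparr>carrier = {0..1}, monoid.mult = m, monoid.one = e, meet = min, join = max,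
     res = (\<lambda>x y. n (m x (n y))), falsum = e, top_el = 1, bot_el = 0\<rparr>"

lemma interval_algebra_simps [simp]:
  "carrier (interval_algebra m e n) = {0..1}" "monoid.mult (interval_algebra m e n) = m"
  "monoid.one (interval_algebra m e n) = e" "meet (interval_algebra m e n) = min"
  "join (interval_algebra m e n) = max" "res (interval_algebra m e n) = (\<lambda>x y. n (m x (n y)))"
  "falsum (interval_algebra m e n) = e" "top_el (interval_algebra m e n) = 1"
  "bot_el (interval_algebra m e n) = 0"
  by (simp_all add: interval_algebra_def)

lemma fle_le_interval_algebra [simp]: "fle_le (interval_algebra m e n) x y \<longleftrightarrow> x \<le> y"
  by (simp add: fle_le_def min_def)

lemma standard_interval_algebra:
  assumes "odd_chain {0..1} m e n (\<le>)"
  shows "standard_IULfp_algebra (interval_algebra m e n)"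
proof -
  interpret odd_chain "{0..1}" m e n "(\<le>)" by fact
  have e: "0 \<le> e" "e \<le> 1" using e_closed by auto
  have "bounded_odd_FLe_algebra (interval_algebra m e n)"
  proof
    fix x y z
    let ?A = "interval_algebra m e n"
    show "\<one>\<^bsub>?A\<^esub> \<in> carrier ?A" "falsum ?A \<in> carrier ?A" "top_el ?A \<in> carrier ?A" "bot_el ?A \<in> carrier ?A"
      "\<one>\<^bsub>?A\<^esub> = falsum ?A"
      using e by auto
    assume x: "x \<in> carrier ?A"
    show "\<one>\<^bsub>?A\<^esub> \<otimes>\<^bsub>?A\<^esub> x = x" "x \<otimes>\<^bsub>?A\<^esub> \<one>\<^bsub>?A\<^esub> = x" "fle_le ?A x (top_el ?A)" "fle_le ?A (bot_el ?A) x"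
      using x e_mul mul_e by auto
    show "fle_neg ?A (fle_neg ?A x) = x"
      using x n_closed[of x] by (simp add: fle_neg_def)
    assume y: "y \<in> carrier ?A"
    show "x \<otimes>\<^bsub>?A\<^esub> y \<in> carrier ?A" "res ?A x y \<in> carrier ?A"
      using x y by (simp_all only: interval_algebra_simps mul_closed n_closed)
    show "meet ?A x y \<in> carrier ?A" "join ?A x y \<in> carrier ?A"
      "meet ?A x y = meet ?A y x" "join ?A x y = join ?A y x"
      "meet ?A x (join ?A x y) = x" "join ?A x (meet ?A x y) = x"
      using x y by (simp_all add: min_def max_def)
    show "x \<otimes>\<^bsub>?A\<^esub> y = y \<otimes>\<^bsub>?A\<^esub> x"
      using x y by (simp only: interval_algebra_simps comm)
    assume z: "z \<in> carrier ?A"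
    show "x \<otimes>\<^bsub>?A\<^esub> y \<otimes>\<^bsub>?A\<^esub> z = x \<otimes>\<^bsub>?A\<^esub> (y \<otimes>\<^bsub>?A\<^esub> z)"
      using x y z by (simp only: interval_algebra_simps assoc)
    show "meet ?A (meet ?A x y) z = meet ?A x (meet ?A y z)" "join ?A (join ?A x y) z = join ?A x (join ?A y z)"
      by (simp_all add: min.assoc max.assoc)
    show "fle_le ?A (x \<otimes>\<^bsub>?A\<^esub> y) z \<longleftrightarrow> fle_le ?A y (res ?A x z)"
      using x y z by (simp only: interval_algebra_simps fle_le_interval_algebra mul_le_iff)
  qed
  then show ?thesis by (simp add: standard_IULfp_algebra_def)
qed

context linear_theory
begin

lemma eval_embedding:
  assumes "partial_embedding (range rep) chain_mul (rep \<^bold>t) chain_neg chain_le (rep ` F) {0..1 :: real} m e n (\<le>) \<rho>"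
    and top: "\<rho> (rep \<^bold>\<top>) = 1" "\<rho> (rep \<^bold>\<bottom>) = 0"
    and v: "\<And>i. Var i \<in> F \<Longrightarrow> v i = \<rho> (rep (Var i))"
    and "parts \<alpha> \<subseteq> F"
  shows "eval_fm (interval_algebra m e n) v \<alpha> = \<rho> (rep \<alpha>)"
  using assms(5)
proof (induction \<alpha>)
  interpret partial_embedding "range rep" chain_mul "rep \<^bold>t" chain_neg chain_le "rep ` F" "{0..1 :: real}" m e n "(\<le>)" \<rho>
    by fact
  have mul: "\<rho> (rep (\<alpha> \<sqdot>& \<beta>)) = m (\<rho> (rep \<alpha>)) (\<rho> (rep \<beta>))" if "{\<alpha>, \<beta>, \<alpha> \<sqdot>& \<beta>} \<subseteq> F" for \<alpha> \<beta>
    using \<rho>_mul[of "rep \<alpha>" "rep \<beta>"] that by (simp add: mul_rep)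
  have neg: "\<rho> (rep (Neg \<alpha>)) = n (\<rho> (rep \<alpha>))" if "rep \<alpha> \<in> rep ` F" "rep (Neg \<alpha>) \<in> rep ` F" for \<alpha>
    using \<rho>_n[of "rep \<alpha>"] that by (simp add: neg_rep)
  have le: "Th \<turnstile> \<alpha> \<sqdot>\<rightarrow> \<beta> \<longleftrightarrow> \<rho> (rep \<alpha>) \<le> \<rho> (rep \<beta>)" if "\<alpha> \<in> F" "\<beta> \<in> F" for \<alpha> \<beta>
    using \<rho>_le[of "rep \<alpha>" "rep \<beta>"] that by simp
  {
    case (And \<alpha> \<beta>)
    then have "\<alpha> \<in> F" "\<beta> \<in> F" using self_parts by auto
    then show ?case using And le by (simp add: rep_and)
  next
    case (Or \<alpha> \<beta>)
    then have "\<alpha> \<in> F" "\<beta> \<in> F" using self_parts by auto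
    then show ?case using Or le by (simp add: rep_or)
  next
    case (Fuse \<alpha> \<beta>)
    then have "{\<alpha>, \<beta>, \<alpha> \<sqdot>& \<beta>} \<subseteq> F" using self_parts by auto
    then show ?case using Fuse mul by simp
  next
    case (Imp \<alpha> \<beta>)
    then have F: "{\<alpha>, \<beta>, Neg \<beta>, \<alpha> \<sqdot>& Neg \<beta>, \<alpha> \<sqdot>\<rightarrow> \<beta>} \<subseteq> F" using self_parts by auto
    \<comment> \<open>The formula \<open>Neg (\<alpha> \<sqdot>& Neg \<beta>)\<close> need not be in
      \<open>F\<close>, but it has the same representative as the implication, which is in
      \<open>F\<close>. This is why \<open>neg\<close> asks for membership of
      representatives.\<close>
    then have "rep (Neg (\<alpha> \<sqdot>& Neg \<beta>)) \<in> rep ` F" using rep_imp[of \<alpha> \<beta>] by (metis imageI insert_subset)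
    then have "\<rho> (rep (\<alpha> \<sqdot>\<rightarrow> \<beta>)) = n (m (\<rho> (rep \<alpha>)) (n (\<rho> (rep \<beta>))))"
      using F mul neg by (simp add: rep_imp)
    then show ?case using Imp by simp
  }
qed (use v top rep_falsity partial_embedding.\<rho>_e[OF assms(1)] in auto)

end

theorem standard_countermodel:
  assumes T: "finite T" and "\<not> T \<turnstile> \<phi>"
  shows "\<exists>(A :: real bounded_fle) v. standard_IULfp_algebra A \<and> is_model A v T \<and> \<not> is_model A v {\<phi>}"
proof -
  obtain Th where Th: "T \<subseteq> Th" "\<not> Th \<turnstile> \<phi>" "\<And>a b. Th \<turnstile> a \<sqdot>\<rightarrow> b \<or> Th \<turnstile> b \<sqdot>\<rightarrow> a"
    using linear_extension[OF assms(2)] by blast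
  interpret linear_theory Th by unfold_locales (rule Th)
  define F where "F = insert \<^bold>t (\<Union> (parts ` insert \<phi> T))"
  have F: "finite F" "\<^bold>t \<in> F" "\<And>\<alpha>. \<alpha> \<in> insert \<phi> T \<Longrightarrow> parts \<alpha> \<subseteq> F"
    using T finite_parts unfolding F_def by auto
  have "Th \<turnstile> x \<sqdot>\<rightarrow> rep \<^bold>\<top>" for x
    using imp_trans[OF prov_ax[OF L13] rep(1)] .
  then obtain m e n \<rho> where emb:
    "partial_embedding (range rep) chain_mul (rep \<^bold>t) chain_neg chain_le (rep ` F) {0..1 :: real} m e n (\<le>) \<rho>"
    and top: "\<rho> (rep \<^bold>\<top>) = 1" "\<rho> (chain_neg (rep \<^bold>\<top>)) = 0"
    using unit_interval_embedding[of "rep ` F" "rep \<^bold>\<top>"] F(1,2) rep_top_ne[OF Th(2)]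
    by blast
  interpret partial_embedding "range rep" chain_mul "rep \<^bold>t" chain_neg chain_le "rep ` F" "{0..1 :: real}" m e n "(\<le>)" \<rho>
    by (rule emb)
  let ?A = "interval_algebra m e n"
  \<comment> \<open>The value 0 keeps the remaining variables inside the carrier; the formulas at
    hand contain no variable outside \<open>F\<close>.\<close>
  define v where "v i = (if Var i \<in> F then \<rho> (rep (Var i)) else 0)" for i
  have v: "v i \<in> {0..1}" for i
    unfolding v_def using \<rho>_closed[of "rep (Var i)"] by auto
  have holds: "fle_le ?A (monoid.one ?A) (eval_fm ?A v \<alpha>) \<longleftrightarrow> Th \<turnstile> \<alpha>" if "\<alpha> \<in> insert \<phi> T" for \<alpha>
  proof -
    have "eval_fm ?A v \<alpha> = \<rho> (rep \<alpha>)"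
      using emb top(1) top(2)[folded rep_bot] _ F(3)[OF that] by (rule eval_embedding) (simp add: v_def)
    moreover have "\<alpha> \<in> F" using F(3)[OF that] self_parts by blast
    ultimately show ?thesis
      using \<rho>_le[of "rep \<^bold>t" "rep \<alpha>"] \<rho>_e F(2) by (simp add: truth_imp_iff)
  qed
  have "standard_IULfp_algebra ?A" using target by (rule standard_interval_algebra)
  moreover have "is_model ?A v T"
    using v holds Th(1) IULfp_consequence.Hyp by (auto simp: is_model_def simp del: fle_le_interval_algebra)
  moreover have "\<not> is_model ?A v {\<phi>}"
    using holds Th(2) by (auto simp: is_model_def simp del: fle_le_interval_algebra)
  ultimately show ?thesis by blast
qed

theorem theorem2:
  fixes T :: "fm set" and \<phi> :: fm
  assumes "finite T"
  shows "T \<Turnstile>\<^sub>I\<^sub>U\<^sub>L\<^sub>f\<^sub>p \<phi> \<longleftrightarrow>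
    (\<forall>(A :: real bounded_fle) e.
       standard_IULfp_algebra A \<longrightarrow> is_model A e T \<longrightarrow> is_model A e {\<phi>})"
proof
  assume \<phi>: "T \<turnstile> \<phi>"
  show "\<forall>(A :: real bounded_fle) e. standard_IULfp_algebra A \<longrightarrow> is_model A e T \<longrightarrow> is_model A e {\<phi>}"
  proof (intro allI impI)
    fix A :: "real bounded_fle" and e
    assume A: "standard_IULfp_algebra A" and e: "is_model A e T"
    interpret bounded_odd_FLe_algebra A using A by (simp add: standard_IULfp_algebra_def)
    interpret bounded_odd_FLe_chain A
      using A by unfold_locales (auto simp: standard_IULfp_algebra_def fle_le_def min_def)
    show "is_model A e {\<phi>}"
      using consequence_sound[OF \<phi> e] e by (simp add: is_model_def)
  qed
next
  assume "\<forall>(A :: real bounded_fle) e. standard_IULfp_algebra A \<longrightarrow> is_model A e T \<longrightarrow> is_model A e {\<phi>}"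
  then show "T \<turnstile> \<phi>" using standard_countermodel[OF assms] by blast
qed

end
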